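(* Let $M$ and $M'$ be pure motives over $\mathbb{Q}$ with coefficients in a number field $\mathbb{E}$ such that: (1) $M$ is critical and $d^{+}(M)=d^{-}(M)$; (2) $M'$ is a direct sum of critical motives; (3) $M\otimes M'$ is critical. Then, in $(\mathbb{E}\otimes_{\mathbb{Q}}\mathbb{C})^\times/\mathbb{E}^\times$, \[ \frac{c^{+}(M\otimes M')}{c^{-}(M\otimes M')} = \left( \frac{c^{+}(M)}{c^{-}(M)}\right)^{\mathrm{Tr}(\rho|_{H_{B}(M')})}, \] where $\mathrm{Tr}(\rho|_{H_B(M')})=d^+(M')-d^-(M')$ is the trace of complex conjugation on the Betti realization of $M'$.
   Context: For a pure motive $M$ over $\mathbb{Q}$ with coefficients in $\mathbb{E}$: $H_B(M)$ is its Betti realization, a finite-dimensional $\mathbb{E}$-vector space with involution $\rho$ (complex conjugation) whose $\pm1$-eigenspaces $H_B^\pm(M)$ have dimensions $d^{\pm}(M)$; $H_{DR}(M)$ is its de Rham realization, an $\mathbb{E}$-vector space with decreasing Hodge filtration $F^p$, with comparison isomorphism $I:H_B(M)\otimes_{\mathbb{Q}}\mathbb{C}\to H_{DR}(M)\otimes_{\mathbb{Q}}\mathbb{C}$ compatible with the Hodge decomposition $H_B(M)\otimes\mathbb{C}=\bigoplus_{p+q=w}H^{p,q}$ (i.e. $I(\bigoplus_{p'\ge p}H^{p',q})=F^p\otimes\mathbb{C}$). $M$ is critical if there are Hodge filtration steps $F^{\pm}(M)$ with $\dim_{\mathbb{E}}H_{DR}(M)/F^{\mp}(M)=d^{\pm}(M)$.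 Deligne's periods $c^{\pm}(M)\in(\mathbb{E}\otimes_{\mathbb{Q}}\mathbb{C})^\times/\mathbb{E}^\times$ are the determinants, in $\mathbb{E}$-rational bases, of $H_B^{\pm}(M)\otimes\mathbb{C}\to H_{DR}(M)\otimes\mathbb{C}\to (H_{DR}(M)/F^{\mp}(M))\otimes\mathbb{C}$. Tensor products of motives have realizations the tensor products of the realizations. *)

theory Defs
  imports
    "HOL-Algebra.Coset"
    "Jordan_Normal_Form.Determinant"
    Complex_Main
begin

section \<open>Extension of scalars from \<open>\<rat>\<close> to \<open>\<complex>\<close>\<close>

text \<open>Formal sums of pairs modulo the relations of the tensor product. All spaces below are
  \<open>\<rat>\<close>-vector spaces, and on these biadditive is the same as \<open>\<rat>\<close>-bilinear (see
  \<open>tens_rat\<close> below), so that the quotient is the tensor product with \<open>\<complex>\<close> over \<open>\<rat>\<close>.\<close>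

inductive tensor_eq :: "('a::ab_group_add \<times> complex) list \<Rightarrow> ('a \<times> complex) list \<Rightarrow> bool" where
  te_refl: "tensor_eq xs xs"
| te_sym: "tensor_eq xs ys \<Longrightarrow> tensor_eq ys xs"
| te_trans: "tensor_eq xs ys \<Longrightarrow> tensor_eq ys zs \<Longrightarrow> tensor_eq xs zs"
| te_append: "tensor_eq xs xs' \<Longrightarrow> tensor_eq ys ys' \<Longrightarrow> tensor_eq (xs @ ys) (xs' @ ys')"
| te_comm: "tensor_eq (xs @ ys) (ys @ xs)"
| te_zero_left: "tensor_eq [(0, z)] []"
| te_zero_right: "tensor_eq [(v, 0)] []"
| te_add_left: "tensor_eq [(v + w, z)] [(v, z), (w, z)]"
| te_add_right: "tensor_eq [(v, z + z')] [(v, z), (v, z')]"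

quotient_type (overloaded) 'a tensor_C = "('a::ab_group_add \<times> complex) list" / tensor_eq
  by (rule equivpI) (auto simp: reflp_def symp_def transp_def intro: te_refl te_sym te_trans)

lift_definition tens :: "'a::ab_group_add \<Rightarrow> complex \<Rightarrow> 'a tensor_C" is "\<lambda>a z. [(a, z)]" .

instantiation tensor_C :: (ab_group_add) ab_group_add
begin

lift_definition zero_tensor_C :: "'a tensor_C" is "[]" .

lift_definition plus_tensor_C :: "'a tensor_C \<Rightarrow> 'a tensor_C \<Rightarrow> 'a tensor_C" is "(@)"
  by (rule te_append)

lift_definition uminus_tensor_C :: "'a tensor_C \<Rightarrow> 'a tensor_C" is "map (\<lambda>(a, z). (- a, z))"
proof -
  fix xs ys :: "('a \<times> complex) list"
  assume "tensor_eq xs ys"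
  then show "tensor_eq (map (\<lambda>(a, z). (- a, z)) xs) (map (\<lambda>(a, z). (- a, z)) ys)"
  proof induction
    case (te_add_left v w z)
    show ?case using tensor_eq.te_add_left[of "- v" "- w" z] by simp
  qed (auto intro: tensor_eq.intros)
qed

definition minus_tensor_C :: "'a tensor_C \<Rightarrow> 'a tensor_C \<Rightarrow> 'a tensor_C" where
  "minus_tensor_C x y = x + - y"

instance
proof
  fix x y z :: "'a tensor_C"
  show "x + y + z = x + (y + z)" by transfer (simp add: te_refl)
  show "x + y = y + x" by transfer (rule te_comm)
  show "0 + x = x" by transfer (simp add: te_refl)
  show "x - y = x + - y" by (rule minus_tensor_C_def)
  show "- x + x = 0"
  proof transfer
    fix xs :: "('a \<times> complex) list"
    let ?m = "map (\<lambda>(a, z). (- a, z))"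
    show "tensor_eq (?m xs @ xs) []"
    proof (induction xs)
      case Nil
      show ?case by (simp add: te_refl)
    next
      case (Cons p xs)
      obtain a z where p: "p = (a, z)" by (cases p)
      have 1: "tensor_eq [(- a, z), (a, z)] []"
        using te_trans[OF te_sym[OF te_add_left[of "- a" a z]]] te_zero_left[of z] by simp
      have 2: "tensor_eq (?m xs @ [(a, z)]) ([(a, z)] @ ?m xs)" by (rule te_comm)
      have "tensor_eq ([(- a, z)] @ (?m xs @ [(a, z)]) @ xs) ([(- a, z)] @ ([(a, z)] @ ?m xs) @ xs)"
        by (intro te_append te_refl 2)
      moreover have "tensor_eq ([(- a, z), (a, z)] @ (?m xs @ xs)) ([] @ [])"
        by (intro te_append 1 Cons)
      ultimately show ?case using p by (auto intro: te_trans)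
    qed
  qed
qed

end

lemma tens_add_left: "tens (v + w) z = tens v z + tens w z"
  by transfer (simp add: te_add_left)

lemma tens_add_right: "tens v (z + z') = tens v z + tens v z'"
  by transfer (simp add: te_add_right)

lemma tens_zero_left [simp]: "tens 0 z = 0"
  by transfer (rule te_zero_left)

lemma tens_zero_right [simp]: "tens v 0 = 0"
  by transfer (rule te_zero_right)

lemma tensor_C_induct [case_names zero tens add]:
  fixes x :: "'a::ab_group_add tensor_C"
  assumes "P 0" "\<And>a z. P (tens a z)" "\<And>x y. P x \<Longrightarrow> P y \<Longrightarrow> P (x + y)"
  shows "P x"
proof (induction x rule: tensor_C.abs_induct)
  case (1 xs)
  show ?case
  proof (induction xs)
    case Nil
    then show ?case using assms(1) by (simp add: zero_tensor_C.abs_eq)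
  next
    case (Cons p xs)
    obtain a z where p: "p = (a, z)" by (cases p)
    have "abs_tensor_C (p # xs) = tens a z + abs_tensor_C xs"
      by (simp add: p tens.abs_eq plus_tensor_C.abs_eq)
    then show ?case using assms(2,3) Cons by metis
  qed
qed

definition biadditive ::
    "('a::ab_group_add \<Rightarrow> 'b::ab_group_add \<Rightarrow> 'c::ab_group_add) \<Rightarrow> bool" where
  "biadditive \<beta> \<longleftrightarrow>
     (\<forall>x y z. \<beta> (x + y) z = \<beta> x z + \<beta> y z) \<and> (\<forall>x y z. \<beta> x (y + z) = \<beta> x y + \<beta> x z)"

text \<open>The additive map induced by a biadditive map; a junk value if \<open>\<beta>\<close> is not biadditive.\<close>

definition tens_lift ::
    "('a::ab_group_add \<Rightarrow> complex \<Rightarrow> 'c::ab_group_add) \<Rightarrow> 'a tensor_C \<Rightarrow> 'c" where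
  "tens_lift \<beta> x = (\<Sum>(a, z)\<leftarrow>rep_tensor_C x. \<beta> a z)"

lemma biadditive_zero:
  assumes "biadditive \<beta>" shows "\<beta> 0 y = 0" "\<beta> x 0 = 0"
proof -
  have "\<beta> (0 + 0) y = \<beta> 0 y + \<beta> 0 y" "\<beta> x (0 + 0) = \<beta> x 0 + \<beta> x 0"
    using assms unfolding biadditive_def by blast+
  then show "\<beta> 0 y = 0" "\<beta> x 0 = 0" by simp_all
qed

lemma tensor_eq_sum:
  assumes "tensor_eq xs ys" "biadditive \<beta>"
  shows "(\<Sum>(a, z)\<leftarrow>xs. \<beta> a z) = (\<Sum>(a, z)\<leftarrow>ys. \<beta> a z)"
  using assms(1)
proof induction
  case (te_add_left v w z)
  show ?case using assms(2) by (simp add: biadditive_def)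
next
  case (te_add_right v z z')
  show ?case using assms(2) by (simp add: biadditive_def)
next
  case (te_comm xs ys)
  show ?case by (simp only: map_append sum_list_append add.commute)
next
  case (te_append xs xs' ys ys')
  then show ?case by (simp only: map_append sum_list_append)
next
  case (te_sym xs ys)
  from te_sym.IH show ?case by (rule sym)
next
  case (te_trans xs ys zs)
  from te_trans.IH show ?case by (rule trans)
qed (simp_all add: biadditive_zero[OF assms(2)])

lemma tens_lift_abs:
  assumes "biadditive \<beta>"
  shows "tens_lift \<beta> (abs_tensor_C xs) = (\<Sum>(a, z)\<leftarrow>xs. \<beta> a z)"
  unfolding tens_lift_def
  by (rule tensor_eq_sum[OF _ assms]) (rule Quotient3_rep_abs[OF Quotient3_tensor_C te_refl])

lemma tens_lift_tens: "biadditive \<beta> \<Longrightarrow> tens_lift \<beta> (tens a z) = \<beta> a z"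
  by (simp add: tens.abs_eq tens_lift_abs)

lemma tens_lift_zero: "biadditive \<beta> \<Longrightarrow> tens_lift \<beta> 0 = 0"
  by (simp add: zero_tensor_C.abs_eq tens_lift_abs)

lemma tens_lift_add:
  assumes "biadditive \<beta>" shows "tens_lift \<beta> (x + y) = tens_lift \<beta> x + tens_lift \<beta> y"
proof (induction x rule: tensor_C.abs_induct)
  case (1 xs)
  show ?case
    by (induction y rule: tensor_C.abs_induct)
       (simp add: plus_tensor_C.abs_eq tens_lift_abs assms)
qed

lemma tens_biadditive: "biadditive tens"
  by (simp add: biadditive_def tens_add_left tens_add_right)

text \<open>\<open>f \<otimes> 1\<close> for an additive map \<open>f\<close>, and complex conjugation \<open>1 \<otimes> c\<close> on the coefficients.\<close>

definition tens_map :: "('a::ab_group_add \<Rightarrow> 'b::ab_group_add) \<Rightarrow> 'a tensor_C \<Rightarrow> 'b tensor_C" where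
  "tens_map f = tens_lift (\<lambda>a z. tens (f a) z)"

definition tens_cnj :: "'a::ab_group_add tensor_C \<Rightarrow> 'a tensor_C" where
  "tens_cnj = tens_lift (\<lambda>a z. tens a (cnj z))"

text \<open>The \<open>\<complex>\<close>-bilinear extension \<open>(a \<otimes> z, b \<otimes> w) \<mapsto> t a b \<otimes> z w\<close> of a biadditive map \<open>t\<close>.\<close>

definition tens_prod ::
    "('a::ab_group_add \<Rightarrow> 'b::ab_group_add \<Rightarrow> 'c::ab_group_add) \<Rightarrow>
     'a tensor_C \<Rightarrow> 'b tensor_C \<Rightarrow> 'c tensor_C" where
  "tens_prod t x y = tens_lift (\<lambda>a z. tens_lift (\<lambda>b w. tens (t a b) (z * w)) y) x"

context
  fixes t :: "'a::ab_group_add \<Rightarrow> 'b::ab_group_add \<Rightarrow> 'c::ab_group_add"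
  assumes t: "biadditive t"
begin

lemma tens_prod_inner: "biadditive (\<lambda>b w. tens (t a b) (z * w))"
  using t by (simp add: biadditive_def tens_add_left tens_add_right algebra_simps)

lemma tens_prod_outer: "biadditive (\<lambda>a z. tens_lift (\<lambda>b w. tens (t a b) (z * w)) y)"
proof (induction y rule: tensor_C_induct)
  case zero
  show ?case by (simp add: tens_lift_zero[OF tens_prod_inner] biadditive_def)
next
  case (tens a z)
  show ?case using t
    by (simp add: tens_lift_tens[OF tens_prod_inner] biadditive_def tens_add_left
        tens_add_right algebra_simps)
next
  case (add x y)
  then show ?case
    by (simp add: tens_lift_add[OF tens_prod_inner] biadditive_def)
qed

lemma tens_prod_tens_left:
  "tens_prod t (tens a z) y = tens_lift (\<lambda>b w. tens (t a b) (z * w)) y"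
  unfolding tens_prod_def by (rule tens_lift_tens[OF tens_prod_outer])

lemma tens_prod_tens: "tens_prod t (tens a z) (tens b w) = tens (t a b) (z * w)"
  unfolding tens_prod_tens_left by (rule tens_lift_tens[OF tens_prod_inner])

lemma tens_prod_add_left: "tens_prod t (x + x') y = tens_prod t x y + tens_prod t x' y"
  unfolding tens_prod_def by (rule tens_lift_add[OF tens_prod_outer])

lemma tens_prod_zero_left: "tens_prod t 0 y = 0"
  unfolding tens_prod_def by (rule tens_lift_zero[OF tens_prod_outer])

lemma tens_prod_add_right: "tens_prod t x (y + y') = tens_prod t x y + tens_prod t x y'"
proof (induction x rule: tensor_C_induct)
  case (tens a z)
  show ?case unfolding tens_prod_tens_left by (rule tens_lift_add[OF tens_prod_inner])
qed (simp_all add: tens_prod_add_left tens_prod_zero_left)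

lemma tens_prod_zero_right: "tens_prod t x 0 = 0"
  using tens_prod_add_right[of x 0 0] by simp

end

lemma biadditive_times: "biadditive ((*) :: 'a::ring \<Rightarrow> 'a \<Rightarrow> 'a)"
  by (simp add: biadditive_def algebra_simps)

lemma exists_additive_rat:
  "\<exists>f :: 'a::field_char_0 \<Rightarrow> rat. (\<forall>x y. f (x + y) = f x + f y) \<and> f 1 = 1"
proof -
  have "vector_space (\<lambda>q (x::'a). of_rat q * x)"
    by unfold_locales (simp_all add: of_rat_add of_rat_mult distrib_left distrib_right mult.assoc)
  moreover have "vector_space ((*) :: rat \<Rightarrow> rat \<Rightarrow> rat)"
    by unfold_locales (simp_all add: distrib_left distrib_right mult.assoc)
  ultimately interpret vector_space_pair "\<lambda>q (x::'a). of_rat q * x" "(*) :: rat \<Rightarrow> rat \<Rightarrow> rat"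
    by (rule vector_space_pair.intro)
  have "vs1.independent {1::'a}"
    by (simp add: vs1.dependent_single)
  from linear_independent_extend[OF this, of "\<lambda>_. 1"]
  obtain f where "Vector_Spaces.linear (\<lambda>q (x::'a). of_rat q * x) (*) f" "f 1 = (1::rat)"
    by auto
  then show ?thesis
    by (intro exI[of _ f]) (simp add: linear_add)
qed

instantiation tensor_C :: (field_char_0) comm_ring_1
begin

definition times_tensor_C :: "'a tensor_C \<Rightarrow> 'a tensor_C \<Rightarrow> 'a tensor_C" where
  "times_tensor_C = tens_prod (*)"

definition one_tensor_C :: "'a tensor_C" where
  "one_tensor_C = tens 1 1"

instance
proof
  note defs = times_tensor_C_def one_tensor_C_def
  note rules = tens_prod_tens[OF biadditive_times] tens_prod_add_left[OF biadditive_times]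
    tens_prod_add_right[OF biadditive_times] tens_prod_zero_left[OF biadditive_times]
    tens_prod_zero_right[OF biadditive_times]
  fix x y z :: "'a tensor_C"
  show "x * y = y * x" unfolding defs
  proof (induction x rule: tensor_C_induct)
    case (tens a u)
    show ?case by (induction y rule: tensor_C_induct) (simp_all add: rules mult.commute)
  qed (simp_all add: rules)
  show "x * y * z = x * (y * z)" unfolding defs
  proof (induction x rule: tensor_C_induct)
    case (tens a u)
    show ?case
    proof (induction y rule: tensor_C_induct)
      case (tens b v)
      show ?case by (induction z rule: tensor_C_induct) (simp_all add: rules mult.assoc)
    qed (simp_all add: rules)
  qed (simp_all add: rules)
  show "1 * x = x" unfolding defs
    by (induction x rule: tensor_C_induct) (simp_all add: rules)
  show "(x + y) * z = x * z + y * z" unfolding defs by (simp add: rules)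
  show "(0 :: 'a tensor_C) \<noteq> 1"
  proof
    obtain f :: "'a \<Rightarrow> rat" where f: "\<And>x y. f (x + y) = f x + f y" "f 1 = 1"
      using exists_additive_rat by blast
    have b: "biadditive (\<lambda>a z. of_rat (f a) * z :: complex)"
      by (simp add: biadditive_def f of_rat_add algebra_simps)
    assume "(0 :: 'a tensor_C) = 1"
    then have "tens_lift (\<lambda>a z. of_rat (f a) * z :: complex) 0 = 
      tens_lift (\<lambda>a z. of_rat (f a) * z) (tens (1 :: 'a) 1)"
      by (simp add: defs)
    then show False by (simp add: tens_lift_zero[OF b] tens_lift_tens[OF b] f)
  qed
qed

end

lemma biadditive_scale: "vector_space s \<Longrightarrow> biadditive s"
  by (simp add: biadditive_def vector_space_def)

lemma tens_rat:
  fixes s :: "'e::field_char_0 \<Rightarrow> 'v::ab_group_add \<Rightarrow> 'v"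
  assumes "vector_space s"
  shows "tens (s (of_rat q) v) z = tens v (of_rat q * z)"
proof -
  interpret vector_space s by fact
  have nat: "tens (s (of_nat n) v) z = tens v (of_nat n * z)" for n v and z
    by (induction n) (simp_all add: scale_left_distrib distrib_right tens_add_left tens_add_right)
  have int: "tens (s (of_int k) v) z = tens v (of_int k * z)" for k v and z
  proof (cases k rule: int_cases2)
    case (nonneg n)
    then show ?thesis using nat by simp
  next
    case (nonpos n)
    have "tens (s (of_int k) v) z + tens (s (of_nat n) v) z = 0"
      by (simp add: nonpos flip: tens_add_left)
    moreover have "tens v (of_int k * z) + tens v (of_nat n * z) = 0"
      by (simp add: nonpos flip: tens_add_right)
    ultimately show ?thesis using nat by (metis add_right_cancel)
  qed
  obtain a b where q: "q = of_int a / of_int b" "b > 0"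
    using quotient_of_div[of q] quotient_of_denom_pos' by (metis prod.collapse)
  let ?u = "s (inverse (of_int b)) v"
  have u: "s (of_int b) ?u = v" using q by simp
  have r: "(of_rat q :: 'e) = of_int a * inverse (of_int b)"
    "(of_rat q :: complex) = of_int a / of_int b"
    unfolding q(1) of_rat_divide of_rat_of_int_eq by (simp_all only: divide_inverse)
  have "s (of_rat q) v = s (of_int a) ?u"
    by (simp add: r)
  then have "tens (s (of_rat q) v) z = tens ?u (of_int a * z)" by (simp only: int)
  also have "\<dots> = tens ?u (of_int b * (of_rat q * z))"
    using q(2) by (simp add: r(2))
  also have "\<dots> = tens v (of_rat q * z)" by (simp only: u flip: int)
  finally show ?thesis .
qed

text \<open>\<open>tens_prod s\<close> is scalar multiplication by \<open>E \<otimes> \<complex>\<close> on \<open>V \<otimes> \<complex>\<close>.\<close>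

lemma module_tens_prod:
  fixes s :: "'e::field_char_0 \<Rightarrow> 'v::ab_group_add \<Rightarrow> 'v"
  assumes "vector_space s"
  shows "Modules.module (tens_prod s)"
proof -
  interpret vector_space s by fact
  note s = biadditive_scale[OF assms]
  note rules = tens_prod_tens[OF s] tens_prod_add_left[OF s] tens_prod_add_right[OF s]
    tens_prod_zero_left[OF s] tens_prod_zero_right[OF s]
    tens_prod_tens[OF biadditive_times] tens_prod_add_left[OF biadditive_times]
    tens_prod_add_right[OF biadditive_times] tens_prod_zero_left[OF biadditive_times]
    tens_prod_zero_right[OF biadditive_times]
  show ?thesis
  proof
    fix a b :: "'e tensor_C" and x y :: "'v tensor_C"
    show "tens_prod s a (x + y) = tens_prod s a x + tens_prod s a y"
      "tens_prod s (a + b) x = tens_prod s a x + tens_prod s b x" by (simp_all add: rules)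
    show "tens_prod s 1 x = x" unfolding one_tensor_C_def
      by (induction x rule: tensor_C_induct) (simp_all add: rules)
    show "tens_prod s a (tens_prod s b x) = tens_prod s (a * b) x" unfolding times_tensor_C_def
    proof (induction a rule: tensor_C_induct)
      case (tens a u)
      show ?case
      proof (induction b rule: tensor_C_induct)
        case (tens b v)
        show ?case by (induction x rule: tensor_C_induct) (simp_all add: rules mult.assoc)
      qed (simp_all add: rules)
    qed (simp_all add: rules)
  qed
qed

text \<open>The image of \<open>V \<otimes> \<complex>\<close> for a subspace \<open>V\<close>; it is isomorphic to \<open>V \<otimes> \<complex>\<close> by flatness.\<close>

definition ext_C :: "'a::ab_group_add set \<Rightarrow> 'a tensor_C set" where
  "ext_C V = {\<Sum>(v, z)\<leftarrow>xs. tens v z | xs. fst ` set xs \<subseteq> V}"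


section \<open>Linear algebra\<close>

definition number_field :: "'e::field_char_0 itself \<Rightarrow> bool" where
  "number_field _ \<longleftrightarrow>
     (\<exists>S :: 'e set. finite S \<and> Modules.module.span (\<lambda>q x. of_rat q * x) S = UNIV)"

definition finite_dim :: "('e::field \<Rightarrow> 'v::ab_group_add \<Rightarrow> 'v) \<Rightarrow> bool" where
  "finite_dim s \<longleftrightarrow> (\<exists>S. finite S \<and> Modules.module.span s S = UNIV)"

definition is_basis :: "('e::field \<Rightarrow> 'v::ab_group_add \<Rightarrow> 'v) \<Rightarrow> 'v set \<Rightarrow> 'v set \<Rightarrow> bool" where
  "is_basis s V B \<longleftrightarrow> \<not> Modules.module.dependent s B \<and> Modules.module.span s B = V"

text \<open>The images of the vectors in the list form a basis of the quotient by \<open>F\<close>.\<close>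

definition is_quotient_basis ::
    "('e::field \<Rightarrow> 'v::ab_group_add \<Rightarrow> 'v) \<Rightarrow> 'v set \<Rightarrow> 'v list \<Rightarrow> bool" where
  "is_quotient_basis s F ws \<longleftrightarrow>
     (\<forall>x. \<exists>!c. (\<forall>i \<ge> length ws. c i = 0) \<and> x - (\<Sum>i<length ws. s (c i) (ws ! i)) \<in> F)"

definition trace_of ::
    "('e::field \<Rightarrow> 'v::ab_group_add \<Rightarrow> 'v) \<Rightarrow> ('v \<Rightarrow> 'v) \<Rightarrow> 'e" where
  "trace_of s f = (let B = (SOME B. is_basis s UNIV B)
     in \<Sum>b\<in>B. Modules.module.representation s B (f b) b)"

text \<open>The whole space is the internal direct sum of the family \<open>X\<close> (with finitely supported
  sums if the index set is infinite).\<close>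

definition internal_direct_sum :: "'i set \<Rightarrow> ('i \<Rightarrow> 'v::ab_group_add set) \<Rightarrow> bool" where
  "internal_direct_sum J X \<longleftrightarrow>
     (\<forall>x. \<exists>!f. (\<forall>i\<in>J. f i \<in> X i) \<and> (\<forall>i. i \<notin> J \<longrightarrow> f i = 0) \<and>
        finite {i. f i \<noteq> 0} \<and> x = (\<Sum>i | f i \<noteq> 0. f i))"

text \<open>A bilinear map \<open>t\<close> exhibiting its target as the tensor product of its two sources.\<close>

definition is_tensor_product ::
    "('e::field \<Rightarrow> 'u::ab_group_add \<Rightarrow> 'u) \<Rightarrow> ('e \<Rightarrow> 'v::ab_group_add \<Rightarrow> 'v) \<Rightarrow>
     ('e \<Rightarrow> 'w::ab_group_add \<Rightarrow> 'w) \<Rightarrow> ('u \<Rightarrow> 'v \<Rightarrow> 'w) \<Rightarrow> bool" where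
  "is_tensor_product s1 s2 s3 t \<longleftrightarrow>
     (\<forall>v. Vector_Spaces.linear s1 s3 (\<lambda>u. t u v)) \<and> (\<forall>u. Vector_Spaces.linear s2 s3 (t u)) \<and>
     (\<forall>B C. is_basis s1 UNIV B \<longrightarrow> is_basis s2 UNIV C \<longrightarrow>
        inj_on (case_prod t) (B \<times> C) \<and> is_basis s3 UNIV (case_prod t ` (B \<times> C)))"


section \<open>Realizations of pure motives\<close>

text \<open>A motive over \<open>\<rat>\<close> with coefficients in \<open>'e\<close> enters only through its realizations. The Betti
  space is all of \<open>'b\<close> and the de Rham space all of \<open>'d\<close>. Besides the decomposition and the
  comparison with the filtration, the axioms contain the two Hodge symmetries: complex conjugation
  of the coefficients and the involution \<open>rho\<close> both exchange \<open>H\<^sup>p\<^sup>q\<close> and \<open>H\<^sup>q\<^sup>p\<close>. The second one makes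
  the maps that define the periods invertible.\<close>

record (overloaded) ('e, 'b, 'd) realization =
  weight :: int
  scaleB :: "'e::field_char_0 \<Rightarrow> 'b::ab_group_add \<Rightarrow> 'b"
  rho :: "'b \<Rightarrow> 'b"
  hodge :: "int \<Rightarrow> int \<Rightarrow> 'b tensor_C set"
  scaleD :: "'e \<Rightarrow> 'd::ab_group_add \<Rightarrow> 'd"
  fil :: "int \<Rightarrow> 'd set"
  comp :: "'b tensor_C \<Rightarrow> 'd tensor_C"

locale pure_realization =
  fixes M :: "('e::field_char_0, 'b::ab_group_add, 'd::ab_group_add) realization"
  assumes betti: "vector_space (scaleB M)" "finite_dim (scaleB M)"
    and de_rham: "vector_space (scaleD M)" "finite_dim (scaleD M)"
    and rho_linear: "Vector_Spaces.linear (scaleB M) (scaleB M) (rho M)"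
    and rho_involution: "rho M (rho M v) = v"
    and fil_subspace: "Modules.module.subspace (scaleD M) (fil M p)"
    and fil_decreasing: "p \<le> p' \<Longrightarrow> fil M p' \<subseteq> fil M p"
    and fil_finite: "\<exists>p. fil M p = UNIV" "\<exists>p. fil M p = {0}"
    and hodge_submodule: "Modules.module.subspace (tens_prod (scaleB M)) (hodge M p q)"
    and hodge_weight: "p + q \<noteq> weight M \<Longrightarrow> hodge M p q = {0}"
    and hodge_decomposition:
      "internal_direct_sum {(p, q). p + q = weight M} (\<lambda>(p, q). hodge M p q)"
    and hodge_cnj: "tens_cnj ` hodge M p q = hodge M q p"
    and hodge_rho: "tens_map (rho M) ` hodge M p q = hodge M q p"
    and comp_linear: "Modules.module_hom (tens_prod (scaleB M)) (tens_prod (scaleD M)) (comp M)"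
    and comp_bij: "bij (comp M)"
    and comp_fil: "comp M ` Modules.module.span (tens_prod (scaleB M)) (\<Union>p'\<in>{p..}. \<Union>q. hodge M p' q)
      = ext_C (fil M p)"

definition is_tensor_realization ::
    "('b1::ab_group_add \<Rightarrow> 'b2::ab_group_add \<Rightarrow> 'b3::ab_group_add) \<Rightarrow>
     ('d1::ab_group_add \<Rightarrow> 'd2::ab_group_add \<Rightarrow> 'd3::ab_group_add) \<Rightarrow>
     ('e::field_char_0, 'b1, 'd1) realization \<Rightarrow> ('e, 'b2, 'd2) realization \<Rightarrow>
     ('e, 'b3, 'd3) realization \<Rightarrow> bool" where
  "is_tensor_realization tB tD M M' N \<longleftrightarrow>
     is_tensor_product (scaleB M) (scaleB M') (scaleB N) tB \<and>
     is_tensor_product (scaleD M) (scaleD M') (scaleD N) tD \<and>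
     weight N = weight M + weight M' \<and>
     (\<forall>v v'. rho N (tB v v') = tB (rho M v) (rho M' v')) \<and>
     (\<forall>p. fil N p = Modules.module.span (scaleD N)
        (\<Union>a. {tD x x' | x x'. x \<in> fil M a \<and> x' \<in> fil M' (p - a)})) \<and>
     (\<forall>p q. hodge N p q = Modules.module.span (tens_prod (scaleB N))
        (\<Union>a. \<Union>b. {tens_prod tB x x' | x x'. x \<in> hodge M a b \<and> x' \<in> hodge M' (p - a) (q - b)})) \<and>
     (\<forall>x x'. comp N (tens_prod tB x x') = tens_prod tD (comp M x) (comp M' x'))"

text \<open>A subobject: Betti part \<open>U\<close> and de Rham part \<open>W\<close>, with the restricted structure.\<close>

definition is_subrealization ::
    "('e::field_char_0, 'b::ab_group_add, 'd::ab_group_add) realization \<Rightarrow> 'b set \<Rightarrow> 'd set \<Rightarrow> bool"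
  where
  "is_subrealization M U W \<longleftrightarrow>
     Modules.module.subspace (scaleB M) U \<and> Modules.module.subspace (scaleD M) W \<and>
     rho M ` U \<subseteq> U \<and> comp M ` ext_C U = ext_C W \<and>
     ext_C U = Modules.module.span (tens_prod (scaleB M)) (\<Union>p. \<Union>q. hodge M p q \<inter> ext_C U)"

text \<open>Signs \<open>\<plusminus>\<close> are the elements \<open>1\<close> and \<open>-1\<close> of the coefficient field.\<close>

definition eigenspace ::
    "('e::field_char_0, 'b::ab_group_add, 'd::ab_group_add) realization \<Rightarrow> 'e \<Rightarrow> 'b set" where
  "eigenspace M \<epsilon> = {v. rho M v = scaleB M \<epsilon> v}"

definition sub_eig_dim ::
    "('e::field_char_0, 'b::ab_group_add, 'd::ab_group_add) realization \<Rightarrow> 'b set \<Rightarrow> 'e \<Rightarrow> nat" where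
  "sub_eig_dim M U \<epsilon> = vector_space.dim (scaleB M) (U \<inter> eigenspace M \<epsilon>)"

text \<open>\<open>F\<close> is the filtration step of \<open>W\<close> that is called \<open>F\<^sup>\<mp>\<close> for the sign \<open>\<epsilon> = \<plusminus>1\<close>.\<close>

definition sub_hodge_step ::
    "('e::field_char_0, 'b::ab_group_add, 'd::ab_group_add) realization \<Rightarrow> 'b set \<Rightarrow> 'd set \<Rightarrow>
     'e \<Rightarrow> 'd set \<Rightarrow> bool" where
  "sub_hodge_step M U W \<epsilon> F \<longleftrightarrow> (\<exists>p. F = W \<inter> fil M p) \<and>
     vector_space.dim (scaleD M) W - vector_space.dim (scaleD M) F = sub_eig_dim M U \<epsilon>"

definition sub_critical ::
    "('e::field_char_0, 'b::ab_group_add, 'd::ab_group_add) realization \<Rightarrow> 'b set \<Rightarrow> 'd set \<Rightarrow> bool"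
  where
  "sub_critical M U W \<longleftrightarrow> (\<exists>F. sub_hodge_step M U W 1 F) \<and> (\<exists>F. sub_hodge_step M U W (-1) F)"

abbreviation eig_dim ::
    "('e::field_char_0, 'b::ab_group_add, 'd::ab_group_add) realization \<Rightarrow> 'e \<Rightarrow> nat" where
  "eig_dim M \<equiv> sub_eig_dim M UNIV"

abbreviation critical ::
    "('e::field_char_0, 'b::ab_group_add, 'd::ab_group_add) realization \<Rightarrow> bool" where
  "critical M \<equiv> sub_critical M UNIV UNIV"

definition direct_sum_of_critical ::
    "('e::field_char_0, 'b::ab_group_add, 'd::ab_group_add) realization \<Rightarrow> bool" where
  "direct_sum_of_critical M \<longleftrightarrow>
     (\<exists>(k::nat) U W. internal_direct_sum {..<k} U \<and> internal_direct_sum {..<k} W \<and>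
        (\<forall>j<k. is_subrealization M (U j) (W j) \<and> sub_critical M (U j) (W j)))"


section \<open>Deligne's periods\<close>

definition coeff_units :: "'e::field_char_0 tensor_C monoid" where
  "coeff_units = \<lparr>carrier = {u. u dvd 1}, monoid.mult = (*), one = 1\<rparr>"

definition field_units :: "'e::field_char_0 tensor_C set" where
  "field_units = {tens e 1 | e. e \<noteq> 0}"

definition period_group :: "'e::field_char_0 tensor_C set monoid" where
  "period_group = coeff_units Mod field_units"

text \<open>\<open>A\<close> is the matrix of \<open>H\<^sup>\<epsilon> \<otimes> \<complex> \<rightarrow> (H/F) \<otimes> \<complex>\<close> in the rational bases \<open>vs\<close> and \<open>ws\<close>.\<close>

definition is_period_matrix ::
    "('e::field_char_0, 'b::ab_group_add, 'd::ab_group_add) realization \<Rightarrow> 'e \<Rightarrow>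
     'e tensor_C mat \<Rightarrow> bool" where
  "is_period_matrix M \<epsilon> A \<longleftrightarrow>
     (\<exists>F vs ws. sub_hodge_step M UNIV UNIV \<epsilon> F \<and>
        distinct vs \<and> is_basis (scaleB M) (eigenspace M \<epsilon>) (set vs) \<and>
        is_quotient_basis (scaleD M) F ws \<and>
        A \<in> carrier_mat (length ws) (length vs) \<and>
        (\<forall>j<length vs. comp M (tens (vs ! j) 1)
           - (\<Sum>i<length ws. tens_prod (scaleD M) (A $$ (i, j)) (tens (ws ! i) 1)) \<in> ext_C F))"

text \<open>The period is the common class of the determinants of all period matrices.\<close>

definition period ::
    "('e::field_char_0, 'b::ab_group_add, 'd::ab_group_add) realization \<Rightarrow> 'e \<Rightarrow> 'e tensor_C set"
  where
  "period M \<epsilon> = (THE c. \<exists>A. is_period_matrix M \<epsilon> A \<and> c = field_units #>\<^bsub>coeff_units\<^esub> det A)"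

definition period_ratio ::
    "('e::field_char_0, 'b::ab_group_add, 'd::ab_group_add) realization \<Rightarrow> 'e tensor_C set" where
  "period_ratio M = period M 1 \<otimes>\<^bsub>period_group\<^esub> inv\<^bsub>period_group\<^esub> period M (-1)"

end

theory Submission
  imports Defs
begin

text \<open>Write \<open>V\<close>, \<open>V'\<close> for the complexified Betti spaces, with Hodge types centred at \<open>0\<close>. As the two
  eigenspaces of \<open>\<rho>\<close> on \<open>M\<close> have the same dimension \<open>n\<close>, criticality forces both signs to use the
  same filtration step \<open>F\<close>, of half the total dimension, and since \<open>\<rho>\<close> reverses Hodge types there is
  no middle type. So the vectors of negative type have a basis \<open>e\<^sub>1, \<dots>, e\<^sub>n\<close>, and \<open>\<rho> e\<^sub>i \<in> F\<close>. Hence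
  \<open>e\<^sub>i\<close>, \<open>e\<^sub>i + \<rho> e\<^sub>i\<close> and \<open>e\<^sub>i - \<rho> e\<^sub>i\<close> agree modulo \<open>F\<close>, and if \<open>\<alpha>\<close>, \<open>\<beta>\<close> are the determinants of
  \<open>(e\<^sub>i + \<rho> e\<^sub>i)\<close>, \<open>(e\<^sub>i - \<rho> e\<^sub>i)\<close> in rational bases of the eigenspaces, then \<open>c\<^sup>+ \<alpha> = c\<^sup>- \<beta>\<close>.

  The same applies to \<open>M \<otimes> M'\<close>. For a basis \<open>f\<^sub>k\<close> of \<open>V'\<close> of pure types, exactly one of \<open>e\<^sub>i \<otimes> f\<^sub>k\<close> and
  its image under \<open>\<rho>\<close> has negative type, so up to sign the relevant vectors are the symmetrizations
  and antisymmetrizations of the \<open>e\<^sub>i \<otimes> f\<^sub>k\<close>. These have one and the same coefficient matrix in the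
  bases \<open>(e\<^sub>i \<plusminus> \<rho> e\<^sub>i) \<otimes> v'\<^sub>\<plusminus>\<close> and \<open>(e\<^sub>i \<mp> \<rho> e\<^sub>i) \<otimes> v'\<^sub>\<plusminus>\<close>, where \<open>v'\<^sub>\<plusminus>\<close> runs through rational bases
  of the eigenspaces of \<open>M'\<close>. With \<open>d\<^sup>\<plusminus> = d\<^sup>\<plusminus>(M')\<close> the determinants of these two bases are
  \<open>\<alpha>\<close> to the power \<open>d\<^sup>+\<close> times \<open>\<beta>\<close> to the power \<open>d\<^sup>-\<close>, and the same with \<open>\<alpha>\<close> and \<open>\<beta>\<close> exchanged,
  so the ratio of the periods is \<open>(\<beta> / \<alpha>)\<close> to the power \<open>d\<^sup>+ - d\<^sup>-\<close>.\<close>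

section \<open>Determinants over commutative rings\<close>

text \<open>The determinants live over E \<otimes> \<complex>, a ring which in general has zero
  divisors. Induction on \<open>m\<close> peels the identity block off one row and column at a time,
  each time splitting off a last block of size one.\<close>

lemma det_block_diag_one_right:
  fixes A :: "'a::comm_ring_1 mat"
  assumes A: "A \<in> carrier_mat n n"
  shows "det (four_block_mat A (0\<^sub>m n m) (0\<^sub>m m n) (1\<^sub>m m)) = det A"
proof (induction m)
  case 0
  have "four_block_mat A (0\<^sub>m n 0) (0\<^sub>m 0 n) (1\<^sub>m 0) = A"
    using A by (intro eq_matI) auto
  then show ?case by simp
next
  case (Suc m)
  let ?B = "four_block_mat A (0\<^sub>m n m) (0\<^sub>m m n) (1\<^sub>m m)"
  have "four_block_mat A (0\<^sub>m n (Suc m)) (0\<^sub>m (Suc m) n) (1\<^sub>m (Suc m))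
      = four_block_mat ?B (0\<^sub>m (n + m) 1) (0\<^sub>m 1 (n + m)) (1\<^sub>m 1)"
    using A by (intro eq_matI) auto
  moreover have "det \<dots> = det ?B * det (1\<^sub>m 1 :: 'a mat)"
    using A by (intro det_four_block_mat_upper_right_zero_col) auto
  ultimately show ?case using Suc by simp
qed

lemma det_block_diag_one_left:
  fixes B :: "'a::comm_ring_1 mat"
  assumes B: "B \<in> carrier_mat m m"
  shows "det (four_block_mat (1\<^sub>m n) (0\<^sub>m n m) (0\<^sub>m m n) B) = det B"
proof (induction n)
  case 0
  have "four_block_mat (1\<^sub>m 0) (0\<^sub>m 0 m) (0\<^sub>m m 0) B = B"
    using B by (intro eq_matI) auto
  then show ?case by simp
next
  case (Suc n)
  let ?B = "four_block_mat (1\<^sub>m n) (0\<^sub>m n m) (0\<^sub>m m n) B"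
  have "four_block_mat (1\<^sub>m (Suc n)) (0\<^sub>m (Suc n) m) (0\<^sub>m m (Suc n)) B
      = four_block_mat (1\<^sub>m 1) (0\<^sub>m 1 (n + m)) (0\<^sub>m (n + m) 1) ?B"
  proof (rule eq_matI)
    fix i j
    assume "i < dim_row (four_block_mat (1\<^sub>m 1) (0\<^sub>m 1 (n + m)) (0\<^sub>m (n + m) 1) ?B)"
      "j < dim_col (four_block_mat (1\<^sub>m 1) (0\<^sub>m 1 (n + m)) (0\<^sub>m (n + m) 1) ?B)"
    then have "i < Suc n + m" "j < Suc n + m" using B by auto
    then show "four_block_mat (1\<^sub>m (Suc n)) (0\<^sub>m (Suc n) m) (0\<^sub>m m (Suc n)) B $$ (i, j)
        = four_block_mat (1\<^sub>m 1) (0\<^sub>m 1 (n + m)) (0\<^sub>m (n + m) 1) ?B $$ (i, j)"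
      using B by (cases i; cases j) auto
  qed (use B in auto)
  moreover have "det \<dots> = det (1\<^sub>m 1 :: 'a mat) * det ?B"
    using B by (intro det_four_block_mat_lower_left_zero_col) auto
  ultimately show ?case using Suc by simp
qed

text \<open>The block matrix is diag(\<open>A\<close>, 1) times diag(1, \<open>B\<close>), so
  multiplicativity of \<open>det\<close> reduces to one identity block at a time.\<close>

lemma det_block_diag:
  fixes A B :: "'a::comm_ring_1 mat"
  assumes A: "A \<in> carrier_mat n n" and B: "B \<in> carrier_mat m m"
  shows "det (four_block_mat A (0\<^sub>m n m) (0\<^sub>m m n) B) = det A * det B"
proof -
  have "four_block_mat A (0\<^sub>m n m) (0\<^sub>m m n) (1\<^sub>m m) * four_block_mat (1\<^sub>m n) (0\<^sub>m n m) (0\<^sub>m m n) B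
      = four_block_mat A (0\<^sub>m n m) (0\<^sub>m m n) B"
    using A B by (subst mult_four_block_mat[of _ n n _ m _ m]) auto
  then have "det (four_block_mat A (0\<^sub>m n m) (0\<^sub>m m n) B)
      = det (four_block_mat A (0\<^sub>m n m) (0\<^sub>m m n) (1\<^sub>m m))
        * det (four_block_mat (1\<^sub>m n) (0\<^sub>m n m) (0\<^sub>m m n) B)"
    using A B by (metis det_mult four_block_carrier_mat one_carrier_mat)
  then show ?thesis using A B by (simp add: det_block_diag_one_left det_block_diag_one_right)
qed

text \<open>A rank argument that survives over any nontrivial commutative ring: if
  \<open>k < m\<close>, padding with zeros makes both factors square without changing the product,
  yet one of them gets a zero row and determinant 0, while the product has determinant 1.\<close>

lemma right_inverse_mat_dim:
  fixes A :: "'a::comm_ring_1 mat"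
  assumes A: "A \<in> carrier_mat m k" and B: "B \<in> carrier_mat k m" and AB: "A * B = 1\<^sub>m m"
  shows "m \<le> k"
proof (rule ccontr)
  assume "\<not> m \<le> k"
  then have k: "k < m" by simp
  define A' where "A' = mat m m (\<lambda>(i, j). if j < k then A $$ (i, j) else 0)"
  \<comment> \<open>Row \<open>k\<close> is singled out as the zero vector because this is the
    literal form that \<open>det_row_0\<close> expects; \<open>k < m\<close> makes the row
    exist.\<close>
  define B' where "B' = mat\<^sub>r m m (\<lambda>i. if i = k then 0\<^sub>v m else if i < k then row B i else 0\<^sub>v m)"
  have B'_index: "B' $$ (i, j) = (if i < k then B $$ (i, j) else 0)" if "i < m" "j < m" for i j
    using that B by (auto simp: B'_def mat_of_rows_def)
  have carrier: "A' \<in> carrier_mat m m" "B' \<in> carrier_mat m m"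
    by (auto simp: A'_def B'_def)
  have "A' * B' = A * B"
  proof (rule eq_matI)
    fix i j assume "i < dim_row (A * B)" "j < dim_col (A * B)"
    then have ij: "i < m" "j < m" using A B by auto
    have "(A' * B') $$ (i, j) = (\<Sum>l<m. A' $$ (i, l) * B' $$ (l, j))"
      using ij carrier by (simp add: scalar_prod_def atLeast0LessThan)
    also have "\<dots> = (\<Sum>l<k. A' $$ (i, l) * B' $$ (l, j))"
      using k ij by (intro sum.mono_neutral_right) (auto simp: A'_def)
    also have "\<dots> = (\<Sum>l<k. A $$ (i, l) * B $$ (l, j))"
      using k ij by (intro sum.cong) (auto simp: A'_def B'_index)
    also have "\<dots> = (A * B) $$ (i, j)"
      using ij A B by (simp add: scalar_prod_def atLeast0LessThan)
    finally show "(A' * B') $$ (i, j) = (A * B) $$ (i, j)" .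
  qed (use A B carrier in auto)
  then have "det A' * det B' = 1" using AB det_mult[OF carrier] by simp
  moreover have "det B' = 0" unfolding B'_def
    by (rule det_row_0[OF k]) (use B in auto)
  ultimately show False by simp
qed

lemma det_dvd_one_of_right_inverse:
  fixes A :: "'a::comm_ring_1 mat"
  assumes "A \<in> carrier_mat n n" "B \<in> carrier_mat n n" "A * B = 1\<^sub>m n"
  shows "det A dvd 1"
  using det_mult[OF assms(1,2)] assms(3) by (auto intro: dvdI[of _ _ "det B"])


section \<open>Relative determinants of lists of vectors\<close>

lemma sum_lessThan_add:
  fixes f :: "nat \<Rightarrow> 'a::comm_monoid_add"
  shows "(\<Sum>i<n + m. f i) = (\<Sum>i<n. f i) + (\<Sum>i<m. f (n + i))"
  by (induction m) (simp_all add: add.assoc)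

text \<open>A locale of its own, since definitions in \<open>Modules.module\<close> itself would be shadowed by their
  instances for real vector spaces.\<close>

locale ring_module = Modules.module scale
  for scale :: "'a::comm_ring_1 \<Rightarrow> 'b::ab_group_add \<Rightarrow> 'b" (infixr "*s" 75)
begin

text \<open>Coefficients are attached to positions, so \<open>us\<close> may repeat entries; a
  further multiple of a vector is added at one position \<open>j\<close> where it occurs.\<close>

lemma in_span_list:
  "x \<in> span (set us) \<longleftrightarrow> (\<exists>c. x = (\<Sum>i<length us. c i *s us ! i))"
proof
  show "x \<in> span (set us)" if "\<exists>c. x = (\<Sum>i<length us. c i *s us ! i)"
    using that by (auto intro!: span_sum span_scale intro: span_base)
  assume "x \<in> span (set us)"
  then show "\<exists>c. x = (\<Sum>i<length us. c i *s us ! i)"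
  proof (induction rule: span_induct_alt)
    case base
    show ?case by (rule exI[of _ "\<lambda>_. 0"]) simp
  next
    case (step a v y)
    then obtain c j where c: "y = (\<Sum>i<length us. c i *s us ! i)" and j: "j < length us" "us ! j = v"
      by (auto simp: in_set_conv_nth)
    have "(\<Sum>i<length us. (c i + (if i = j then a else 0)) *s us ! i)
        = y + (\<Sum>i<length us. (if i = j then a else 0) *s us ! i)"
      by (simp add: c scale_left_distrib sum.distrib)
    also have "(\<Sum>i<length us. (if i = j then a else 0) *s us ! i)
        = (\<Sum>i<length us. if i = j then a *s v else 0)"
      using j by (intro sum.cong) auto
    also have "\<dots> = a *s v" using j by simp
    finally show ?case by (metis add.commute)
  qed
qed

lemma span_list_minimal: "S \<subseteq> span T \<Longrightarrow> x \<in> span S \<Longrightarrow> x \<in> span T"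
  by (metis span_mono span_span subsetD)

text \<open>Coordinates stand in the columns of \<open>A\<close>. Since \<open>vs\<close> may be
  dependent, this is a relation, and \<open>A\<close> need not be unique.\<close>

definition expresses :: "'b list \<Rightarrow> 'a mat \<Rightarrow> 'b list \<Rightarrow> bool" where
  "expresses vs A us \<longleftrightarrow> A \<in> carrier_mat (length vs) (length us) \<and>
     (\<forall>j<length us. us ! j = (\<Sum>i<length vs. A $$ (i, j) *s vs ! i))"

lemma expressesD:
  assumes "expresses vs A us"
  shows "A \<in> carrier_mat (length vs) (length us)"
    and "j < length us \<Longrightarrow> us ! j = (\<Sum>i<length vs. A $$ (i, j) *s vs ! i)"
  using assms by (auto simp: expresses_def)

lemma exists_expresses:
  assumes "set us \<subseteq> span (set vs)"
  shows "\<exists>A. expresses vs A us"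
proof -
  have "\<forall>j<length us. \<exists>c. us ! j = (\<Sum>i<length vs. c i *s vs ! i)"
    using assms in_span_list nth_mem by blast
  then obtain c where "\<forall>j<length us. us ! j = (\<Sum>i<length vs. c j i *s vs ! i)" by metis
  then have "expresses vs (mat (length vs) (length us) (\<lambda>(i, j). c j i)) us"
    by (auto simp: expresses_def)
  then show ?thesis ..
qed

lemma expresses_trans:
  assumes A: "expresses vs A us" and B: "expresses us B ws"
  shows "expresses vs (A * B) ws"
  unfolding expresses_def
proof (intro conjI allI impI)
  note a = expressesD[OF A] and b = expressesD[OF B]
  show "A * B \<in> carrier_mat (length vs) (length ws)" using a(1) b(1) by simp
  fix j assume j: "j < length ws"
  have "ws ! j = (\<Sum>k<length us. B $$ (k, j) *s us ! k)" by (rule b(2)[OF j])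
  also have "\<dots> = (\<Sum>k<length us. \<Sum>i<length vs. (A $$ (i, k) * B $$ (k, j)) *s vs ! i)"
    by (intro sum.cong) (auto simp: a(2) scale_sum_right mult.commute)
  also have "\<dots> = (\<Sum>i<length vs. (\<Sum>k<length us. A $$ (i, k) * B $$ (k, j)) *s vs ! i)"
    by (subst sum.swap) (simp add: scale_sum_left)
  also have "\<dots> = (\<Sum>i<length vs. (A * B) $$ (i, j) *s vs ! i)"
    using a(1) b(1) j by (intro sum.cong) (auto simp: scalar_prod_def atLeast0LessThan)
  finally show "ws ! j = (\<Sum>i<length vs. (A * B) $$ (i, j) *s vs ! i)" .
qed

text \<open>The volume of \<open>us\<close> measured in \<open>vs\<close>, as a relation because the
  expressing matrix may not be unique. It is multiplicative along chains and along
  concatenations.\<close>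

definition rel_det :: "'b list \<Rightarrow> 'b list \<Rightarrow> 'a \<Rightarrow> bool" where
  "rel_det vs us d \<longleftrightarrow> length us = length vs \<and> (\<exists>A. expresses vs A us \<and> det A = d)"

lemma rel_det_trans:
  assumes "rel_det vs us d" "rel_det us ws e"
  shows "rel_det vs ws (d * e)"
proof -
  obtain A B where *: "expresses vs A us" "det A = d" "expresses us B ws" "det B = e"
      "length us = length vs" "length ws = length us"
    using assms by (auto simp: rel_det_def)
  then have "expresses vs (A * B) ws" by (auto intro: expresses_trans)
  moreover have "det (A * B) = d * e"
    using * expressesD(1) det_mult by metis
  ultimately show ?thesis using * by (auto simp: rel_det_def)
qed

lemma rel_det_Nil: "rel_det [] [] 1"
proof -
  have "expresses [] (1\<^sub>m 0) []" by (simp add: expresses_def)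
  then show ?thesis unfolding rel_det_def by (metis det_one)
qed

lemma rel_det_single: "rel_det [v] [c *s v] c"
proof -
  have "expresses [v] (mat 1 1 (\<lambda>_. c)) [c *s v]" by (simp add: expresses_def)
  moreover have "det (mat 1 1 (\<lambda>_. c)) = c"
    by (subst det_upper_triangular[of _ 1]) (auto simp: diag_mat_def)
  ultimately show ?thesis by (auto simp: rel_det_def)
qed

lemma rel_det_append:
  assumes "rel_det vs us d" "rel_det vs' us' e"
  shows "rel_det (vs @ vs') (us @ us') (d * e)"
proof -
  obtain A B where *: "expresses vs A us" "det A = d" "expresses vs' B us'" "det B = e"
      "length us = length vs" "length us' = length vs'"
    using assms by (auto simp: rel_det_def)
  define n m where "n = length vs" and "m = length vs'"
  have c: "A \<in> carrier_mat n n" "B \<in> carrier_mat m m"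
    using expressesD(1)[OF *(1)] expressesD(1)[OF *(3)] * by (auto simp: n_def m_def)
  let ?C = "four_block_mat A (0\<^sub>m n m) (0\<^sub>m m n) B"
  have "expresses (vs @ vs') ?C (us @ us')"
    unfolding expresses_def
  proof (intro conjI allI impI)
    show "?C \<in> carrier_mat (length (vs @ vs')) (length (us @ us'))"
      using c * by (simp add: n_def m_def)
    fix j assume j: "j < length (us @ us')"
    have "(\<Sum>i<length (vs @ vs'). ?C $$ (i, j) *s (vs @ vs') ! i)
       = (\<Sum>i<n. ?C $$ (i, j) *s (vs @ vs') ! i) + (\<Sum>i<m. ?C $$ (n + i, j) *s (vs @ vs') ! (n + i))"
      unfolding length_append n_def[symmetric] m_def[symmetric] by (rule sum_lessThan_add)
    also have "\<dots> = (us @ us') ! j"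
    proof (cases "j < n")
      case True
      then have "(\<Sum>i<n. ?C $$ (i, j) *s (vs @ vs') ! i) = us ! j"
        using c * expressesD(2)[OF *(1), of j] by (auto simp: n_def nth_append intro!: sum.cong)
      moreover have "(\<Sum>i<m. ?C $$ (n + i, j) *s (vs @ vs') ! (n + i)) = 0"
        using True c by (intro sum.neutral) auto
      ultimately show ?thesis using True * by (simp add: n_def nth_append)
    next
      case False
      then have jm: "j - n < m" using j * by (auto simp: n_def m_def)
      then have "(\<Sum>i<m. ?C $$ (n + i, j) *s (vs @ vs') ! (n + i)) = us' ! (j - n)"
        using False c * expressesD(2)[OF *(3), of "j - n"]
        by (auto simp: n_def m_def nth_append intro!: sum.cong)
      moreover have "(\<Sum>i<n. ?C $$ (i, j) *s (vs @ vs') ! i) = 0"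
        using False jm c by (intro sum.neutral) auto
      ultimately show ?thesis using False * by (simp add: n_def nth_append)
    qed
    finally show "(us @ us') ! j = (\<Sum>i<length (vs @ vs'). ?C $$ (i, j) *s (vs @ vs') ! i)" ..
  qed
  moreover have "det ?C = d * e" using det_block_diag[OF c] * by simp
  ultimately show ?thesis using * by (auto simp: rel_det_def)
qed

lemma rel_det_concat:
  assumes "\<And>w. w \<in> set ws \<Longrightarrow> rel_det (f w) (g w) d"
  shows "rel_det (concat (map f ws)) (concat (map g ws)) (d ^ length ws)"
  using assms by (induction ws) (auto simp: rel_det_Nil intro: rel_det_append)

text \<open>The matrix is diagonal with entries \<plusminus>1. It serves to replace vectors by their
  images under \<rho>, which negates their antisymmetrizations.\<close>

lemma rel_det_signs:
  assumes "list_all2 (\<lambda>v u. u = v \<or> u = - v) vs us"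
  shows "\<exists>d. (d = 1 \<or> d = - 1) \<and> rel_det vs us d"
  using assms
proof induction
  case Nil
  show ?case using rel_det_Nil by auto
next
  case (Cons v vs u us)
  obtain d where d: "d = 1 \<or> d = - 1" "rel_det vs us d" using Cons by auto
  obtain c :: 'a where c: "c = 1 \<or> c = - 1" "u = c *s v"
    using Cons(1) by (metis scale_minus_left scale_one)
  have "rel_det ([v] @ vs) ([u] @ us) (c * d)"
    unfolding c(2) by (rule rel_det_append[OF rel_det_single d(2)])
  moreover have "c * d = 1 \<or> c * d = - 1" using c(1) d(1) by auto
  ultimately show ?case by auto
qed

section \<open>Vectors with equal coefficients in two lists\<close>

definition corresponds :: "'b list \<Rightarrow> 'b list \<Rightarrow> 'b \<Rightarrow> 'b \<Rightarrow> bool" where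
  "corresponds vs vs' x x' \<longleftrightarrow>
     (\<exists>c. x = (\<Sum>i<length vs. c i *s vs ! i) \<and> x' = (\<Sum>i<length vs. c i *s vs' ! i))"

lemma corresponds_zero: "corresponds vs vs' 0 0"
  unfolding corresponds_def by (rule exI[of _ "\<lambda>_. 0"]) simp

lemma corresponds_add:
  assumes "corresponds vs vs' x x'" "corresponds vs vs' y y'"
  shows "corresponds vs vs' (x + y) (x' + y')"
proof -
  obtain c d where "x = (\<Sum>i<length vs. c i *s vs ! i)" "x' = (\<Sum>i<length vs. c i *s vs' ! i)"
    "y = (\<Sum>i<length vs. d i *s vs ! i)" "y' = (\<Sum>i<length vs. d i *s vs' ! i)"
    using assms by (auto simp: corresponds_def)
  then show ?thesis unfolding corresponds_def
    by (intro exI[of _ "\<lambda>i. c i + d i"]) (simp add: scale_left_distrib sum.distrib)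
qed

lemma corresponds_scale:
  assumes "corresponds vs vs' x x'"
  shows "corresponds vs vs' (a *s x) (a *s x')"
proof -
  obtain c where "x = (\<Sum>i<length vs. c i *s vs ! i)" "x' = (\<Sum>i<length vs. c i *s vs' ! i)"
    using assms by (auto simp: corresponds_def)
  then show ?thesis unfolding corresponds_def
    by (intro exI[of _ "\<lambda>i. a * c i"]) (simp add: scale_sum_right)
qed

lemma corresponds_base:
  assumes "(x, x') \<in> set (zip vs vs')"
  shows "corresponds vs vs' x x'"
proof -
  obtain j where j: "j < length vs" "x = vs ! j" "x' = vs' ! j"
    using assms by (auto simp: in_set_zip)
  have "(\<Sum>i<length vs. (if i = j then 1 else 0) *s us ! i) = us ! j" for us
    using j by (simp add: if_distrib[of "\<lambda>a. a *s _"] cong: if_cong)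
  then show ?thesis unfolding corresponds_def j(2,3) by metis
qed

text \<open>One matrix of shared coefficients expresses both families, so a single determinant
  \<open>d\<close> serves for both. In the final comparison this common factor cancels.\<close>

lemma rel_det_corresponds:
  assumes len: "length vs' = length vs" "length us = length vs"
    and "list_all2 (corresponds vs vs') us us'"
  shows "\<exists>d. rel_det vs us d \<and> rel_det vs' us' d"
proof -
  have l: "length us' = length us" using assms(3) by (simp add: list_all2_lengthD)
  have "\<forall>j<length us. corresponds vs vs' (us ! j) (us' ! j)"
    using assms(3) by (auto simp: list_all2_conv_all_nth)
  then obtain c where c: "\<forall>j<length us. us ! j = (\<Sum>i<length vs. c j i *s vs ! i)
      \<and> us' ! j = (\<Sum>i<length vs. c j i *s vs' ! i)"
    unfolding corresponds_def by metis
  let ?A = "mat (length vs) (length us) (\<lambda>(i, j). c j i)"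
  have "expresses vs ?A us" "expresses vs' ?A us'"
    using c len l by (auto simp: expresses_def)
  then show ?thesis using len l by (auto simp: rel_det_def)
qed

end

lemma expresses_map:
  assumes "Modules.module_hom s t f" "ring_module.expresses s vs A us"
  shows "ring_module.expresses t (map f vs) A (map f us)"
proof -
  interpret Modules.module_hom s t f by fact
  interpret m1: ring_module s ..
  interpret m2: ring_module t ..
  note e = m1.expressesD[OF assms(2)]
  show ?thesis using e(1)
    by (auto simp: m2.expresses_def e(2) sum scale intro!: sum.cong)
qed

lemma rel_det_map:
  assumes "Modules.module_hom s t f" "ring_module.rel_det s vs us d"
  shows "ring_module.rel_det t (map f vs) (map f us) d"
proof -
  interpret Modules.module_hom s t f by fact
  interpret m1: ring_module s ..
  interpret m2: ring_module t ..
  show ?thesis using assms(2) expresses_map[OF assms(1)]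
    by (auto simp: m1.rel_det_def m2.rel_det_def)
qed

text \<open>Replaces dimension counting over \<open>E \<otimes> \<complex>\<close>, which is not a field.\<close>

lemma separated_length_le:
  fixes s :: "'a::comm_ring_1 \<Rightarrow> 'b::ab_group_add \<Rightarrow> 'b"
  assumes hom: "\<And>i. i < length ys \<Longrightarrow> Modules.module_hom s (*) (\<phi> i)"
    and sep: "\<And>i j. i < length ys \<Longrightarrow> j < length ys \<Longrightarrow> \<phi> i (ys ! j) = (if i = j then 1 else 0)"
    and "Modules.module s"
    and span: "\<And>y. y \<in> set ys \<Longrightarrow> \<exists>x\<in>Modules.module.span s (set us). \<forall>i<length ys. \<phi> i y = \<phi> i x"
  shows "length ys \<le> length us"
proof -
  interpret ring_module s using assms(3) by (rule ring_module.intro)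
  let ?m = "length ys" and ?k = "length us"
  have "\<forall>j<?m. \<exists>c. \<forall>i<?m. \<phi> i (ys ! j) = \<phi> i (\<Sum>l<?k. s (c l) (us ! l))"
    using span in_span_list nth_mem by metis
  then obtain c where c: "\<And>i j. j < ?m \<Longrightarrow> i < ?m \<Longrightarrow> \<phi> i (ys ! j) = \<phi> i (\<Sum>l<?k. s (c j l) (us ! l))"
    by metis
  let ?P = "mat ?m ?k (\<lambda>(i, l). \<phi> i (us ! l))" and ?T = "mat ?k ?m (\<lambda>(l, j). c j l)"
  have "?P * ?T = 1\<^sub>m ?m"
  proof (rule eq_matI)
    fix i j assume "i < dim_row (1\<^sub>m ?m :: 'a mat)" "j < dim_col (1\<^sub>m ?m :: 'a mat)"
    then have ij: "i < ?m" "j < ?m" by auto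
    interpret h: Modules.module_hom s "(*)" "\<phi> i" by (rule hom[OF ij(1)])
    have "(?P * ?T) $$ (i, j) = (\<Sum>l<?k. c j l * \<phi> i (us ! l))"
      using ij by (simp add: scalar_prod_def atLeast0LessThan mult.commute)
    also have "\<dots> = \<phi> i (ys ! j)" using ij by (simp add: c h.sum h.scale)
    finally show "(?P * ?T) $$ (i, j) = (1\<^sub>m ?m) $$ (i, j)" using sep ij by simp
  qed auto
  then show ?thesis by (rule right_inverse_mat_dim[rotated 2]) auto
qed

section \<open>Finite-dimensional spaces and quotients\<close>

lemma finite_dimE:
  assumes "vector_space s" "finite_dim s"
  obtains B where "finite_dimensional_vector_space s B"
proof -
  interpret vector_space s by fact
  obtain S where S: "finite S" "span S = UNIV" using assms(2) by (auto simp: finite_dim_def)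
  obtain B where B: "B \<subseteq> UNIV" "independent B" "UNIV \<subseteq> span B" using basis_exists[of UNIV] by metis
  have "finite B" using independent_span_bound[of S B] S B by auto
  then have "finite_dimensional_vector_space s B"
    using B assms(1) by unfold_locales auto
  then show thesis by (rule that)
qed

lemma is_basis_list_length:
  assumes "vector_space s" "is_basis s V (set vs)" "distinct vs"
  shows "length vs = vector_space.dim s V"
proof -
  interpret vector_space s by fact
  have "independent (set vs)" "span (set vs) = V" using assms(2) by (auto simp: is_basis_def)
  then show ?thesis using assms(3) dim_span_eq_card_independent distinct_card by metis
qed

lemma exists_basis_list:
  assumes "vector_space s" "finite_dim s" "Modules.module.subspace s V"
  shows "\<exists>vs. distinct vs \<and> is_basis s V (set vs)"
proof -
  obtain B0 where "finite_dimensional_vector_space s B0" using finite_dimE[OF assms(1,2)] .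
  interpret finite_dimensional_vector_space s B0 by fact
  obtain B where B: "B \<subseteq> V" "independent B" "V \<subseteq> span B" by (metis basis_exists)
  then have "span B = V" using assms(3) span_minimal by blast
  moreover obtain vs where "set vs = B" "distinct vs"
    using finite_distinct_list finiteI_independent[OF B(2)] by metis
  ultimately show ?thesis using B(2) by (auto simp: is_basis_def)
qed

lemma coordinate_functionals:
  assumes "vector_space s" "\<not> Modules.module.dependent s (set vs)" "distinct vs"
  obtains \<phi> where "\<And>i. Vector_Spaces.linear s (*) (\<phi> i)"
    and "\<And>i j. i < length vs \<Longrightarrow> j < length vs \<Longrightarrow> \<phi> i (vs ! j) = (if i = j then 1 else 0)"
proof -
  interpret vector_space s by fact
  have *: "vector_space ((*) :: 'a \<Rightarrow> 'a \<Rightarrow> 'a)"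
    by unfold_locales (simp_all add: algebra_simps)
  interpret vector_space_pair s "(*) :: 'a \<Rightarrow> 'a \<Rightarrow> 'a"
    by (intro vector_space_pair.intro assms(1) *)
  have "\<exists>f. Vector_Spaces.linear s (*) f \<and> (\<forall>x\<in>set vs. f x = (if x = vs ! i then 1 else 0))" for i
    by (rule linear_independent_extend[OF assms(2)])
  then obtain \<phi> where \<phi>: "\<And>i. Vector_Spaces.linear s (*) (\<phi> i)"
    "\<And>i. \<forall>x\<in>set vs. \<phi> i x = (if x = vs ! i then 1 else 0)" by metis
  show thesis
    by (rule that[of \<phi>]) (use \<phi> assms(3) in \<open>auto simp: nth_eq_iff_index_eq\<close>)
qed

text \<open>Sums and multiples of expansions modulo \<open>F\<close> are again expansions, so
  uniqueness of the coefficients makes them linear in the vector. They are the dual basis of the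
  quotient, pulled back to the whole space.\<close>

lemma quotient_coordinate_functionals:
  assumes vs: "vector_space s" and sub: "Modules.module.subspace s F"
    and ws: "is_quotient_basis s F ws"
  obtains \<omega> where "\<And>i. Vector_Spaces.linear s (*) (\<omega> i)"
    and "\<And>i x. x \<in> F \<Longrightarrow> \<omega> i x = 0"
    and "\<And>i j. i < length ws \<Longrightarrow> j < length ws \<Longrightarrow> \<omega> i (ws ! j) = (if i = j then 1 else 0)"
    and "\<And>x. x - (\<Sum>i<length ws. s (\<omega> i x) (ws ! i)) \<in> F"
proof -
  interpret vector_space s by fact
  let ?P = "\<lambda>x c. (\<forall>i \<ge> length ws. c i = 0) \<and> x - (\<Sum>i<length ws. s (c i) (ws ! i)) \<in> F"
  \<comment> \<open>The description selects a coefficient function on all of nat; the condition that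
    it vanish from \<open>length ws\<close> on is what makes it unique.\<close>
  define \<omega> where "\<omega> i x = (THE c. ?P x c) i" for i x
  have P: "?P x (\<lambda>i. \<omega> i x)" for x
    using theI'[of "?P x"] ws unfolding is_quotient_basis_def \<omega>_def by blast
  have unique: "\<omega> i x = c i" if "?P x c" for x c i
    using ws P[of x] that unfolding is_quotient_basis_def by metis
  have "\<omega> i (x + y) = \<omega> i x + \<omega> i y" for i x y
  proof -
    have "x - (\<Sum>i<length ws. s (\<omega> i x) (ws ! i)) + (y - (\<Sum>i<length ws. s (\<omega> i y) (ws ! i))) \<in> F"
      using P subspace_add[OF sub] by blast
    then have "?P (x + y) (\<lambda>i. \<omega> i x + \<omega> i y)"
      using P[of x] P[of y] by (simp add: scale_left_distrib sum.distrib algebra_simps)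
    then show ?thesis by (rule unique)
  qed
  moreover have "\<omega> i (s a x) = a * \<omega> i x" for i a x
  proof -
    have "s a (x - (\<Sum>i<length ws. s (\<omega> i x) (ws ! i))) \<in> F"
      using P subspace_scale[OF sub] by blast
    then have "?P (s a x) (\<lambda>i. a * \<omega> i x)"
      using P[of x] by (simp add: scale_right_diff_distrib scale_sum_right)
    then show ?thesis by (rule unique)
  qed
  ultimately have 1: "Vector_Spaces.linear s (*) (\<omega> i)" for i
    by unfold_locales (simp_all add: algebra_simps)
  have 2: "\<omega> i x = 0" if "x \<in> F" for i x
    by (rule unique[of "\<lambda>_. 0" x]) (use that in simp)
  have 3: "\<omega> i (ws ! j) = (if i = j then 1 else 0)" if j: "j < length ws" for i j
  proof (rule unique[of "\<lambda>i. if i = j then 1 else 0" "ws ! j"])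
    have "(\<Sum>i<length ws. s (if i = j then 1 else 0) (ws ! i)) = ws ! j"
      using j by (simp add: if_distrib[of "\<lambda>a. s a _"] cong: if_cong)
    then show "?P (ws ! j) (\<lambda>i. if i = j then 1 else 0)"
      using j subspace_0[OF sub] by auto
  qed
  show thesis by (rule that[of \<omega>]) (use 1 2 3 P in auto)
qed

text \<open>A basis \<open>A\<close> of \<open>F\<close> is extended to a basis \<open>B\<close> of
  the whole space; the added vectors \<open>B - A\<close> represent a basis of the quotient.\<close>

lemma exists_quotient_basis:
  assumes "vector_space s" "finite_dim s" "Modules.module.subspace s F"
  obtains ws where "is_quotient_basis s F ws"
    and "length ws = vector_space.dim s UNIV - vector_space.dim s F"
proof -
  obtain B0 where "finite_dimensional_vector_space s B0" using finite_dimE[OF assms(1,2)] .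
  interpret finite_dimensional_vector_space s B0 by fact
  obtain A where A: "A \<subseteq> F" "independent A" "F \<subseteq> span A" by (metis basis_exists)
  have spanA: "span A = F" using A assms(3) span_minimal by blast
  obtain B where B: "A \<subseteq> B" "independent B" "UNIV \<subseteq> span B"
    by (rule maximal_independent_subset_extend[OF subset_UNIV A(2)])
  then have spanB: "span B = UNIV" by auto
  have finB: "finite B" using B(2) by (rule finiteI_independent)
  obtain ws where ws: "set ws = B - A" "distinct ws" using finite_distinct_list[of "B - A"] finB by auto
  have len: "length ws = dim UNIV - dim F"
  proof -
    have "length ws = card B - card A"
      using ws distinct_card finB B(1) by (metis card_Diff_subset finite_subset)
    then show ?thesis
      using dim_span_eq_card_independent A(2) B(2) spanA spanB by metis
  qed
  let ?P = "\<lambda>x c. (\<forall>i \<ge> length ws. c i = 0) \<and> x - (\<Sum>i<length ws. s (c i) (ws ! i)) \<in> F"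
  have "\<exists>!c. ?P x c" for x
  proof (rule ex_ex1I)
    have "x \<in> span ((B - A) \<union> A)" using B(1) spanB by (simp add: Un_absorb2)
    then obtain y z where yz: "x = y + z" "y \<in> span (set ws)" "z \<in> F"
      unfolding span_Un ws(1) spanA by auto
    interpret ring_module s ..
    obtain c where "y = (\<Sum>i<length ws. s (c i) (ws ! i))" using yz(2) in_span_list by blast
    then have "?P x (\<lambda>i. if i < length ws then c i else 0)" using yz by simp
    then show "\<exists>c. ?P x c" by (rule exI[of "?P x" "\<lambda>i. if i < length ws then c i else 0"])
  next
    fix c d assume c: "?P x c" and d: "?P x d"
    \<comment> \<open>The difference of two expansions of \<open>x\<close> lies in \<open>F\<close>,
      where the functionals dual to the vectors of \<open>B - A\<close> vanish; evaluating them
      gives \<open>c j - d j = 0\<close>.\<close>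
    define y where "y = (\<Sum>i<length ws. s (c i - d i) (ws ! i))"
    have "y = (x - (\<Sum>i<length ws. s (d i) (ws ! i))) - (x - (\<Sum>i<length ws. s (c i) (ws ! i)))"
      by (simp add: y_def scale_left_diff_distrib sum_subtractf)
    then have yF: "y \<in> F" using c d subspace_diff[OF assms(3)] by metis
    obtain \<phi> where \<phi>: "\<And>i. Vector_Spaces.linear s (*) (\<phi> i)"
      "\<And>i x. x \<in> B \<Longrightarrow> \<phi> i x = (if x = ws ! i then 1 else 0)"
    proof -
      have *: "vector_space ((*) :: 'a \<Rightarrow> 'a \<Rightarrow> 'a)"
        by unfold_locales (simp_all add: algebra_simps)
      interpret vector_space_pair s "(*) :: 'a \<Rightarrow> 'a \<Rightarrow> 'a"
        by (intro vector_space_pair.intro assms(1) *)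
      have "\<exists>f. Vector_Spaces.linear s (*) f \<and> (\<forall>x\<in>B. f x = (if x = ws ! i then 1 else 0))" for i
        by (rule linear_independent_extend[OF B(2)])
      then show thesis using that by metis
    qed
    have "c j = d j" if j: "j < length ws" for j
    proof -
      interpret h: Vector_Spaces.linear s "(*)" "\<phi> j" by (rule \<phi>(1))
      have "\<phi> j y = (\<Sum>i<length ws. (c i - d i) * \<phi> j (ws ! i))"
        by (simp add: y_def h.sum h.scale)
      also have "\<dots> = (\<Sum>i<length ws. if i = j then c j - d j else 0)"
      proof (intro sum.cong refl)
        fix i assume "i \<in> {..<length ws}"
        then have "ws ! i \<in> B" "ws ! i = ws ! j \<longleftrightarrow> i = j"
          using ws j by (auto simp: nth_eq_iff_index_eq dest: nth_mem)
        then show "(c i - d i) * \<phi> j (ws ! i) = (if i = j then c j - d j else 0)"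
          by (simp add: \<phi>(2))
      qed
      finally have "\<phi> j y = c j - d j" using j by simp
      moreover have "\<phi> j y = 0"
      proof (rule h.eq_0_on_span)
        show "y \<in> span A" using yF spanA by simp
        fix a assume a: "a \<in> A"
        have "ws ! j \<notin> A" using ws j nth_mem by blast
        then show "\<phi> j a = 0" using a B(1) \<phi>(2)[of a j] by auto
      qed
      ultimately show ?thesis by simp
    qed
    moreover have "c j = d j" if "\<not> j < length ws" for j using c d that by simp
    ultimately show "c = d" by blast
  qed
  then have "is_quotient_basis s F ws" by (simp add: is_quotient_basis_def)
  then show thesis using len by (rule that)
qed

text \<open>The coordinate functionals of \<open>ws\<close> vanish on \<open>F\<close>, so they
  cannot distinguish a vector from its expansion in \<open>ws'\<close>, and
  \<open>separated_length_le\<close> applies. Used in both directions, it shows that all bases of a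
  quotient have the same length.\<close>

lemma quotient_basis_length_le:
  assumes "vector_space s" "Modules.module.subspace s F"
    and ws: "is_quotient_basis s F ws" and ws': "is_quotient_basis s F ws'"
  shows "length ws \<le> length ws'"
proof -
  interpret vector_space s by fact
  obtain \<omega> where \<omega>: "\<And>i. Vector_Spaces.linear s (*) (\<omega> i)" "\<And>i x. x \<in> F \<Longrightarrow> \<omega> i x = 0"
    "\<And>i j. i < length ws \<Longrightarrow> j < length ws \<Longrightarrow> \<omega> i (ws ! j) = (if i = j then 1 else 0)"
    "\<And>x. x - (\<Sum>i<length ws. s (\<omega> i x) (ws ! i)) \<in> F"
    using quotient_coordinate_functionals[OF assms(1,2) ws] by blast
  obtain \<omega>' where "\<And>i. Vector_Spaces.linear s (*) (\<omega>' i)" "\<And>i x. x \<in> F \<Longrightarrow> \<omega>' i x = 0"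
    "\<And>i j. i < length ws' \<Longrightarrow> j < length ws' \<Longrightarrow> \<omega>' i (ws' ! j) = (if i = j then 1 else 0)"
    and \<omega>': "\<And>x. x - (\<Sum>i<length ws'. s (\<omega>' i x) (ws' ! i)) \<in> F"
    using quotient_coordinate_functionals[OF assms(1,2) ws'] by blast
  show ?thesis
  proof (rule separated_length_le[of ws s \<omega>])
    show "Modules.module_hom s (*) (\<omega> i)" for i
      using \<omega>(1)[of i] by (simp add: module_hom_iff_linear)
    show "Modules.module s" ..
    fix y
    let ?x = "\<Sum>i<length ws'. s (\<omega>' i y) (ws' ! i)"
    have "\<omega> i y = \<omega> i ?x" for i
    proof -
      interpret h: Vector_Spaces.linear s "(*)" "\<omega> i" by (rule \<omega>(1))
      show ?thesis using \<omega>(2)[OF \<omega>'[of y], of i] by (simp add: h.diff)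
    qed
    moreover have "?x \<in> span (set ws')" by (auto intro!: span_sum span_scale intro: span_base)
    ultimately show "\<exists>x\<in>span (set ws'). \<forall>i<length ws. \<omega> i y = \<omega> i x" by blast
  qed (simp_all add: \<omega>(3))
qed

text \<open>\<open>trace_of\<close> picks an unspecified basis, so a computation of it needs
  independence of the basis. This is the cyclicity of the trace, written out with the two
  change-of-basis matrices.\<close>

lemma trace_of_basis:
  assumes "vector_space s" "Vector_Spaces.linear s s f" "finite B" "is_basis s UNIV B"
  shows "trace_of s f = (\<Sum>b\<in>B. Modules.module.representation s B (f b) b)"
proof -
  interpret vector_space s by fact
  interpret f: Vector_Spaces.linear s s f by fact
  define C where "C = (SOME B. is_basis s UNIV B)"
  have "is_basis s UNIV C" unfolding C_def using assms(4) by (rule someI)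
  then have C: "independent C" "span C = UNIV" by (auto simp: is_basis_def)
  have B: "independent B" "span B = UNIV" using assms(4) by (auto simp: is_basis_def)
  have finC: "finite C" using independent_span_bound[OF assms(3) C(1)] B(2) by simp
  let ?b = "representation B" and ?c = "representation C"
  have sumB: "(\<Sum>b\<in>B. s (?b v b) b) = v" and sumC: "(\<Sum>c\<in>C. s (?c v c) c) = v" for v
    using sum_representation_eq[of B v B] sum_representation_eq[of C v C] B C assms(3) finC by auto
  have 1: "?c v c = (\<Sum>b\<in>B. ?b v b * ?c b c)" for v c
  proof -
    have "?c v c = ?c (\<Sum>b\<in>B. s (?b v b) b) c" by (simp add: sumB)
    also have "\<dots> = (\<Sum>b\<in>B. ?b v b * ?c b c)"
      using C by (simp add: representation_sum representation_scale)
    finally show ?thesis .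
  qed
  have 2: "?b (f c) b = (\<Sum>b'\<in>B. ?b c b' * ?b (f b') b)" for c b
  proof -
    have "?b (f c) b = ?b (f (\<Sum>b'\<in>B. s (?b c b') b')) b" by (simp add: sumB)
    also have "\<dots> = (\<Sum>b'\<in>B. ?b c b' * ?b (f b') b)"
      using B by (simp add: f.sum f.scale representation_sum representation_scale)
    finally show ?thesis .
  qed
  have 3: "?b b b' = (\<Sum>c\<in>C. ?c b c * ?b c b')" for b b'
  proof -
    have "?b b b' = ?b (\<Sum>c\<in>C. s (?c b c) c) b'" by (simp add: sumC)
    also have "\<dots> = (\<Sum>c\<in>C. ?c b c * ?b c b')"
      using B by (simp add: representation_sum representation_scale)
    finally show ?thesis .
  qed
  have "trace_of s f = (\<Sum>c\<in>C. ?c (f c) c)" by (simp add: trace_of_def C_def Let_def)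
  \<comment> \<open>Each diagonal entry in \<open>C\<close> is expanded twice through
    \<open>B\<close>. Once the sum over \<open>c\<close> stands innermost, fact \<open>3\<close>
    contracts the two base changes to the identity.\<close>
  also have "\<dots> = (\<Sum>c\<in>C. \<Sum>b\<in>B. \<Sum>b'\<in>B. ?b (f b') b * (?c b c * ?b c b'))"
    by (subst 1, subst 2) (simp add: sum_distrib_left sum_distrib_right mult_ac)
  also have "\<dots> = (\<Sum>b\<in>B. \<Sum>c\<in>C. \<Sum>b'\<in>B. ?b (f b') b * (?c b c * ?b c b'))"
    by (rule sum.swap)
  also have "\<dots> = (\<Sum>b\<in>B. \<Sum>b'\<in>B. \<Sum>c\<in>C. ?b (f b') b * (?c b c * ?b c b'))"
    by (intro sum.cong refl sum.swap)
  also have "\<dots> = (\<Sum>b\<in>B. \<Sum>b'\<in>B. ?b (f b') b * ?b b b')"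
    by (subst 3) (simp add: sum_distrib_left)
  also have "\<dots> = (\<Sum>b\<in>B. ?b (f b) b)"
  proof (intro sum.cong refl)
    fix b assume b: "b \<in> B"
    have "(\<Sum>b'\<in>B. ?b (f b') b * ?b b b') = (\<Sum>b'\<in>B. if b' = b then ?b (f b') b else 0)"
      using representation_basis[OF B(1) b] by (intro sum.cong) auto
    then show "(\<Sum>b'\<in>B. ?b (f b') b * ?b b b') = ?b (f b) b" using b assms(3) by simp
  qed
  finally show ?thesis .
qed


section \<open>Linear maps after extension of scalars\<close>

abbreviation ext :: "'a::ab_group_add \<Rightarrow> 'a tensor_C" where
  "ext v \<equiv> tens v 1"

lemma tens_map_tens: "additive f \<Longrightarrow> tens_map f (tens v z) = tens (f v) z"
  unfolding tens_map_def
  by (subst tens_lift_tens) (simp_all add: biadditive_def additive.add tens_add_left tens_add_right)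

lemma tens_map_add: "additive f \<Longrightarrow> tens_map f (x + y) = tens_map f x + tens_map f y"
  unfolding tens_map_def
  by (rule tens_lift_add) (simp_all add: biadditive_def additive.add tens_add_left tens_add_right)

lemma linear_additive: "Vector_Spaces.linear s1 s2 f \<Longrightarrow> additive f"
  by (simp add: additive_def Vector_Spaces.linear_iff)

lemma module_hom_tens_map:
  assumes "Vector_Spaces.linear s1 s2 f"
  shows "Modules.module_hom (tens_prod s1) (tens_prod s2) (tens_map f)"
proof -
  interpret Vector_Spaces.linear s1 s2 f by fact
  note s1 = biadditive_scale[OF vs1.vector_space_axioms] and s2 = biadditive_scale[OF vs2.vector_space_axioms]
  note f = linear_additive[OF assms]
  note rules = tens_prod_tens[OF s1] tens_prod_tens[OF s2] tens_prod_add_left[OF s1]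
    tens_prod_add_left[OF s2] tens_prod_add_right[OF s1] tens_prod_add_right[OF s2]
    tens_prod_zero_left[OF s1] tens_prod_zero_left[OF s2] tens_prod_zero_right[OF s1]
    tens_prod_zero_right[OF s2] tens_map_tens[OF f] tens_map_add[OF f]
  have zero: "tens_map f 0 = 0" using rules(12)[of 0 0] by simp
  have "tens_map f (tens_prod s1 r x) = tens_prod s2 r (tens_map f x)" for r x
  proof (induction r rule: tensor_C_induct)
    case (tens a z)
    show ?case
      by (induction x rule: tensor_C_induct) (simp_all add: rules zero scale)
  qed (simp_all add: rules zero)
  then show ?thesis
    by (intro module_hom.intro module_tens_prod vs1.vector_space_axioms vs2.vector_space_axioms
        module_hom_axioms.intro) (simp_all add: rules)
qed

lemma tens_prod_times: "tens_prod (*) = (*)"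
  by (simp add: times_tensor_C_def)

lemma module_hom_tens_functional:
  "Vector_Spaces.linear s (*) f \<Longrightarrow> Modules.module_hom (tens_prod s) (*) (tens_map f)"
  using module_hom_tens_map[of s "(*)" f] by (simp add: tens_prod_times)

lemma ext_one: "(ext 1 :: 'e::field_char_0 tensor_C) = 1"
  by (simp add: one_tensor_C_def)

lemma ext_mult: "ext a * ext b = (ext (a * b) :: 'e::field_char_0 tensor_C)"
  by (simp add: times_tensor_C_def tens_prod_tens biadditive_times)

lemma comm_ring_hom_ext: "comm_ring_hom (ext :: 'e::field_char_0 \<Rightarrow> 'e tensor_C)"
  by unfold_locales (simp_all add: tens_add_left ext_one ext_mult)

context vector_space
begin

lemma tens_prod_tens_scale: "tens_prod scale (tens c z) (tens v w) = tens (scale c v) (z * w)"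
  by (rule tens_prod_tens[OF biadditive_scale[OF vector_space_axioms]])

end

lemma ext_C_tens: "v \<in> V \<Longrightarrow> tens v z \<in> ext_C V"
  unfolding ext_C_def by (intro CollectI exI[of _ "[(v, z)]"]) auto

lemma ext_C_UNIV: "ext_C UNIV = UNIV"
proof -
  have "x \<in> ext_C UNIV" for x :: "'a tensor_C"
  proof (induction x rule: tensor_C_induct)
    case zero
    show ?case unfolding ext_C_def by (intro CollectI exI[of _ "[]"]) simp
  next
    case (tens v z)
    show ?case by (rule ext_C_tens) simp
  next
    case (add x y)
    then obtain xs ys where "x = (\<Sum>(v, z)\<leftarrow>xs. tens v z)" "y = (\<Sum>(v, z)\<leftarrow>ys. tens v z)"
      by (auto simp: ext_C_def)
    then show ?case unfolding ext_C_def by (intro CollectI exI[of _ "xs @ ys"]) simp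
  qed
  then show ?thesis by auto
qed

text \<open>The span on the left is over E, the one on the right over E \<otimes> \<complex>; they
  match because cv \<otimes> z = (c \<otimes> z)(v \<otimes> 1).\<close>

lemma ext_C_span:
  assumes "vector_space s"
  shows "ext_C (Modules.module.span s B) = Modules.module.span (tens_prod s) (ext ` B)"
proof -
  interpret vector_space s by fact
  interpret C: Modules.module "tens_prod s" by (rule module_tens_prod[OF assms])
  have 1: "tens v z \<in> C.span (ext ` B)" if "v \<in> span B" for v z
    using that
  proof (induction arbitrary: z rule: span_induct_alt)
    case base
    show ?case by (simp add: C.span_zero)
  next
    case (step c v y)
    have "tens (s c v) z = tens_prod s (tens c z) (ext v)" by (simp add: tens_prod_tens_scale)
    then show ?case using step by (simp add: tens_add_left C.span_add C.span_scale C.span_base)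
  qed
  have "(\<Sum>(v, z)\<leftarrow>xs. tens v z) \<in> C.span (ext ` B)" if "fst ` set xs \<subseteq> span B" for xs :: "('b \<times> complex) list"
    using that
  proof (induction xs)
    case Nil
    show ?case by (simp add: C.span_zero)
  next
    case (Cons p xs)
    then show ?case by (cases p) (auto intro!: C.span_add 1)
  qed
  then have "ext_C (span B) \<subseteq> C.span (ext ` B)" by (auto simp: ext_C_def)
  moreover have "C.span (ext ` B) \<subseteq> ext_C (span B)"
  proof (rule C.span_minimal)
    show "ext ` B \<subseteq> ext_C (span B)" by (auto intro: ext_C_tens span_base)
    have add: "x + y \<in> ext_C (span B)" if "x \<in> ext_C (span B)" "y \<in> ext_C (span B)" for x y
    proof -
      obtain xs ys where "x = (\<Sum>(v, z)\<leftarrow>xs. tens v z)" "y = (\<Sum>(v, z)\<leftarrow>ys. tens v z)"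
        "fst ` set xs \<subseteq> span B" "fst ` set ys \<subseteq> span B"
        using \<open>x \<in> _\<close> \<open>y \<in> _\<close> by (auto simp: ext_C_def)
      then show ?thesis unfolding ext_C_def by (intro CollectI exI[of _ "xs @ ys"]) auto
    qed
    have zero: "0 \<in> ext_C (span B)"
      unfolding ext_C_def by (intro CollectI exI[of _ "[]"]) simp
    have scale: "tens_prod s r x \<in> ext_C (span B)" if x: "x \<in> ext_C (span B)" for r x
    proof (induction r rule: tensor_C_induct)
      case (tens c z)
      obtain xs where xs: "x = (\<Sum>(v, z)\<leftarrow>xs. tens v z)" "fst ` set xs \<subseteq> span B"
        using x by (auto simp: ext_C_def)
      show ?case unfolding xs(1) using xs(2)
      proof (induction xs)
        case (Cons p xs)
        then show ?case
          by (cases p) (auto simp: C.scale_right_distrib tens_prod_tens_scale intro!: add ext_C_tens span_scale)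
      qed (simp add: zero)
    qed (simp_all add: zero C.scale_left_distrib add)
    show "C.subspace (ext_C (span B))" by (rule C.subspaceI) (rule zero add scale; assumption)+
  qed
  ultimately show ?thesis by (rule equalityI)
qed

lemma ext_C_subspace:
  assumes "vector_space s" "Modules.module.subspace s V"
  shows "ext_C V = Modules.module.span (tens_prod s) (ext ` V)"
proof -
  interpret vector_space s by fact
  show ?thesis using ext_C_span[OF assms(1), of V] span_eq_iff[THEN iffD2, OF assms(2)] by simp
qed

lemma subspace_ext_C:
  assumes "vector_space s" "Modules.module.subspace s V"
  shows "Modules.module.subspace (tens_prod s) (ext_C V)"
proof -
  interpret C: Modules.module "tens_prod s" by (rule module_tens_prod[OF assms(1)])
  show ?thesis unfolding ext_C_subspace[OF assms] by simp
qed

lemma span_ext_spanning: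
  assumes "vector_space s" "Modules.module.span s B = UNIV"
  shows "Modules.module.span (tens_prod s) (ext ` B) = UNIV"
  using ext_C_span[OF assms(1), of B] by (simp add: assms(2) ext_C_UNIV)

lemma tens_map_vanishes:
  assumes "Vector_Spaces.linear s1 s2 f" "\<And>v. v \<in> V \<Longrightarrow> f v = 0" "x \<in> ext_C V"
  shows "tens_map f x = 0"
proof -
  note f = linear_additive[OF assms(1)]
  obtain xs where xs: "x = (\<Sum>(v, z)\<leftarrow>xs. tens v z)" "fst ` set xs \<subseteq> V"
    using assms(3) by (auto simp: ext_C_def)
  have "tens_map f 0 = 0" using tens_map_add[OF f, of 0 0] by simp
  then have "tens_map f (\<Sum>(v, z)\<leftarrow>xs. tens v z) = 0"
    using xs(2) by (induction xs) (auto simp: tens_map_add[OF f] tens_map_tens[OF f] assms(2))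
  then show ?thesis by (simp add: xs)
qed

lemma expresses_ext:
  assumes "vector_space s" "ring_module.expresses s vs A us"
  shows "ring_module.expresses (tens_prod s) (map ext vs) (map_mat ext A) (map ext us)"
proof -
  interpret vector_space s by fact
  interpret E: ring_module s ..
  interpret R: ring_module "tens_prod s" using module_tens_prod[OF assms(1)] by (rule ring_module.intro)
  note e = E.expressesD[OF assms(2)]
  have sum: "ext (\<Sum>i\<in>I. f i) = (\<Sum>i\<in>I. ext (f i))" for I and f :: "nat \<Rightarrow> 'b"
    by (induction I rule: infinite_finite_induct) (simp_all add: tens_add_left)
  show ?thesis unfolding R.expresses_def
    using e(1) by (auto simp: e(2) sum tens_prod_tens_scale)
qed

text \<open>Rational coordinates on the quotient, extended to complex coefficients. They turn
  congruences modulo \<open>ext_C F\<close> into identities of scalars, and so they determine the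
  entries of a period matrix.\<close>

lemma ext_quotient_functionals:
  assumes vs: "vector_space s" and sub: "Modules.module.subspace s F"
    and ws: "is_quotient_basis s F ws"
  obtains \<Omega> where "\<And>i. Modules.module_hom (tens_prod s) (*) (\<Omega> i)"
    and "\<And>i x. x \<in> ext_C F \<Longrightarrow> \<Omega> i x = 0"
    and "\<And>i j. i < length ws \<Longrightarrow> j < length ws \<Longrightarrow> \<Omega> i (ext (ws ! j)) = (if i = j then 1 else 0)"
    and "\<And>x. x - (\<Sum>i<length ws. tens_prod s (\<Omega> i x) (ext (ws ! i))) \<in> ext_C F"
proof -
  interpret vector_space s by fact
  interpret C: Modules.module "tens_prod s" by (rule module_tens_prod[OF vs])
  obtain \<omega> where \<omega>: "\<And>i. Vector_Spaces.linear s (*) (\<omega> i)" "\<And>i x. x \<in> F \<Longrightarrow> \<omega> i x = 0"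
    "\<And>i j. i < length ws \<Longrightarrow> j < length ws \<Longrightarrow> \<omega> i (ws ! j) = (if i = j then 1 else 0)"
    "\<And>x. x - (\<Sum>i<length ws. s (\<omega> i x) (ws ! i)) \<in> F"
    using quotient_coordinate_functionals[OF vs sub ws] by blast
  note add = linear_additive[OF \<omega>(1)]
  note subF = subspace_ext_C[OF vs sub]
  have 4: "x - (\<Sum>i<length ws. tens_prod s (tens_map (\<omega> i) x) (ext (ws ! i))) \<in> ext_C F" for x
  proof (induction x rule: tensor_C_induct)
    case zero
    have "tens_map (\<omega> i) 0 = 0" for i using tens_map_add[OF add, of i 0 0] by simp
    then show ?case using C.subspace_0[OF subF] by simp
  next
    case (tens v z)
    have sum: "tens (\<Sum>i\<in>I. f i) z = (\<Sum>i\<in>I. tens (f i) z)" for I and f :: "nat \<Rightarrow> 'b"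
      by (induction I rule: infinite_finite_induct) (simp_all add: tens_add_left)
    have diff: "tens (a - b) z = tens a z - tens b z" for a b :: 'b
      using tens_add_left[of "a - b" b z] by (simp add: eq_diff_eq)
    have "tens v z - (\<Sum>i<length ws. tens_prod s (tens_map (\<omega> i) (tens v z)) (ext (ws ! i)))
        = tens (v - (\<Sum>i<length ws. s (\<omega> i v) (ws ! i))) z"
      by (simp add: tens_map_tens[OF add] tens_prod_tens_scale sum diff)
    then show ?case using \<omega>(4) by (simp add: ext_C_tens)
  next
    case (add x y)
    then show ?case
      using C.subspace_add[OF subF add]
      by (simp add: tens_map_add[OF linear_additive[OF \<omega>(1)]] C.scale_left_distrib sum.distrib algebra_simps)
  qed
  have 2: "tens_map (\<omega> i) x = 0" if "x \<in> ext_C F" for i x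
    using \<omega>(2) by (rule tens_map_vanishes[OF \<omega>(1) _ that])
  show thesis
    by (rule that[of "\<lambda>i. tens_map (\<omega> i)"])
       (simp_all add: 2 4 \<omega>(3) ext_one tens_map_tens[OF add] module_hom_tens_functional[OF \<omega>(1)])
qed

lemma ext_coordinate_functionals:
  fixes s :: "'e::field_char_0 \<Rightarrow> 'v::ab_group_add \<Rightarrow> 'v"
  assumes "vector_space s" "\<not> Modules.module.dependent s (set vs)" "distinct vs"
  obtains \<Phi> where "\<And>i. Modules.module_hom (tens_prod s) (*) (\<Phi> i)"
    and "\<And>i j. i < length vs \<Longrightarrow> j < length vs \<Longrightarrow> \<Phi> i (ext (vs ! j)) = (if i = j then 1 else 0)"
proof -
  obtain \<phi> where \<phi>: "\<And>i. Vector_Spaces.linear s (*) (\<phi> i)"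
    "\<And>i j. i < length vs \<Longrightarrow> j < length vs \<Longrightarrow> \<phi> i (vs ! j) = (if i = j then 1 else 0)"
    using coordinate_functionals[OF assms] by blast
  show thesis
    by (rule that[of "\<lambda>i. tens_map (\<phi> i)"])
       (simp_all add: \<phi>(2) ext_one tens_map_tens[OF linear_additive[OF \<phi>(1)]]
         module_hom_tens_functional[OF \<phi>(1)])
qed

section \<open>Homogeneous frames\<close>

text \<open>Decompositions can be added and scaled termwise, so their uniqueness makes the
  components linear in the vector.\<close>

lemma (in ring_module) internal_direct_sum_projections:
  assumes sub: "\<And>i. i \<in> J \<Longrightarrow> subspace (X i)" and sum: "internal_direct_sum J X"
  obtains \<pi> where "\<And>i. Modules.module_hom scale scale (\<pi> i)"
    and "\<And>i x. i \<in> J \<Longrightarrow> \<pi> i x \<in> X i" and "\<And>i j x. i \<in> J \<Longrightarrow> x \<in> X i \<Longrightarrow> \<pi> j x = (if j = i then x else 0)"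
proof -
  let ?P = "\<lambda>f x. (\<forall>i\<in>J. f i \<in> X i) \<and> (\<forall>i. i \<notin> J \<longrightarrow> f i = 0) \<and> finite {i. f i \<noteq> 0} \<and>
    x = (\<Sum>i | f i \<noteq> 0. f i)"
  define \<pi> where "\<pi> i x = (THE f. ?P f x) i" for i x
  have P: "?P (\<lambda>i. \<pi> i x) x" for x
  proof -
    have "\<exists>!f. ?P f x" using sum by (simp add: internal_direct_sum_def)
    from theI'[OF this] show ?thesis unfolding \<pi>_def .
  qed
  have unique: "\<pi> i x = f i" if "?P f x" for x f i
  proof -
    have "\<exists>!f. ?P f x" using sum by (simp add: internal_direct_sum_def)
    from the1_equality[OF this, OF that] show ?thesis by (simp only: \<pi>_def)
  qed
  \<comment> \<open>The support of a sum or multiple may shrink by cancellation, so sums over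
    supports are moved to a common finite index set.\<close>
  have sum_eq: "(\<Sum>i | f i \<noteq> 0. f i) = sum f A" if "finite A" "{i. f i \<noteq> 0} \<subseteq> A" for A f
    using that by (intro sum.mono_neutral_left) auto
  have add: "\<pi> i (x + y) = \<pi> i x + \<pi> i y" for i x y
  proof -
    let ?A = "{i. \<pi> i x \<noteq> 0} \<union> {i. \<pi> i y \<noteq> 0}"
    have fin: "finite ?A" using P[of x] P[of y] by simp
    have s: "{i. \<pi> i x + \<pi> i y \<noteq> 0} \<subseteq> ?A" by auto
    have "x = (\<Sum>i\<in>?A. \<pi> i x)" using P[of x] sum_eq[OF fin Un_upper1] by simp
    moreover have "y = (\<Sum>i\<in>?A. \<pi> i y)" using P[of y] sum_eq[OF fin Un_upper2] by simp
    ultimately have "x + y = (\<Sum>i\<in>?A. \<pi> i x + \<pi> i y)" by (simp add: sum.distrib)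
    then have "x + y = (\<Sum>i | \<pi> i x + \<pi> i y \<noteq> 0. \<pi> i x + \<pi> i y)"
      using sum_eq[OF fin s] by simp
    then have "?P (\<lambda>i. \<pi> i x + \<pi> i y) (x + y)"
      using P[of x] P[of y] finite_subset[OF s fin] subspace_add[OF sub] by simp
    then show ?thesis by (rule unique)
  qed
  have scale: "\<pi> i (c *s x) = c *s \<pi> i x" for i c x
  proof -
    let ?A = "{i. \<pi> i x \<noteq> 0}"
    have fin: "finite ?A" using P[of x] by simp
    have s: "{i. c *s \<pi> i x \<noteq> 0} \<subseteq> ?A" by auto
    have "x = (\<Sum>i\<in>?A. \<pi> i x)" using P[of x] by simp
    then have "c *s x = (\<Sum>i\<in>?A. c *s \<pi> i x)" by (metis scale_sum_right)
    then have "c *s x = (\<Sum>i | c *s \<pi> i x \<noteq> 0. c *s \<pi> i x)"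
      using sum_eq[OF fin s] by simp
    then have "?P (\<lambda>i. c *s \<pi> i x) (c *s x)"
      using P[of x] finite_subset[OF s fin] subspace_scale[OF sub] by simp
    then show ?thesis by (rule unique)
  qed
  have 1: "Modules.module_hom scale scale (\<pi> i)" for i
    by unfold_locales (simp_all add: add scale)
  have 2: "\<pi> j x = (if j = i then x else 0)" if "i \<in> J" "x \<in> X i" for i j x
  proof (rule unique[of "\<lambda>j. if j = i then x else 0"])
    have "{j. (if j = i then x else 0) \<noteq> 0} \<subseteq> {i}" by auto
    then have fin: "finite {j. (if j = i then x else 0) \<noteq> 0}" by (rule finite_subset) simp
    have "(\<Sum>j | (if j = i then x else 0) \<noteq> 0. if j = i then x else 0)
        = (\<Sum>j\<in>{i}. if j = i then x else 0)"
      by (rule sum_eq) auto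
    then show "?P (\<lambda>j. if j = i then x else 0) x"
      using that fin subspace_0[OF sub] by auto
  qed
  have 3: "\<pi> i x \<in> X i" if "i \<in> J" for i x using P[of x] that by simp
  show thesis by (rule that[of \<pi>]) (fact 1 3 2)+
qed

section \<open>Complexified structure maps and the equality of the two dimensions\<close>

context pure_realization
begin

sublocale B: vector_space "scaleB M" by (rule betti)

sublocale D: vector_space "scaleD M" by (rule de_rham)

sublocale BC: ring_module "tens_prod (scaleB M)"
  by (intro ring_module.intro module_tens_prod betti)

sublocale DC: ring_module "tens_prod (scaleD M)"
  by (intro ring_module.intro module_tens_prod de_rham)

sublocale comp: Modules.module_hom "tens_prod (scaleB M)" "tens_prod (scaleD M)" "comp M"
  by (rule comp_linear)

abbreviation rhoC :: "'b tensor_C \<Rightarrow> 'b tensor_C" where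
  "rhoC \<equiv> tens_map (rho M)"

sublocale rhoC: Modules.module_hom "tens_prod (scaleB M)" "tens_prod (scaleB M)" rhoC
  by (rule module_hom_tens_map) (rule rho_linear)

lemma rhoC_tens: "rhoC (tens v z) = tens (rho M v) z"
  by (rule tens_map_tens[OF linear_additive[OF rho_linear]])

lemma rhoC_rhoC [simp]: "rhoC (rhoC x) = x"
  by (induction x rule: tensor_C_induct) (simp_all add: rhoC_tens rho_involution rhoC.add)

lemma rhoC_surj: "range rhoC = UNIV"
  by (metis rhoC_rhoC surjI)

abbreviation comp_inv :: "'d tensor_C \<Rightarrow> 'b tensor_C" where
  "comp_inv \<equiv> inv_into UNIV (comp M)"

lemma comp_comp_inv [simp]: "comp M (comp_inv y) = y" and comp_inv_comp [simp]: "comp_inv (comp M x) = x"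
  using comp_bij by (auto simp: bij_def surj_f_inv_f)

sublocale comp_inv: Modules.module_hom "tens_prod (scaleD M)" "tens_prod (scaleB M)" comp_inv
proof unfold_locales
  fix x y r
  show "comp_inv (x + y) = comp_inv x + comp_inv y"
    by (metis comp.add comp_comp_inv comp_inv_comp)
  show "comp_inv (tens_prod (scaleD M) r x) = tens_prod (scaleB M) r (comp_inv x)"
    by (metis comp.scale comp_comp_inv comp_inv_comp)
qed

lemma functional_comp:
  assumes "Modules.module_hom (tens_prod (scaleD M)) (*) \<phi>"
  shows "Modules.module_hom (tens_prod (scaleB M)) (*) (\<lambda>x. \<phi> (comp M x))"
  using module_hom_compose[OF comp_linear assms] by (simp add: o_def)

text \<open>Rational bases of either side are separated by functionals over E \<otimes> \<complex>,
  and \<open>comp M\<close> carries generators of one side to generators of the other;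
  \<open>separated_length_le\<close> compares the lengths both ways.\<close>

lemma dim_betti_eq_dim_de_rham: "B.dim UNIV = D.dim UNIV"
proof (rule antisym)
  obtain vs where vs: "distinct vs" "is_basis (scaleB M) UNIV (set vs)"
    using exists_basis_list[OF betti B.subspace_UNIV] by blast
  obtain xs where xs: "distinct xs" "is_basis (scaleD M) UNIV (set xs)"
    using exists_basis_list[OF de_rham D.subspace_UNIV] by blast
  have spanB: "BC.span (ext ` set vs) = UNIV" and spanD: "DC.span (ext ` set xs) = UNIV"
    using span_ext_spanning[OF betti(1)] span_ext_spanning[OF de_rham(1)] vs xs
    by (auto simp: is_basis_def)
  have len: "length vs = B.dim UNIV" "length xs = D.dim UNIV"
    using is_basis_list_length[OF betti(1)] is_basis_list_length[OF de_rham(1)] vs xs by auto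
  obtain \<Phi> where \<Phi>: "\<And>i. Modules.module_hom (tens_prod (scaleB M)) (*) (\<Phi> i)"
    "\<And>i j. i < length vs \<Longrightarrow> j < length vs \<Longrightarrow> \<Phi> i (ext (vs ! j)) = (if i = j then 1 else 0)"
    using ext_coordinate_functionals[OF betti(1) _ vs(1)] vs(2) unfolding is_basis_def by blast
  obtain \<Psi> where \<Psi>: "\<And>i. Modules.module_hom (tens_prod (scaleD M)) (*) (\<Psi> i)"
    "\<And>i j. i < length xs \<Longrightarrow> j < length xs \<Longrightarrow> \<Psi> i (ext (xs ! j)) = (if i = j then 1 else 0)"
    using ext_coordinate_functionals[OF de_rham(1) _ xs(1)] xs(2) unfolding is_basis_def by blast
  have "length (map ext vs) \<le> length (map (\<lambda>x. comp_inv (ext x)) xs)"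
  proof (rule separated_length_le[of _ _ \<Phi>])
    have "set (map (\<lambda>x. comp_inv (ext x)) xs) = comp_inv ` ext ` set xs" by auto
    then have "BC.span (set (map (\<lambda>x. comp_inv (ext x)) xs)) = range comp_inv"
      by (simp only: comp_inv.span_image spanD)
    also have "\<dots> = UNIV" using comp_inv_comp by (metis surjI)
    finally show "\<exists>x\<in>BC.span (set (map (\<lambda>x. comp_inv (ext x)) xs)). \<forall>i<length (map ext vs). \<Phi> i y = \<Phi> i x" for y
      by auto
  qed (simp_all add: \<Phi> BC.module_axioms)
  then show "B.dim UNIV \<le> D.dim UNIV" by (simp add: len)
  have "length (map ext xs) \<le> length (map (\<lambda>v. comp M (ext v)) vs)"
  proof (rule separated_length_le[of _ _ \<Psi>])
    have "set (map (\<lambda>x. comp M (ext x)) vs) = comp M ` ext ` set vs" by auto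
    then have "DC.span (set (map (\<lambda>x. comp M (ext x)) vs)) = range (comp M)"
      by (simp only: comp.span_image spanB)
    also have "\<dots> = UNIV" using comp_comp_inv by (metis surjI)
    finally show "\<exists>x\<in>DC.span (set (map (\<lambda>x. comp M (ext x)) vs)). \<forall>i<length (map ext xs). \<Psi> i y = \<Psi> i x" for y
      by auto
  qed (simp_all add: \<Psi> DC.module_axioms)
  then show "D.dim UNIV \<le> B.dim UNIV" by (simp add: len)
qed

section \<open>The Hodge filtration on the Betti side and its projections\<close>

definition hodge_fil :: "int \<Rightarrow> 'b tensor_C set" where
  "hodge_fil p = {x. comp M x \<in> ext_C (fil M p)}"

lemma hodge_fil_eq_span: "hodge_fil p = BC.span (\<Union>p'\<in>{p..}. \<Union>q. hodge M p' q)"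
proof -
  have "hodge_fil p = comp_inv ` ext_C (fil M p)"
    unfolding hodge_fil_def by (auto intro: image_eqI[of _ _ "comp M _"])
  then show ?thesis by (simp add: image_image flip: comp_fil)
qed

lemma hodge_fil_subspace: "BC.subspace (hodge_fil p)"
  by (simp add: hodge_fil_eq_span)

lemma hodge_subset_fil: "p \<le> a \<Longrightarrow> x \<in> hodge M a q \<Longrightarrow> x \<in> hodge_fil p"
  unfolding hodge_fil_eq_span by (rule BC.span_base) auto

text \<open>The first index suffices because the weight determines the second. Pieces off the weight
  are zero, so the last clause can be stated for all \<open>q\<close>.\<close>

definition is_hodge_projection :: "(int \<Rightarrow> 'b tensor_C \<Rightarrow> 'b tensor_C) \<Rightarrow> bool" where
  "is_hodge_projection \<pi> \<longleftrightarrow>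
     (\<forall>p. Modules.module_hom (tens_prod (scaleB M)) (tens_prod (scaleB M)) (\<pi> p)) \<and>
     (\<forall>p x. \<pi> p x \<in> hodge M p (weight M - p)) \<and>
     (\<forall>p p' q x. x \<in> hodge M p q \<longrightarrow> \<pi> p' x = (if p' = p then x else 0))"

lemma exists_hodge_projection: "\<exists>\<pi>. is_hodge_projection \<pi>"
proof -
  let ?J = "{(p, q). p + q = weight M}" and ?X = "\<lambda>(p, q). hodge M p q"
  have "BC.subspace (?X i)" for i using hodge_submodule by (cases i) simp
  from BC.internal_direct_sum_projections[OF this hodge_decomposition]
  obtain \<pi> where \<pi>: "\<And>i. Modules.module_hom (tens_prod (scaleB M)) (tens_prod (scaleB M)) (\<pi> i)"
    "\<And>i x. i \<in> ?J \<Longrightarrow> \<pi> i x \<in> ?X i"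
    "\<And>i j x. i \<in> ?J \<Longrightarrow> x \<in> ?X i \<Longrightarrow> \<pi> j x = (if j = i then x else 0)" by blast
  have 3: "\<pi> (p', weight M - p') x = (if p' = p then x else 0)" if x: "x \<in> hodge M p q" for p p' q x
  proof (cases "p + q = weight M")
    case True
    then have "weight M - p' = q \<longleftrightarrow> p' = p" by auto
    then show ?thesis using \<pi>(3)[of "(p, q)" x] x True by auto
  next
    case False
    then have "x = 0" using x hodge_weight by blast
    then show ?thesis using module_hom.zero[OF \<pi>(1)] by simp
  qed
  have 2: "\<pi> (p, weight M - p) x \<in> hodge M p (weight M - p)" for p x
    using \<pi>(2)[of "(p, weight M - p)" x] by simp
  show ?thesis
    unfolding is_hodge_projection_def
    by (rule exI[of _ "\<lambda>p. \<pi> (p, weight M - p)"]) (intro conjI allI impI \<pi>(1) 2 3)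
qed

definition hodge_proj :: "int \<Rightarrow> 'b tensor_C \<Rightarrow> 'b tensor_C" where
  "hodge_proj = (SOME \<pi>. is_hodge_projection \<pi>)"

lemma is_hodge_projection_proj: "is_hodge_projection hodge_proj"
  unfolding hodge_proj_def using exists_hodge_projection by (rule someI_ex)

sublocale proj: Modules.module_hom "tens_prod (scaleB M)" "tens_prod (scaleB M)" "hodge_proj p" for p
  using is_hodge_projection_proj by (simp add: is_hodge_projection_def)

lemma hodge_proj_mem: "hodge_proj p x \<in> hodge M p (weight M - p)"
  and hodge_proj_hodge: "x \<in> hodge M p q \<Longrightarrow> hodge_proj p' x = (if p' = p then x else 0)"
  using is_hodge_projection_proj unfolding is_hodge_projection_def by auto

text \<open>It is enough to look at generators: one of type \<open>p\<close> is removed entirely,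
  one of higher type is untouched and already lies in the next step.\<close>

lemma diff_hodge_proj_mem:
  assumes "x \<in> hodge_fil p"
  shows "x - hodge_proj p x \<in> hodge_fil (p + 1)"
  using assms unfolding hodge_fil_eq_span[of p]
proof (induction rule: BC.span_induct_alt)
  case base
  show ?case using BC.subspace_0[OF hodge_fil_subspace] by (simp add: proj.zero)
next
  case (step c x y)
  then obtain p' q where x: "p \<le> p'" "x \<in> hodge M p' q" by auto
  have "x - hodge_proj p x \<in> hodge_fil (p + 1)"
  proof (cases "p' = p")
    case True
    then show ?thesis using hodge_proj_hodge[OF x(2)] BC.subspace_0[OF hodge_fil_subspace] by simp
  next
    case False
    then show ?thesis using x hodge_proj_hodge[OF x(2)] hodge_subset_fil[of "p + 1" p' x q] by simp
  qed
  then have "tens_prod (scaleB M) c (x - hodge_proj p x) + (y - hodge_proj p y) \<in> hodge_fil (p + 1)"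
    using step by (intro BC.subspace_add[OF hodge_fil_subspace] BC.subspace_scale[OF hodge_fil_subspace])
  then show ?case by (simp add: proj.add proj.scale BC.scale_right_diff_distrib algebra_simps)
qed

text \<open>A vector of Hodge type \<open>(p, q)\<close> is paired with \<open>p\<close>.\<close>

definition homogeneous :: "(int \<times> 'b tensor_C) list \<Rightarrow> bool" where
  "homogeneous bs \<longleftrightarrow> (\<forall>(a, x)\<in>set bs. x \<in> hodge M a (weight M - a))"

text \<open>Plays the role of a basis of V of pure types. Generation by exactly as many vectors as
  the rank replaces independence, which is less convenient over E \<otimes> \<complex>.\<close>

definition hodge_frame :: "(int \<times> 'b tensor_C) list \<Rightarrow> bool" where
  "hodge_frame bs \<longleftrightarrow> homogeneous bs \<and> BC.span (snd ` set bs) = UNIV \<and> length bs = D.dim UNIV"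

text \<open>The projection to type \<open>p\<close> fixes \<open>x\<close>, while in an expansion of
  \<open>x\<close> it kills the frame vectors of every other degree.\<close>

lemma hodge_subset_span_frame:
  assumes "hodge_frame bs" "x \<in> hodge M p q"
  shows "x \<in> BC.span {y. (p, y) \<in> set bs}"
proof -
  have "hodge_proj p y \<in> BC.span {y. (p, y) \<in> set bs}" if "y \<in> BC.span (snd ` set bs)" for y
    using that
  proof (induction rule: BC.span_induct_alt)
    case base
    show ?case by (simp add: proj.zero BC.span_zero)
  next
    case (step c y z)
    then obtain a where a: "(a, y) \<in> set bs" by auto
    then have "y \<in> hodge M a (weight M - a)"
      using assms(1) by (auto simp: hodge_frame_def homogeneous_def)
    then have "hodge_proj p y \<in> BC.span {y. (p, y) \<in> set bs}"
      using a hodge_proj_hodge[of y] by (auto simp: BC.span_zero intro: BC.span_base)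
    then show ?case using step by (simp add: proj.add proj.scale BC.span_add BC.span_scale)
  qed
  then have "hodge_proj p x \<in> BC.span {y. (p, y) \<in> set bs}"
    using assms(1) by (auto simp: hodge_frame_def)
  then show ?thesis using hodge_proj_hodge[OF assms(2)] by simp
qed

lemma hodge_fil_subset_span_frame:
  assumes "hodge_frame bs" "x \<in> hodge_fil p"
  shows "x \<in> BC.span (snd ` {b \<in> set bs. p \<le> fst b})"
proof (rule BC.span_list_minimal)
  show "x \<in> BC.span (\<Union>p'\<in>{p..}. \<Union>q. hodge M p' q)" using assms(2) by (simp add: hodge_fil_eq_span)
  show "(\<Union>p'\<in>{p..}. \<Union>q. hodge M p' q) \<subseteq> BC.span (snd ` {b \<in> set bs. p \<le> fst b})"
  proof
    fix x assume "x \<in> (\<Union>p'\<in>{p..}. \<Union>q. hodge M p' q)"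
    then obtain p' q where p': "p' \<in> {p..}" and x: "x \<in> hodge M p' q" by auto
    have "{y. (p', y) \<in> set bs} \<subseteq> snd ` {b \<in> set bs. p \<le> fst b}" using p' by force
    then show "x \<in> BC.span (snd ` {b \<in> set bs. p \<le> fst b})"
      using BC.span_mono hodge_subset_span_frame[OF assms(1) x] by blast
  qed
qed

text \<open>Descending induction along the filtration. Rational vectors completing a basis of one
  step to a basis of the next larger step are moved to the Betti side and replaced by their
  components of type \<open>p\<close>; this changes them only within the smaller step, which is
  already generated. Bases over E give the exact number of vectors.\<close>

lemma exists_hodge_frame: "\<exists>bs. hodge_frame bs"
proof -
  obtain p1 where p1: "fil M p1 = {0}" using fil_finite by auto
  obtain p0 where p0: "fil M p0 = UNIV" using fil_finite by auto
  obtain B0 where B0: "finite_dimensional_vector_space (scaleD M) B0" using finite_dimE[OF de_rham] .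
  have ind: "\<exists>bs. homogeneous bs \<and> hodge_fil (p1 - int n) \<subseteq> BC.span (snd ` set bs) \<and>
      length bs = D.dim (fil M (p1 - int n))" for n
  proof (induction n)
    case 0
    have "ext_C (fil M p1) = {0}"
      using ext_C_span[OF de_rham(1), of "{}"] by (simp add: p1)
    then have "x = 0" if "x \<in> hodge_fil p1" for x
      using that comp_inv.zero comp_inv_comp[of x] by (auto simp: hodge_fil_def)
    moreover have "D.dim {0} = 0"
      using D.dim_span[of "{}"] finite_dimensional_vector_space.dim_empty[OF B0] by simp
    ultimately show ?case by (intro exI[of _ "[]"]) (auto simp: homogeneous_def p1 BC.span_zero)
  next
    case (Suc n)
    define p where "p = p1 - int (Suc n)"
    have p': "p1 - int n = p + 1" by (simp add: p_def)
    obtain bs where bs: "homogeneous bs" "hodge_fil (p + 1) \<subseteq> BC.span (snd ` set bs)"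
      "length bs = D.dim (fil M (p + 1))" using Suc unfolding p' by auto
    obtain A where A: "A \<subseteq> fil M (p + 1)" "D.independent A" "fil M (p + 1) \<subseteq> D.span A"
      by (metis D.basis_exists)
    have spanA: "D.span A = fil M (p + 1)"
      using A D.span_minimal[OF A(1) fil_subspace] by (intro equalityI)
    have "A \<subseteq> fil M p" using A(1) fil_decreasing[of p "p + 1"] by auto
    then obtain C where C: "A \<subseteq> C" "C \<subseteq> fil M p" "D.independent C" "fil M p \<subseteq> D.span C"
      using D.maximal_independent_subset_extend[OF _ A(2)] by metis
    have spanC: "D.span C = fil M p"
      using C D.span_minimal[OF C(2) fil_subspace] by (intro equalityI)
    have finC: "finite C" using C(3) by (rule finite_dimensional_vector_space.finiteI_independent[OF B0])
    obtain ws where ws: "set ws = C - A" "distinct ws" using finite_distinct_list[of "C - A"] finC by auto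
    define cs where "cs = map (\<lambda>w. (p, hodge_proj p (comp_inv (ext w)))) ws"
    have "homogeneous (cs @ bs)"
      using bs(1) hodge_proj_mem by (auto simp: homogeneous_def cs_def)
    moreover have "hodge_fil p \<subseteq> BC.span (snd ` set (cs @ bs))"
    proof
      fix x assume "x \<in> hodge_fil p"
      then have "comp M x \<in> DC.span (ext ` C)"
        using ext_C_span[OF de_rham(1), of C] by (simp add: hodge_fil_def spanC)
      then have "comp_inv (comp M x) \<in> BC.span (comp_inv ` ext ` C)"
        unfolding comp_inv.span_image by (rule imageI)
      moreover have bs_span: "BC.span (snd ` set bs) \<subseteq> BC.span (snd ` set (cs @ bs))"
        by (rule BC.span_mono) auto
      have "comp_inv ` ext ` C \<subseteq> BC.span (snd ` set (cs @ bs))"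
      proof clarify
        fix c assume c: "c \<in> C"
        let ?y = "comp_inv (ext c)"
        show "?y \<in> BC.span (snd ` set (cs @ bs))"
        proof (cases "c \<in> A")
          case True
          then have "?y \<in> hodge_fil (p + 1)" using A(1) by (auto simp: hodge_fil_def intro: ext_C_tens)
          then show ?thesis using bs(2) bs_span by blast
        next
          case False
          have "?y \<in> hodge_fil p" using c C(2) by (auto simp: hodge_fil_def intro: ext_C_tens)
          then have "?y - hodge_proj p ?y \<in> BC.span (snd ` set (cs @ bs))"
            using diff_hodge_proj_mem bs(2) bs_span by blast
          moreover have "hodge_proj p ?y \<in> BC.span (snd ` set (cs @ bs))"
            using False c ws(1) by (intro BC.span_base) (force simp: cs_def)
          ultimately have "?y - hodge_proj p ?y + hodge_proj p ?y \<in> BC.span (snd ` set (cs @ bs))"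
            by (rule BC.span_add)
          then show ?thesis by simp
        qed
      qed
      ultimately show "x \<in> BC.span (snd ` set (cs @ bs))"
        using BC.span_list_minimal by (metis comp_inv_comp)
    qed
    moreover have "length (cs @ bs) = D.dim (fil M p)"
    proof -
      have "length cs = card C - card A"
        using ws distinct_card[OF ws(2)] finC C(1) by (simp add: cs_def card_Diff_subset finite_subset)
      moreover have "card A \<le> card C" using finC C(1) by (rule card_mono)
      ultimately show ?thesis
        using bs(3) D.dim_span_eq_card_independent[OF A(2)] D.dim_span_eq_card_independent[OF C(3)]
        by (simp add: spanA spanC)
    qed
    ultimately show ?case unfolding p_def[symmetric] by blast
  qed
  \<comment> \<open>For the zero space \<open>p0\<close> may exceed \<open>p1\<close>; the induction
    therefore runs down to their minimum, where the filtration is still the whole space.\<close>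
  have min: "p1 - int (nat (p1 - min p0 p1)) = min p0 p1" by simp
  obtain bs where bs: "homogeneous bs" "hodge_fil (min p0 p1) \<subseteq> BC.span (snd ` set bs)"
      "length bs = D.dim (fil M (min p0 p1))"
    using ind[of "nat (p1 - min p0 p1)"] unfolding min by blast
  moreover have "fil M (min p0 p1) = UNIV" using fil_decreasing[of "min p0 p1" p0] p0 by auto
  ultimately show ?thesis by (auto simp: hodge_frame_def hodge_fil_def ext_C_UNIV)
qed

text \<open>Two lower bounds from \<open>separated_length_le\<close>: frame vectors of degree below
  \<open>p\<close> generate the quotient by the filtration step, those of degree at least
  \<open>p\<close> generate the step itself. The total length is \<open>D.dim UNIV\<close>, so both
  bounds are equalities.\<close>

lemma hodge_frame_count:
  assumes bs: "hodge_frame bs"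
  shows "length (filter (\<lambda>b. p \<le> fst b) bs) = D.dim (fil M p)"
proof (rule antisym)
  obtain B0 where B0: "finite_dimensional_vector_space (scaleD M) B0" using finite_dimE[OF de_rham] .
  have dim_le: "D.dim (fil M p) \<le> D.dim UNIV"
    by (rule finite_dimensional_vector_space.dim_subset[OF B0 subset_UNIV])
  have total: "length (filter (\<lambda>b. p \<le> fst b) bs) + length (filter (\<lambda>b. \<not> p \<le> fst b) bs) = D.dim UNIV"
    using bs unfolding hodge_frame_def by (simp only: sum_length_filter_compl)
  obtain ws where ws: "is_quotient_basis (scaleD M) (fil M p) ws"
    "length ws = D.dim UNIV - D.dim (fil M p)"
    using exists_quotient_basis[OF de_rham fil_subspace] .
  obtain \<Omega> where \<Omega>: "\<And>i. Modules.module_hom (tens_prod (scaleD M)) (*) (\<Omega> i)"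
    "\<And>i x. x \<in> ext_C (fil M p) \<Longrightarrow> \<Omega> i x = 0"
    "\<And>i j. i < length ws \<Longrightarrow> j < length ws \<Longrightarrow> \<Omega> i (ext (ws ! j)) = (if i = j then 1 else 0)"
    "\<And>x. x - (\<Sum>i<length ws. tens_prod (scaleD M) (\<Omega> i x) (ext (ws ! i))) \<in> ext_C (fil M p)"
    using ext_quotient_functionals[OF de_rham(1) fil_subspace ws(1)] by blast
  let ?us = "map snd (filter (\<lambda>b. \<not> p \<le> fst b) bs)"
  have "length (map (\<lambda>w. comp_inv (ext w)) ws) \<le> length ?us"
  proof (rule separated_length_le[of _ "tens_prod (scaleB M)" "\<lambda>i x. \<Omega> i (comp M x)"])
    show "Modules.module_hom (tens_prod (scaleB M)) (*) (\<lambda>x. \<Omega> i (comp M x))" for i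
      by (rule functional_comp) (rule \<Omega>)
    fix y
    let ?vs = "snd ` {b \<in> set bs. p \<le> fst b}"
    have "snd ` set bs = ?vs \<union> set ?us" by auto
    then have "y \<in> BC.span (?vs \<union> set ?us)" using bs unfolding hodge_frame_def by (metis UNIV_I)
    then obtain v u where vu: "y = v + u" "v \<in> BC.span ?vs" "u \<in> BC.span (set ?us)"
      unfolding BC.span_Un by blast
    have "?vs \<subseteq> hodge_fil p"
      using bs hodge_subset_fil[of p] unfolding hodge_frame_def homogeneous_def by force
    then have "v \<in> hodge_fil p" using vu(2) BC.span_minimal[OF _ hodge_fil_subspace] by blast
    then have "\<Omega> i (comp M y) = \<Omega> i (comp M u)" for i
      using module_hom.add[OF \<Omega>(1)] \<Omega>(2) by (simp add: vu(1) comp.add hodge_fil_def)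
    then show "\<exists>x\<in>BC.span (set ?us).
        \<forall>i<length (map (\<lambda>w. comp_inv (ext w)) ws). \<Omega> i (comp M y) = \<Omega> i (comp M x)"
      using vu(3) by blast
  qed (simp_all add: \<Omega>(3) BC.module_axioms)
  then show "length (filter (\<lambda>b. p \<le> fst b) bs) \<le> D.dim (fil M p)"
    using total dim_le ws(2) by simp
  obtain xs where xs: "distinct xs" "is_basis (scaleD M) (fil M p) (set xs)"
    using exists_basis_list[OF de_rham fil_subspace] by blast
  obtain \<Psi> where \<Psi>: "\<And>i. Modules.module_hom (tens_prod (scaleD M)) (*) (\<Psi> i)"
    "\<And>i j. i < length xs \<Longrightarrow> j < length xs \<Longrightarrow> \<Psi> i (ext (xs ! j)) = (if i = j then 1 else 0)"
    using ext_coordinate_functionals[OF de_rham(1) _ xs(1)] xs(2) unfolding is_basis_def by blast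
  let ?vs = "map snd (filter (\<lambda>b. p \<le> fst b) bs)"
  have "length (map (\<lambda>x. comp_inv (ext x)) xs) \<le> length ?vs"
  proof (rule separated_length_le[of _ "tens_prod (scaleB M)" "\<lambda>i x. \<Psi> i (comp M x)"])
    show "Modules.module_hom (tens_prod (scaleB M)) (*) (\<lambda>x. \<Psi> i (comp M x))" for i
      by (rule functional_comp) (rule \<Psi>)
    fix y assume "y \<in> set (map (\<lambda>x. comp_inv (ext x)) xs)"
    then obtain x where x: "y = comp_inv (ext x)" "x \<in> set xs" by auto
    then have "x \<in> fil M p" using xs(2) D.span_base unfolding is_basis_def by blast
    then have "y \<in> hodge_fil p" by (simp add: x hodge_fil_def ext_C_tens)
    then have "y \<in> BC.span (set ?vs)" using hodge_fil_subset_span_frame[OF bs] by simp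
    then show "\<exists>x\<in>BC.span (set ?vs).
        \<forall>i<length (map (\<lambda>x. comp_inv (ext x)) xs). \<Psi> i (comp M y) = \<Psi> i (comp M x)"
      by blast
  qed (simp_all add: \<Psi>(2) BC.module_axioms)
  then show "D.dim (fil M p) \<le> length (filter (\<lambda>b. p \<le> fst b) bs)"
    using is_basis_list_length[OF de_rham(1) xs(2,1)] by simp
qed

section \<open>Reflection of Hodge types by \<rho>\<close>

abbreviation reflect :: "int \<times> 'b tensor_C \<Rightarrow> int \<times> 'b tensor_C" where
  "reflect b \<equiv> (weight M - fst b, rhoC (snd b))"

lemma rhoC_hodge: "x \<in> hodge M p q \<Longrightarrow> rhoC x \<in> hodge M q p"
  using hodge_rho[of p q] by blast

lemma homogeneous_reflect: "homogeneous bs \<Longrightarrow> homogeneous (map reflect bs)"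
  using rhoC_hodge by (fastforce simp: homogeneous_def)

lemma span_reflect: "BC.span (snd ` reflect ` S) = rhoC ` BC.span (snd ` S)"
  by (simp add: image_image flip: rhoC.span_image)

lemma hodge_frame_reflect: "hodge_frame bs \<Longrightarrow> hodge_frame (map reflect bs)"
  using homogeneous_reflect by (auto simp: hodge_frame_def span_reflect rhoC_surj)

end

text \<open>This is the absence of a middle type. According to whether \<open>2 * p \<le> w\<close>,
  one of the conditions \<open>\<not> p \<le> f b\<close> and \<open>p \<le> w - f b\<close> implies
  the other; as both hold equally often along the list, the two filters coincide.\<close>

lemma opposite_degrees:
  fixes p w :: int
  assumes "length (filter (\<lambda>b. p \<le> f b) bs) + length (filter (\<lambda>b. p \<le> w - f b) bs) = length bs"
    and "b \<in> set bs"
  shows "p \<le> f b \<longleftrightarrow> \<not> p \<le> w - f b"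
proof -
  have 1: "length (filter (\<lambda>b. \<not> p \<le> f b) bs) = length (filter (\<lambda>b. p \<le> w - f b) bs)"
    using assms(1) sum_length_filter_compl[of "\<lambda>b. p \<le> f b" bs] by simp
  have *: "filter P bs = filter Q bs"
    if "length (filter P bs) = length (filter Q bs)" "\<And>b. P b \<Longrightarrow> Q b" for P Q
  proof -
    have "filter P bs = filter P (filter Q bs)"
      using that(2) by (metis (mono_tags, lifting) filter_cong filter_filter)
    then show ?thesis using that(1) by (metis length_filter_less filter_True nat_neq_iff)
  qed
  have "filter (\<lambda>b. \<not> p \<le> f b) bs = filter (\<lambda>b. p \<le> w - f b) bs"
  proof (cases "2 * p \<le> w")
    case True
    then show ?thesis using 1 by (intro *) auto
  next
    case False
    then show ?thesis using 1 by (intro *[symmetric]) auto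
  qed
  from arg_cong[OF this, of set] show ?thesis using assms(2) by auto
qed

section \<open>Periods in terms of a transversal of the filtration step\<close>

lemma dvd_one_cancel_right:
  fixes a b c :: "'a::comm_ring_1"
  assumes "c dvd 1" "a * c = b * c"
  shows "a = b"
proof -
  obtain d where d: "1 = c * d" using assms(1) by (elim dvdE)
  have "a = a * c * d" by (simp add: mult.assoc flip: d)
  also have "\<dots> = b * c * d" by (simp only: assms(2))
  finally show ?thesis by (simp add: mult.assoc flip: d)
qed

lemma field_units_coset:
  fixes x :: "'e::field_char_0 tensor_C"
  assumes "e \<noteq> 0"
  shows "field_units #>\<^bsub>coeff_units\<^esub> (ext e * x) = field_units #>\<^bsub>coeff_units\<^esub> x"
proof -
  have "\<exists>h. h \<noteq> 0 \<and> ext a * (ext e * x) = ext h * x" if "a \<noteq> 0" for a :: 'e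
    using that assms by (intro exI[of _ "a * e"]) (simp add: mult.assoc flip: ext_mult)
  moreover have "\<exists>h. h \<noteq> 0 \<and> ext a * x = ext h * (ext e * x)" if "a \<noteq> 0" for a :: 'e
    using that assms by (intro exI[of _ "a / e"]) (simp add: ext_mult flip: mult.assoc)
  ultimately show ?thesis
    unfolding r_coset_def field_units_def coeff_units_def by (auto, blast, blast)
qed

context pure_realization
begin

lemma hodge_step_iff:
  "sub_hodge_step M UNIV UNIV \<epsilon> F \<longleftrightarrow>
     (\<exists>p. F = fil M p) \<and> D.dim UNIV - D.dim F = eig_dim M \<epsilon>"
  by (simp add: sub_hodge_step_def)

lemma hodge_step_subspace: "sub_hodge_step M UNIV UNIV \<epsilon> F \<Longrightarrow> D.subspace F"
  using fil_subspace by (auto simp: hodge_step_iff)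

text \<open>The steps form a chain, so two of equal dimension coincide. The signs may differ: this
  yields the common step \<open>F\<close> when both eigenspaces have the same dimension.\<close>

lemma hodge_step_unique:
  assumes "sub_hodge_step M UNIV UNIV \<epsilon> F" "sub_hodge_step M UNIV UNIV \<epsilon>' F'"
    and "eig_dim M \<epsilon> = eig_dim M \<epsilon>'"
  shows "F = F'"
proof -
  obtain B0 where B0: "finite_dimensional_vector_space (scaleD M) B0" using finite_dimE[OF de_rham] .
  interpret D': finite_dimensional_vector_space "scaleD M" B0 by (rule B0)
  obtain p p' where p: "F = fil M p" "F' = fil M p'" using assms by (auto simp: hodge_step_iff)
  \<comment> \<open>Subtraction on nat is truncated; these bounds recover the dimensions from the
    codimensions.\<close>
  have "D.dim F \<le> D.dim UNIV" "D.dim F' \<le> D.dim UNIV" by (intro D'.dim_subset subset_UNIV)+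
  then have dim: "D.dim F = D.dim F'" using assms by (auto simp: hodge_step_iff)
  have *: "fil M a = fil M b" if "a \<le> b" "D.dim (fil M a) = D.dim (fil M b)" for a b
    using D'.subspace_dim_equal[OF fil_subspace fil_subspace fil_decreasing[OF that(1)]] that(2) by simp
  show ?thesis
  proof (cases "p \<le> p'")
    case True
    then show ?thesis using *[of p p'] dim p by simp
  next
    case False
    then show ?thesis using *[of p' p] dim p by simp
  qed
qed

lemma eigenspace_subspace: "B.subspace (eigenspace M \<epsilon>)"
proof -
  interpret r: Vector_Spaces.linear "scaleB M" "scaleB M" "rho M" by (rule rho_linear)
  show ?thesis
    by (rule B.subspaceI)
      (simp_all add: eigenspace_def r.zero r.add r.scale B.scale_right_distrib mult.commute)
qed

section \<open>Symmetrization and eigenbases\<close>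

text \<open>For \<epsilon> = \<plusminus>1 this is twice the projector onto the eigenspace of \<rho>
  for \<epsilon>.\<close>

definition symmetrize :: "'e \<Rightarrow> 'b tensor_C \<Rightarrow> 'b tensor_C" where
  "symmetrize \<epsilon> x = x + tens_prod (scaleB M) (ext \<epsilon>) (rhoC x)"

lemma symmetrize_tens: "symmetrize \<epsilon> (tens v z) = tens (v + scaleB M \<epsilon> (rho M v)) z"
  by (simp add: symmetrize_def rhoC_tens B.tens_prod_tens_scale tens_add_left)

lemma symmetrize_one: "symmetrize 1 x = x + rhoC x"
  by (simp add: symmetrize_def ext_one)

lemma symmetrize_minus_one: "symmetrize (- 1) x = x - rhoC x"
proof -
  interpret comm_ring_hom "ext :: 'e \<Rightarrow> 'e tensor_C" by (rule comm_ring_hom_ext)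
  show ?thesis by (simp add: symmetrize_def hom_uminus ext_one)
qed

text \<open>On a pure tensor only the rational factor is affected, and v + \<epsilon> \<rho> v is an
  eigenvector because \<rho> is an involution and \<epsilon> squares to 1.\<close>

lemma symmetrize_mem_ext_eigenspace:
  assumes "\<epsilon> = 1 \<or> \<epsilon> = - 1"
  shows "symmetrize \<epsilon> x \<in> ext_C (eigenspace M \<epsilon>)"
proof -
  interpret r: Vector_Spaces.linear "scaleB M" "scaleB M" "rho M" by (rule rho_linear)
  note sub = subspace_ext_C[OF betti(1) eigenspace_subspace, of \<epsilon>]
  show ?thesis
  proof (induction x rule: tensor_C_induct)
    case zero
    show ?case using BC.subspace_0[OF sub] by (simp add: symmetrize_def rhoC.zero)
  next
    case (tens v z)
    have "v + scaleB M \<epsilon> (rho M v) \<in> eigenspace M \<epsilon>"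
      using assms by (auto simp: eigenspace_def r.add r.scale rho_involution B.scale_right_distrib)
    then show ?case by (simp add: symmetrize_tens ext_C_tens)
  next
    case (add x y)
    have "symmetrize \<epsilon> (x + y) = symmetrize \<epsilon> x + symmetrize \<epsilon> y"
      by (simp add: symmetrize_def rhoC.add BC.scale_right_distrib algebra_simps)
    then show ?case using BC.subspace_add[OF sub add] by simp
  qed
qed

definition eigenbasis :: "'e \<Rightarrow> 'b list \<Rightarrow> bool" where
  "eigenbasis \<epsilon> vs \<longleftrightarrow> distinct vs \<and> is_basis (scaleB M) (eigenspace M \<epsilon>) (set vs)"

lemma eigenbasis_length: "eigenbasis \<epsilon> vs \<Longrightarrow> length vs = eig_dim M \<epsilon>"
  using is_basis_list_length[OF betti(1)] by (simp add: eigenbasis_def sub_eig_dim_def)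

lemma symmetrize_mem_span_eigenbasis:
  assumes "\<epsilon> = 1 \<or> \<epsilon> = - 1" "eigenbasis \<epsilon> vs"
  shows "symmetrize \<epsilon> x \<in> BC.span (set (map ext vs))"
  using symmetrize_mem_ext_eigenspace[OF assms(1)] ext_C_span[OF betti(1), of "set vs"] assms(2)
  by (simp add: eigenbasis_def is_basis_def)

text \<open>Isolates what the vectors e_i of the outline contribute to the periods. Hodge types are
  left out, so that the notion applies unchanged to the tensor product.\<close>

definition transversal :: "'d set \<Rightarrow> 'b tensor_C list \<Rightarrow> bool" where
  "transversal F us \<longleftrightarrow> length us = D.dim UNIV - D.dim F \<and>
     (\<forall>u\<in>set us. comp M (rhoC u) \<in> ext_C F) \<and>
     (\<forall>x. \<exists>y\<in>BC.span (set us). comp M (x - y) \<in> ext_C F)"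

text \<open>The determinant on the right does not depend on the sign \<open>\<epsilon>\<close>, because modulo \<open>F \<otimes> \<complex>\<close> a
  transversal vector agrees with its symmetrization.\<close>

lemma transversal_det:
  assumes F: "D.subspace F" and ws: "is_quotient_basis (scaleD M) F ws"
    and us: "transversal F us" and len: "length ws = length us"
  obtains T where "T \<in> carrier_mat (length ws) (length us)" "det T dvd 1"
    and "\<And>vs. \<exists>A\<in>carrier_mat (length ws) (length vs). \<forall>j<length vs. comp M (ext (vs ! j))
           - (\<Sum>i<length ws. tens_prod (scaleD M) (A $$ (i, j)) (ext (ws ! i))) \<in> ext_C F"
    and "\<And>\<epsilon> vs \<alpha> A. length vs = length ws \<Longrightarrow>
        BC.rel_det (map ext vs) (map (symmetrize \<epsilon>) us) \<alpha> \<Longrightarrow>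
        A \<in> carrier_mat (length ws) (length vs) \<Longrightarrow>
        (\<And>j. j < length vs \<Longrightarrow> comp M (ext (vs ! j))
           - (\<Sum>i<length ws. tens_prod (scaleD M) (A $$ (i, j)) (ext (ws ! i))) \<in> ext_C F) \<Longrightarrow>
        det A * \<alpha> = det T"
proof -
  let ?n = "length ws"
  obtain \<Omega> where \<Omega>: "\<And>i. Modules.module_hom (tens_prod (scaleD M)) (*) (\<Omega> i)"
    "\<And>i x. x \<in> ext_C F \<Longrightarrow> \<Omega> i x = 0"
    "\<And>i j. i < ?n \<Longrightarrow> j < ?n \<Longrightarrow> \<Omega> i (ext (ws ! j)) = (if i = j then 1 else 0)"
    "\<And>x. x - (\<Sum>i<?n. tens_prod (scaleD M) (\<Omega> i x) (ext (ws ! i))) \<in> ext_C F"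
    using ext_quotient_functionals[OF de_rham(1) F ws] by blast
  note \<Omega>_sum = module_hom.sum[OF \<Omega>(1)] and \<Omega>_scale = module_hom.scale[OF \<Omega>(1)]
    and \<Omega>_add = module_hom.add[OF \<Omega>(1)] and \<Omega>_diff = module_hom.diff[OF \<Omega>(1)]
  \<comment> \<open>The matrix of the transversal in the quotient coordinates of \<open>ws\<close>;
    neither \<epsilon> nor an eigenbasis enters.\<close>
  define T where "T = mat ?n ?n (\<lambda>(i, j). \<Omega> i (comp M (us ! j)))"
  have T: "T \<in> carrier_mat ?n ?n" by (simp add: T_def)
  have "\<exists>c. comp M (comp_inv (ext (ws ! j)) - (\<Sum>l<?n. tens_prod (scaleB M) (c l) (us ! l))) \<in> ext_C F" for j
    using us BC.in_span_list[of _ us] unfolding transversal_def len by metis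
  then obtain c where c: "\<And>j. comp M (comp_inv (ext (ws ! j))
      - (\<Sum>l<?n. tens_prod (scaleB M) (c j l) (us ! l))) \<in> ext_C F" by metis
  \<comment> \<open>The coefficients \<open>c\<close> expand preimages of the \<open>ws\<close> in
    the transversal modulo \<open>F\<close>, so they form a right inverse of
    \<open>T\<close>.\<close>
  have "T * mat ?n ?n (\<lambda>(l, j). c j l) = 1\<^sub>m ?n"
  proof (rule eq_matI)
    fix i j assume "i < dim_row (1\<^sub>m ?n :: 'e tensor_C mat)" "j < dim_col (1\<^sub>m ?n :: 'e tensor_C mat)"
    then have ij: "i < ?n" "j < ?n" by auto
    have "(T * mat ?n ?n (\<lambda>(l, j). c j l)) $$ (i, j) = (\<Sum>l<?n. c j l * \<Omega> i (comp M (us ! l)))"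
      using ij by (simp add: T_def scalar_prod_def atLeast0LessThan mult.commute)
    also have "\<dots> = \<Omega> i (ext (ws ! j))"
      using \<Omega>(2)[OF c, of i j] by (simp add: comp.diff comp.sum comp.scale \<Omega>_diff \<Omega>_sum \<Omega>_scale)
    finally show "(T * mat ?n ?n (\<lambda>(l, j). c j l)) $$ (i, j) = (1\<^sub>m ?n) $$ (i, j)"
      using ij \<Omega>(3) by simp
  qed (use T in auto)
  then have unit: "det T dvd 1" by (intro det_dvd_one_of_right_inverse[OF T]) auto
  have ex: "\<exists>A\<in>carrier_mat ?n (length vs). \<forall>j<length vs. comp M (ext (vs ! j))
      - (\<Sum>i<?n. tens_prod (scaleD M) (A $$ (i, j)) (ext (ws ! i))) \<in> ext_C F" for vs
  proof (intro bexI allI impI)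
    fix j assume "j < length vs"
    then have "(\<Sum>i<?n. tens_prod (scaleD M) (mat ?n (length vs) (\<lambda>(i, j). \<Omega> i (comp M (ext (vs ! j)))) $$ (i, j)) (ext (ws ! i)))
        = (\<Sum>i<?n. tens_prod (scaleD M) (\<Omega> i (comp M (ext (vs ! j)))) (ext (ws ! i)))"
      by (intro sum.cong) auto
    then show "comp M (ext (vs ! j))
      - (\<Sum>i<?n. tens_prod (scaleD M) (mat ?n (length vs) (\<lambda>(i, j). \<Omega> i (comp M (ext (vs ! j)))) $$ (i, j)) (ext (ws ! i))) \<in> ext_C F"
      using \<Omega>(4) by simp
  qed simp
  have det: "det A * \<alpha> = det T"
    if vs: "length vs = ?n" and \<alpha>: "BC.rel_det (map ext vs) (map (symmetrize \<epsilon>) us) \<alpha>"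
      and A: "A \<in> carrier_mat ?n (length vs)"
        "\<And>j. j < length vs \<Longrightarrow> comp M (ext (vs ! j))
           - (\<Sum>i<?n. tens_prod (scaleD M) (A $$ (i, j)) (ext (ws ! i))) \<in> ext_C F"
    for \<epsilon> vs \<alpha> A
  proof -
    obtain R where R: "BC.expresses (map ext vs) R (map (symmetrize \<epsilon>) us)" "det R = \<alpha>"
      using \<alpha> by (auto simp: BC.rel_det_def)
    have carrier: "A \<in> carrier_mat ?n ?n" "R \<in> carrier_mat ?n ?n"
      using A(1) BC.expressesD(1)[OF R(1)] vs len by auto
    \<comment> \<open>The functionals vanish on \<open>ext_C F\<close>, so the congruence modulo
      \<open>F\<close> determines each entry of \<open>A\<close>.\<close>
    have A_eq: "A $$ (i, j) = \<Omega> i (comp M (ext (vs ! j)))" if ij: "i < ?n" "j < ?n" for i j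
    proof -
      have "\<Omega> i (comp M (ext (vs ! j))) = (\<Sum>l<?n. A $$ (l, j) * \<Omega> i (ext (ws ! l)))"
        using \<Omega>(2)[OF A(2), of j i] ij vs by (simp add: \<Omega>_diff \<Omega>_sum \<Omega>_scale)
      also have "\<dots> = (\<Sum>l<?n. if l = i then A $$ (i, j) else 0)"
        using \<Omega>(3) ij by (intro sum.cong) auto
      finally show ?thesis using ij by simp
    qed
    \<comment> \<open>\<open>R\<close> holds the coordinates of the symmetrized vectors in
      \<open>vs\<close>, and \<open>A\<close> those of \<open>vs\<close> in the quotient; the
      summand with \<rho> dies there.\<close>
    have "A * R = T"
    proof (rule eq_matI)
      fix i j assume "i < dim_row T" "j < dim_col T"
      then have ij: "i < ?n" "j < ?n" using T by auto
      have "(A * R) $$ (i, j) = (\<Sum>l<?n. R $$ (l, j) * \<Omega> i (comp M (ext (vs ! l))))"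
        using ij carrier by (simp add: scalar_prod_def atLeast0LessThan A_eq mult.commute)
      also have "\<dots> = \<Omega> i (comp M (\<Sum>l<?n. tens_prod (scaleB M) (R $$ (l, j)) (ext (vs ! l))))"
        by (simp add: comp.sum comp.scale \<Omega>_sum \<Omega>_scale)
      also have "(\<Sum>l<?n. tens_prod (scaleB M) (R $$ (l, j)) (ext (vs ! l))) = symmetrize \<epsilon> (us ! j)"
        using BC.expressesD(2)[OF R(1), of j] ij len vs by simp
      also have "\<Omega> i (comp M (symmetrize \<epsilon> (us ! j))) = \<Omega> i (comp M (us ! j))"
      proof -
        have "comp M (rhoC (us ! j)) \<in> ext_C F" using us ij len by (simp add: transversal_def)
        then show ?thesis
          using \<Omega>(2) by (simp add: symmetrize_def comp.add comp.scale \<Omega>_add \<Omega>_scale)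
      qed
      finally show "(A * R) $$ (i, j) = T $$ (i, j)" using ij by (simp add: T_def)
    qed (use T carrier in auto)
    then show ?thesis using det_mult[OF carrier] R(2) by simp
  qed
  show thesis using T len by (intro that[OF _ unit ex det]) auto
qed

lemma quotient_basis_change:
  assumes F: "D.subspace F" and ws: "is_quotient_basis (scaleD M) F ws"
    and ws': "is_quotient_basis (scaleD M) F ws'"
  obtains W where "W \<in> carrier_mat (length ws) (length ws')"
    and "\<And>j. j < length ws' \<Longrightarrow> ext (ws' ! j)
        - (\<Sum>i<length ws. tens_prod (scaleD M) (ext (W $$ (i, j))) (ext (ws ! i))) \<in> ext_C F"
proof -
  have "\<exists>c. x - (\<Sum>i<length ws. scaleD M (c i) (ws ! i)) \<in> F" for x
    using ws unfolding is_quotient_basis_def by blast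
  then obtain c where c: "\<And>x. x - (\<Sum>i<length ws. scaleD M (c x i) (ws ! i)) \<in> F" by metis
  have sum: "ext (\<Sum>i\<in>I. f i) = (\<Sum>i\<in>I. ext (f i))" for I and f :: "nat \<Rightarrow> 'd"
    by (induction I rule: infinite_finite_induct) (simp_all add: tens_add_left)
  have diff: "ext (a - b) = ext a - ext b" for a b :: 'd
    using tens_add_left[of "a - b" b 1] by (simp add: eq_diff_eq)
  let ?W = "mat (length ws) (length ws') (\<lambda>(i, j). c (ws' ! j) i)"
  have "ext (ws' ! j) - (\<Sum>i<length ws. tens_prod (scaleD M) (ext (?W $$ (i, j))) (ext (ws ! i))) \<in> ext_C F"
    if "j < length ws'" for j
  proof -
    have "ext (ws' ! j) - (\<Sum>i<length ws. tens_prod (scaleD M) (ext (?W $$ (i, j))) (ext (ws ! i)))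
        = ext (ws' ! j - (\<Sum>i<length ws. scaleD M (c (ws' ! j) i) (ws ! i)))"
      using that by (simp add: diff sum D.tens_prod_tens_scale)
    then show ?thesis using c by (simp add: ext_C_tens)
  qed
  then show thesis by (intro that[of ?W]) auto
qed

text \<open>Both bases are rational, so the matrix has entries in E and its determinant comes from
  E.\<close>

lemma eigenbasis_change:
  assumes vs: "eigenbasis \<epsilon> vs" and vs': "eigenbasis \<epsilon> vs'"
  shows "\<exists>e. BC.rel_det (map ext vs) (map ext vs') (ext e)"
proof -
  interpret E: ring_module "scaleB M" ..
  interpret h: comm_ring_hom "ext :: 'e \<Rightarrow> 'e tensor_C" by (rule comm_ring_hom_ext)
  have "set vs' \<subseteq> B.span (set vs)"
    using vs vs' B.span_superset by (auto simp: eigenbasis_def is_basis_def)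
  then obtain A where A: "E.expresses vs A vs'" using E.exists_expresses by blast
  have "BC.expresses (map ext vs) (map_mat ext A) (map ext vs')"
    by (rule expresses_ext[OF betti(1) A])
  moreover have "length vs' = length vs"
    using vs vs' by (simp add: eigenbasis_length)
  ultimately show ?thesis unfolding BC.rel_det_def by (metis h.hom_det length_map)
qed

lemma ext_dvd_one: "(ext e :: 'e tensor_C) dvd 1 \<Longrightarrow> e \<noteq> 0"
  by auto

text \<open>Here \<tau> is the determinant of \<open>T\<close>: each period is \<tau> divided by the
  volume \<alpha> of the symmetrized transversal, with the same \<tau> for both signs. The proof
  also establishes that \<open>period\<close> is well defined, since another choice of rational
  bases changes the determinant only by factors from E.\<close>

lemma period_transversal:
  assumes step0: "sub_hodge_step M UNIV UNIV \<epsilon>0 F" and us: "transversal F us"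
  obtains \<tau> where "\<tau> dvd 1"
    and "\<And>\<epsilon> vs \<alpha>. \<epsilon> = 1 \<or> \<epsilon> = - 1 \<Longrightarrow> sub_hodge_step M UNIV UNIV \<epsilon> F \<Longrightarrow> eigenbasis \<epsilon> vs \<Longrightarrow>
        BC.rel_det (map ext vs) (map (symmetrize \<epsilon>) us) \<alpha> \<Longrightarrow>
        \<exists>c. c * \<alpha> = \<tau> \<and> period M \<epsilon> = field_units #>\<^bsub>coeff_units\<^esub> c"
proof -
  note F = hodge_step_subspace[OF step0]
  obtain ws where ws: "is_quotient_basis (scaleD M) F ws" "length ws = D.dim UNIV - D.dim F"
    using exists_quotient_basis[OF de_rham F] .
  have len: "length ws = length us" using ws(2) us by (simp add: transversal_def)
  let ?n = "length ws"
  obtain T where T: "T \<in> carrier_mat ?n (length us)" "det T dvd 1"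
    and ex: "\<And>vs. \<exists>A\<in>carrier_mat ?n (length vs). \<forall>j<length vs. comp M (ext (vs ! j))
           - (\<Sum>i<?n. tens_prod (scaleD M) (A $$ (i, j)) (ext (ws ! i))) \<in> ext_C F"
    and det: "\<And>\<epsilon> vs \<alpha> A. length vs = ?n \<Longrightarrow>
        BC.rel_det (map ext vs) (map (symmetrize \<epsilon>) us) \<alpha> \<Longrightarrow>
        A \<in> carrier_mat ?n (length vs) \<Longrightarrow>
        (\<And>j. j < length vs \<Longrightarrow> comp M (ext (vs ! j))
           - (\<Sum>i<?n. tens_prod (scaleD M) (A $$ (i, j)) (ext (ws ! i))) \<in> ext_C F) \<Longrightarrow>
        det A * \<alpha> = det T"
    using transversal_det[OF F ws(1) us len] by blast
  have "\<exists>c. c * \<alpha> = det T \<and> period M \<epsilon> = field_units #>\<^bsub>coeff_units\<^esub> c"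
    if \<epsilon>: "\<epsilon> = 1 \<or> \<epsilon> = - 1" and step: "sub_hodge_step M UNIV UNIV \<epsilon> F" and vs: "eigenbasis \<epsilon> vs"
      and \<alpha>: "BC.rel_det (map ext vs) (map (symmetrize \<epsilon>) us) \<alpha>" for \<epsilon> vs \<alpha>
  proof -
    have eig: "eig_dim M \<epsilon> = ?n" using step ws(2) by (simp add: hodge_step_iff)
    have len_vs: "length vs = ?n" using eigenbasis_length[OF vs] eig by simp
    obtain A where A: "A \<in> carrier_mat ?n (length vs)"
      "\<And>j. j < length vs \<Longrightarrow> comp M (ext (vs ! j))
           - (\<Sum>i<?n. tens_prod (scaleD M) (A $$ (i, j)) (ext (ws ! i))) \<in> ext_C F"
      using ex[of vs] by blast
    have pA: "is_period_matrix M \<epsilon> A"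
      unfolding is_period_matrix_def using step vs ws(1) A unfolding eigenbasis_def by blast
    \<comment> \<open>Another period matrix may use other bases \<open>vs'\<close> and
      \<open>ws'\<close>, but the filtration step is forced. Comparing both matrices with the same
      transversal isolates the rational factors \<open>e\<close> and \<open>det W\<close>.\<close>
    have coset: "field_units #>\<^bsub>coeff_units\<^esub> det A' = field_units #>\<^bsub>coeff_units\<^esub> det A"
      if pA': "is_period_matrix M \<epsilon> A'" for A'
    proof -
      obtain F' vs' ws' where p: "sub_hodge_step M UNIV UNIV \<epsilon> F'" "distinct vs'"
        "is_basis (scaleB M) (eigenspace M \<epsilon>) (set vs')" "is_quotient_basis (scaleD M) F' ws'"
        "A' \<in> carrier_mat (length ws') (length vs')"
        "\<forall>j<length vs'. comp M (ext (vs' ! j))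
           - (\<Sum>i<length ws'. tens_prod (scaleD M) (A' $$ (i, j)) (ext (ws' ! i))) \<in> ext_C F'"
        using pA' unfolding is_period_matrix_def by blast
      have F': "F' = F" by (rule hodge_step_unique[OF p(1) step refl])
      note p = p[unfolded F']
      have vs': "eigenbasis \<epsilon> vs'" using p by (simp add: eigenbasis_def)
      have len_vs': "length vs' = ?n" using eigenbasis_length[OF vs'] eig by simp
      have len_ws': "length ws' = ?n"
        using quotient_basis_length_le[OF de_rham(1) F ws(1) p(4)]
          quotient_basis_length_le[OF de_rham(1) F p(4) ws(1)] by simp
      obtain R where R: "BC.expresses (map ext vs') R (map (symmetrize \<epsilon>) us)"
        using BC.exists_expresses[of "map (symmetrize \<epsilon>) us" "map ext vs'"]
          symmetrize_mem_span_eigenbasis[OF \<epsilon> vs'] by auto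
      then have R': "BC.rel_det (map ext vs') (map (symmetrize \<epsilon>) us) (det R)"
        using len len_vs' by (auto simp: BC.rel_det_def)
      obtain e where e: "BC.rel_det (map ext vs) (map ext vs') (ext e)"
        using eigenbasis_change[OF vs vs'] by blast
      have 1: "det A * (ext e * det R) = det T"
        using det[OF len_vs BC.rel_det_trans[OF e R'] A] .
      obtain W where W: "W \<in> carrier_mat ?n (length ws')"
        "\<And>j. j < length ws' \<Longrightarrow> ext (ws' ! j)
          - (\<Sum>i<?n. tens_prod (scaleD M) (ext (W $$ (i, j))) (ext (ws ! i))) \<in> ext_C F"
        using quotient_basis_change[OF F ws(1) p(4)] by blast
      let ?W = "map_mat ext W :: 'e tensor_C mat"
      have carrier: "?W \<in> carrier_mat ?n ?n" "A' \<in> carrier_mat ?n ?n"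
        using W(1) p(5) len_ws' len_vs' by auto
      note sub = subspace_ext_C[OF de_rham(1) F]
      \<comment> \<open>\<open>?W * A'\<close> rewrites \<open>A'\<close> in the quotient basis
        \<open>ws\<close> and keeps \<open>vs'\<close> on the source side, so \<open>det\<close>
        applies to it.\<close>
      have 2: "det (?W * A') * det R = det T"
      proof (rule det[OF len_vs' R'])
        show "?W * A' \<in> carrier_mat ?n (length vs')" using carrier len_vs' by auto
        fix j assume j: "j < length vs'"
        have "(\<Sum>l<?n. tens_prod (scaleD M) (A' $$ (l, j)) (ext (ws' ! l)
              - (\<Sum>i<?n. tens_prod (scaleD M) (?W $$ (i, l)) (ext (ws ! i))))) \<in> ext_C F"
          using W len_ws' by (intro DC.subspace_sum[OF sub] DC.subspace_scale[OF sub]) auto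
        moreover have "comp M (ext (vs' ! j))
            - (\<Sum>l<?n. tens_prod (scaleD M) (A' $$ (l, j)) (ext (ws' ! l))) \<in> ext_C F"
          using p(6) j len_ws' by auto
        ultimately have "comp M (ext (vs' ! j))
            - (\<Sum>l<?n. tens_prod (scaleD M) (A' $$ (l, j)) (ext (ws' ! l)))
          + (\<Sum>l<?n. tens_prod (scaleD M) (A' $$ (l, j)) (ext (ws' ! l)
              - (\<Sum>i<?n. tens_prod (scaleD M) (?W $$ (i, l)) (ext (ws ! i))))) \<in> ext_C F"
          by (intro DC.subspace_add[OF sub])
        also have "(\<Sum>l<?n. tens_prod (scaleD M) (A' $$ (l, j)) (ext (ws' ! l)
              - (\<Sum>i<?n. tens_prod (scaleD M) (?W $$ (i, l)) (ext (ws ! i)))))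
            = (\<Sum>l<?n. tens_prod (scaleD M) (A' $$ (l, j)) (ext (ws' ! l)))
            - (\<Sum>l<?n. \<Sum>i<?n. tens_prod (scaleD M) (A' $$ (l, j) * ?W $$ (i, l)) (ext (ws ! i)))"
          by (simp add: DC.scale_right_diff_distrib DC.scale_sum_right sum_subtractf)
        also have "(\<Sum>l<?n. \<Sum>i<?n. tens_prod (scaleD M) (A' $$ (l, j) * ?W $$ (i, l)) (ext (ws ! i)))
            = (\<Sum>i<?n. tens_prod (scaleD M) (\<Sum>l<?n. A' $$ (l, j) * ?W $$ (i, l)) (ext (ws ! i)))"
          by (subst sum.swap) (simp add: DC.scale_sum_left)
        also have "\<dots> = (\<Sum>i<?n. tens_prod (scaleD M) ((?W * A') $$ (i, j)) (ext (ws ! i)))"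
          using carrier j len_vs' W len_ws'
          by (intro sum.cong) (auto simp: scalar_prod_def atLeast0LessThan mult.commute)
        finally show "comp M (ext (vs' ! j))
            - (\<Sum>i<?n. tens_prod (scaleD M) ((?W * A') $$ (i, j)) (ext (ws ! i))) \<in> ext_C F"
          by simp
      qed
      interpret h: comm_ring_hom "ext :: 'e \<Rightarrow> 'e tensor_C" by (rule comm_ring_hom_ext)
      have 3: "det (?W * A') = ext (det W) * det A'"
        using det_mult[OF carrier] by simp
      have "det R dvd 1" using 2 T(2) by (metis dvd_trans dvd_triv_right)
      moreover have "ext e * det A * det R = ext (det W) * det A' * det R"
        using 1 2 3 by (simp add: mult_ac)
      ultimately have 4: "ext e * det A = ext (det W) * det A'" by (rule dvd_one_cancel_right)
      \<comment> \<open>\<open>ext e\<close> divides the unit \<open>det T\<close>, and zero divides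
        no unit.\<close>
      have "e \<noteq> 0"
      proof (rule ext_dvd_one)
        show "(ext e :: 'e tensor_C) dvd 1" using 1 T(2) by (metis dvd_mult2 dvd_trans dvd_triv_left dvd_triv_right)
      qed
      moreover have "det W \<noteq> 0"
      proof (rule ext_dvd_one)
        show "(ext (det W) :: 'e tensor_C) dvd 1"
          using 2 3 T(2) by (metis dvd_mult2 dvd_trans dvd_triv_left)
      qed
      ultimately show ?thesis using 4 field_units_coset by metis
    qed
    have "period M \<epsilon> = field_units #>\<^bsub>coeff_units\<^esub> det A"
      unfolding period_def
    proof (rule the_equality)
      show "\<exists>Aa. is_period_matrix M \<epsilon> Aa \<and>
          field_units #>\<^bsub>coeff_units\<^esub> det A = field_units #>\<^bsub>coeff_units\<^esub> det Aa"
        using pA by blast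
    qed (use coset in blast)
    then show ?thesis using det[OF len_vs \<alpha> A] by blast
  qed
  then show thesis using that[OF T(2)] by blast
qed

section \<open>Decomposition of the Betti space into the eigenspaces of \<rho>\<close>

lemma eigenvectors_split:
  "\<exists>x\<in>eigenspace M 1. \<exists>y\<in>eigenspace M (- 1). v = x + y"
proof -
  interpret r: Vector_Spaces.linear "scaleB M" "scaleB M" "rho M" by (rule rho_linear)
  let ?x = "scaleB M (1 / 2) (v + rho M v)" and ?y = "scaleB M (1 / 2) (v - rho M v)"
  have "?x \<in> eigenspace M 1" "?y \<in> eigenspace M (- 1)"
    by (simp_all add: eigenspace_def r.add r.diff r.scale rho_involution add.commute
        flip: B.scale_minus_right)
  moreover have "v = ?x + ?y"
    by (simp add: algebra_simps flip: B.scale_left_distrib)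
  ultimately show ?thesis by blast
qed

lemma eigenspaces_disjoint: "v \<in> eigenspace M 1 \<Longrightarrow> v \<in> eigenspace M (- 1) \<Longrightarrow> v = 0"
proof -
  assume "v \<in> eigenspace M 1" "v \<in> eigenspace M (- 1)"
  then have "v = - v" by (simp add: eigenspace_def)
  then have "v + v = 0" by (metis add.right_inverse)
  then have "scaleB M 2 v = 0" by (metis B.scale_left_distrib B.scale_one one_add_one)
  then show "v = 0" by simp
qed

lemma eigenbasis_append:
  assumes vp: "eigenbasis 1 vp" and vm: "eigenbasis (- 1) vm"
  shows "distinct (vp @ vm)" "is_basis (scaleB M) UNIV (set (vp @ vm))"
proof -
  note p = vp[unfolded eigenbasis_def is_basis_def] and m = vm[unfolded eigenbasis_def is_basis_def]
  have disj: "set vp \<inter> set vm = {}"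
  proof -
    have "v = 0" if "v \<in> set vp" "v \<in> set vm" for v
      using that p m B.span_base by (metis eigenspaces_disjoint)
    then show ?thesis using p B.dependent_zero by blast
  qed
  then show "distinct (vp @ vm)" using p m by simp
  have "v \<in> B.span (set vp \<union> set vm)" for v
    using eigenvectors_split[of v] p m unfolding B.span_Un by blast
  moreover have "B.independent (set vp \<union> set vm)"
  proof (rule B.independent_if_scalars_zero)
    fix f v assume sum: "(\<Sum>x\<in>set vp \<union> set vm. scaleB M (f x) x) = 0" and v: "v \<in> set vp \<union> set vm"
    let ?x = "\<Sum>x\<in>set vp. scaleB M (f x) x" and ?y = "\<Sum>x\<in>set vm. scaleB M (f x) x"
    have "?x + ?y = 0" using sum disj by (simp add: sum.union_disjoint)
    moreover have x: "?x \<in> eigenspace M 1" and y: "?y \<in> eigenspace M (- 1)"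
      using p m B.span_sum B.span_scale B.span_base by (metis (no_types, lifting))+
    moreover have "?x = - ?y" using \<open>?x + ?y = 0\<close> by (simp add: add_eq_0_iff2)
    ultimately have "?x = 0" using eigenspaces_disjoint B.subspace_neg[OF eigenspace_subspace] by metis
    moreover from this have "?y = 0" using \<open>?x + ?y = 0\<close> by simp
    ultimately show "f v = 0"
      using v p m B.independentD[of "set vp" "set vp" f v] B.independentD[of "set vm" "set vm" f v] by auto
  qed simp
  ultimately show "is_basis (scaleB M) UNIV (set (vp @ vm))" by (auto simp: is_basis_def)
qed

lemma exists_eigenbasis: "\<exists>vs. eigenbasis \<epsilon> vs"
  using exists_basis_list[OF betti eigenspace_subspace] by (auto simp: eigenbasis_def)

lemma dim_eq_eig_dims: "B.dim UNIV = eig_dim M 1 + eig_dim M (- 1)"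
proof -
  obtain vp vm where v: "eigenbasis 1 vp" "eigenbasis (- 1) vm" using exists_eigenbasis by metis
  have "length (vp @ vm) = B.dim UNIV"
    using is_basis_list_length[OF betti(1)] eigenbasis_append[OF v] by blast
  then show ?thesis using eigenbasis_length[OF v(1)] eigenbasis_length[OF v(2)] by simp
qed

text \<open>In the basis glued from the two eigenbases, \<rho> is diagonal with entries 1 and
  -1.\<close>

lemma trace_of_rho: "trace_of (scaleB M) (rho M) = of_int (int (eig_dim M 1) - int (eig_dim M (- 1)))"
proof -
  obtain vp vm where v: "eigenbasis 1 vp" "eigenbasis (- 1) vm" using exists_eigenbasis by metis
  let ?B = "set (vp @ vm)"
  note B = eigenbasis_append[OF v]
  have ind: "B.independent ?B" using B(2) by (simp add: is_basis_def)
  have vec: "rho M b = scaleB M 1 b" if "b \<in> set vp" for b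
    using that v(1) B.span_base unfolding eigenbasis_def is_basis_def eigenspace_def by blast
  have vec': "rho M b = scaleB M (- 1) b" if "b \<in> set vm" for b
    using that v(2) B.span_base unfolding eigenbasis_def is_basis_def eigenspace_def by blast
  have rep: "B.representation ?B (scaleB M c b) b = c" if "b \<in> ?B" for c b
    using B.representation_scale[OF ind B.span_base[OF that]] B.representation_basis[OF ind that] by simp
  have "trace_of (scaleB M) (rho M) = (\<Sum>b\<in>?B. B.representation ?B (rho M b) b)"
    by (rule trace_of_basis[OF betti(1) rho_linear _ B(2)]) simp
  also have "\<dots> = (\<Sum>b\<in>set vp. B.representation ?B (rho M b) b) + (\<Sum>b\<in>set vm. B.representation ?B (rho M b) b)"
    using B(1) by (simp add: sum.union_disjoint)
  also have "(\<Sum>b\<in>set vp. B.representation ?B (rho M b) b) = (\<Sum>b\<in>set vp. 1)"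
    using rep vec by (intro sum.cong) (simp_all del: B.scale_one)
  also have "(\<Sum>b\<in>set vm. B.representation ?B (rho M b) b) = (\<Sum>b\<in>set vm. - 1)"
    using rep vec' by (intro sum.cong) (simp_all del: B.scale_minus_left)
  finally show ?thesis
    using B(1) eigenbasis_length[OF v(1)] eigenbasis_length[OF v(2)]
    by (simp add: distinct_card)
qed

end

section \<open>Frames adapted to the middle filtration step\<close>

context pure_realization
begin

text \<open>A frame and its reflection have equally many vectors of degree at least
  \<open>p\<close>. At half the total dimension these counts add up to the length of the frame, so
  \<open>opposite_degrees\<close> applies: a vector of degree at least \<open>p\<close> has its
  \<rho>-image in degree below \<open>p\<close>, which is generated by \<open>L\<close>.\<close>

lemma middle_step_half_frame:
  assumes bs: "hodge_frame bs" and dim: "D.dim UNIV = 2 * D.dim (fil M p)"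
  defines "L \<equiv> filter (\<lambda>b. \<not> p \<le> fst b) bs"
  shows "hodge_frame (L @ map reflect L)" "length L = D.dim (fil M p)"
proof -
  let ?w = "weight M"
  have c: "length (filter (\<lambda>b. p \<le> fst b) bs) = D.dim (fil M p)" by (rule hodge_frame_count[OF bs])
  have "length (filter (\<lambda>b. p \<le> fst b) (map reflect bs)) = D.dim (fil M p)"
    by (rule hodge_frame_count[OF hodge_frame_reflect[OF bs]])
  then have c': "length (filter (\<lambda>b. p \<le> ?w - fst b) bs) = D.dim (fil M p)"
    by (simp add: filter_map o_def)
  have total: "length bs = 2 * D.dim (fil M p)" using bs dim by (simp add: hodge_frame_def)
  have opp: "p \<le> fst b \<longleftrightarrow> \<not> p \<le> ?w - fst b" if "b \<in> set bs" for b
    using opposite_degrees[of p fst bs ?w b] c c' total that by simp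
  show len: "length L = D.dim (fil M p)"
    using c total sum_length_filter_compl[of "\<lambda>b. p \<le> fst b" bs] by (simp add: L_def)
  have hom: "homogeneous L" using bs by (auto simp: L_def hodge_frame_def homogeneous_def)
  have "snd ` set bs \<subseteq> BC.span (snd ` set (L @ map reflect L))"
  proof clarify
    fix a x assume b: "(a, x) \<in> set bs"
    show "snd (a, x) \<in> BC.span (snd ` set (L @ map reflect L))"
    proof (cases "p \<le> a")
      case True
      have "x \<in> hodge M a (?w - a)" using b bs by (auto simp: hodge_frame_def homogeneous_def)
      then have "rhoC x \<in> BC.span {y. (?w - a, y) \<in> set bs}"
        by (intro hodge_subset_span_frame[OF bs]) (rule rhoC_hodge)
      moreover have "{y. (?w - a, y) \<in> set bs} \<subseteq> snd ` set L"
        using opp[OF b] True by (force simp: L_def)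
      ultimately have "rhoC x \<in> BC.span (snd ` set L)" using BC.span_mono by blast
      then have "rhoC (rhoC x) \<in> BC.span (snd ` reflect ` set L)"
        unfolding span_reflect by (rule imageI)
      then show ?thesis
        using BC.span_mono[of "snd ` reflect ` set L" "snd ` set (L @ map reflect L)"]
        by (auto simp: image_Un)
    next
      case False
      then show ?thesis using b by (intro BC.span_base) (force simp: L_def)
    qed
  qed
  then have "BC.span (snd ` set bs) \<subseteq> BC.span (snd ` set (L @ map reflect L))"
    using BC.span_minimal[OF _ BC.subspace_span] by blast
  then have "BC.span (snd ` set (L @ map reflect L)) = UNIV"
    using bs by (simp add: hodge_frame_def top.extremum_unique)
  moreover have "homogeneous (L @ map reflect L)"
    using hom homogeneous_reflect[OF hom] by (auto simp: homogeneous_def)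
  ultimately show "hodge_frame (L @ map reflect L)"
    using len dim by (simp add: hodge_frame_def)
qed

text \<open>Here \<open>L\<close> may contain degrees on both sides of \<open>p\<close>, as can
  happen for the products e_i \<otimes> f_k. Exactly one of a vector and its \<rho>-image has degree
  below \<open>p\<close>; choosing that one puts the other into the filtration step.\<close>

lemma middle_step_transversal:
  assumes L: "hodge_frame (L @ map reflect L)" and len: "length L = D.dim (fil M p)"
  defines "us \<equiv> map (\<lambda>b. if p \<le> fst b then rhoC (snd b) else snd b) L"
  shows "transversal (fil M p) us"
proof -
  let ?w = "weight M"
  have "length (filter (\<lambda>b. p \<le> fst b) (L @ map reflect L)) = D.dim (fil M p)"
    by (rule hodge_frame_count[OF L])
  then have "length (filter (\<lambda>b. p \<le> fst b) L) + length (filter (\<lambda>b. p \<le> ?w - fst b) L) = length L"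
    by (simp add: filter_map o_def len)
  note opp = opposite_degrees[OF this]
  have hom: "x \<in> hodge M a (?w - a)" if "(a, x) \<in> set L" for a x
    using L that by (auto simp: hodge_frame_def homogeneous_def)
  have rho: "rhoC u \<in> hodge_fil p" if mem: "u \<in> set us" for u
  proof -
    obtain b where "b \<in> set L" "u = (if p \<le> fst b then rhoC (snd b) else snd b)"
      using mem unfolding us_def set_map by blast
    then obtain a x where b: "(a, x) \<in> set L" and u: "u = (if p \<le> a then rhoC x else x)"
      by (metis prod.collapse)
    show ?thesis
    proof (cases "p \<le> a")
      case True
      then show ?thesis using hodge_subset_fil[OF _ hom[OF b]] u by simp
    next
      case False
      then have "p \<le> ?w - a" using opp[OF b] by simp
      then show ?thesis using hodge_subset_fil[OF _ rhoC_hodge[OF hom[OF b]]] u False by simp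
    qed
  qed
  have dim: "D.dim UNIV = 2 * D.dim (fil M p)" using L len by (simp add: hodge_frame_def)
  have "\<exists>y\<in>BC.span (set us). comp M (x - y) \<in> ext_C (fil M p)" for x
  proof -
    have "x \<in> BC.span (snd ` set (L @ map reflect L))" using L by (simp add: hodge_frame_def)
    \<comment> \<open>Exchanging a vector with its \<rho>-image does not change the set of the two,
      so the chosen vectors and their images still generate.\<close>
    moreover have "snd ` set (L @ map reflect L) \<subseteq> set us \<union> rhoC ` set us"
    proof
      fix y assume "y \<in> snd ` set (L @ map reflect L)"
      then obtain a z where b: "(a, z) \<in> set L" and y: "y = z \<or> y = rhoC z" by auto
      have "(if p \<le> a then rhoC z else z) \<in> set us" using b by (force simp: us_def)
      then show "y \<in> set us \<union> rhoC ` set us"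
        using y by (auto split: if_splits intro: image_eqI[of _ _ "rhoC z"])
    qed
    ultimately have "x \<in> BC.span (set us \<union> rhoC ` set us)" using BC.span_mono by blast
    then obtain y z where yz: "x = y + z" "y \<in> BC.span (set us)" "z \<in> BC.span (rhoC ` set us)"
      unfolding BC.span_Un by blast
    have "rhoC ` set us \<subseteq> hodge_fil p" using rho by blast
    then have "z \<in> hodge_fil p" using yz(3) BC.span_minimal[OF _ hodge_fil_subspace] by blast
    then show ?thesis using yz(1,2) by (intro bexI[of _ y]) (simp_all add: hodge_fil_def)
  qed
  then show ?thesis
    using rho dim len by (auto simp: transversal_def hodge_fil_def us_def)
qed

end


section \<open>Tensor products\<close>

locale tensor_realization =
  M: pure_realization M + M': pure_realization M' + N: pure_realization N
  for M :: "('e::field_char_0, 'b1::ab_group_add, 'd1::ab_group_add) realization"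
    and M' :: "('e, 'b2::ab_group_add, 'd2::ab_group_add) realization"
    and N :: "('e, 'b3::ab_group_add, 'd3::ab_group_add) realization" +
  fixes tB :: "'b1 \<Rightarrow> 'b2 \<Rightarrow> 'b3" and tD :: "'d1 \<Rightarrow> 'd2 \<Rightarrow> 'd3"
  assumes tensor: "is_tensor_realization tB tD M M' N"
begin

lemma is_tensor_product_betti: "is_tensor_product (scaleB M) (scaleB M') (scaleB N) tB"
  and weight_N: "weight N = weight M + weight M'"
  and rho_tB: "rho N (tB v v') = tB (rho M v) (rho M' v')"
  and hodge_N: "hodge N p q = N.BC.span
        (\<Union>a. \<Union>b. {tens_prod tB x x' | x x'. x \<in> hodge M a b \<and> x' \<in> hodge M' (p - a) (q - b)})"
  using tensor unfolding is_tensor_realization_def by blast+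

lemma linear_tB: "Vector_Spaces.linear (scaleB M) (scaleB N) (\<lambda>v. tB v v')"
    "Vector_Spaces.linear (scaleB M') (scaleB N) (tB v)"
  using is_tensor_product_betti unfolding is_tensor_product_def by blast+

lemma biadditive_tB: "biadditive tB"
  using additive.add[OF linear_additive[OF linear_tB(1)]] additive.add[OF linear_additive[OF linear_tB(2)]]
  by (simp add: biadditive_def)

lemma tB_scale: "tB (scaleB M c v) v' = scaleB N c (tB v v')" "tB v (scaleB M' c v') = scaleB N c (tB v v')"
  using linear_tB by (simp_all add: Vector_Spaces.linear_iff)

abbreviation tensC :: "'b1 tensor_C \<Rightarrow> 'b2 tensor_C \<Rightarrow> 'b3 tensor_C" (infixl "\<boxtimes>" 70) where
  "x \<boxtimes> y \<equiv> tens_prod tB x y"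

lemmas tensC_rules = tens_prod_add_left[OF biadditive_tB] tens_prod_add_right[OF biadditive_tB]
  tens_prod_zero_left[OF biadditive_tB] tens_prod_zero_right[OF biadditive_tB]
  tens_prod_tens[OF biadditive_tB]

lemma ext_tB: "ext (tB v v') = ext v \<boxtimes> ext v'"
  by (simp add: tensC_rules)

lemma tensC_scale_left: "tens_prod (scaleB M) r x \<boxtimes> y = tens_prod (scaleB N) r (x \<boxtimes> y)"
proof (induction r rule: tensor_C_induct)
  case (tens c z)
  show ?case
  proof (induction x rule: tensor_C_induct)
    case (tens v u)
    show ?case
      by (induction y rule: tensor_C_induct)
        (simp_all add: tensC_rules M.B.tens_prod_tens_scale N.B.tens_prod_tens_scale tB_scale
          N.BC.scale_right_distrib mult.assoc)
  qed (simp_all add: tensC_rules M.BC.scale_right_distrib N.BC.scale_right_distrib)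
qed (simp_all add: tensC_rules M.BC.scale_left_distrib N.BC.scale_left_distrib)

lemma tensC_scale_right: "x \<boxtimes> tens_prod (scaleB M') r y = tens_prod (scaleB N) r (x \<boxtimes> y)"
proof (induction r rule: tensor_C_induct)
  case (tens c z)
  show ?case
  proof (induction x rule: tensor_C_induct)
    case (tens v u)
    show ?case
      by (induction y rule: tensor_C_induct)
        (simp_all add: tensC_rules M'.B.tens_prod_tens_scale N.B.tens_prod_tens_scale tB_scale
          M'.BC.scale_right_distrib N.BC.scale_right_distrib mult_ac)
  qed (simp_all add: tensC_rules N.BC.scale_right_distrib)
qed (simp_all add: tensC_rules M'.BC.scale_left_distrib N.BC.scale_left_distrib)

lemma module_hom_tensC_left: "Modules.module_hom (tens_prod (scaleB M)) (tens_prod (scaleB N)) (\<lambda>x. x \<boxtimes> y)"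
  by unfold_locales (simp_all add: tensC_rules tensC_scale_left)

lemma module_hom_tensC_right: "Modules.module_hom (tens_prod (scaleB M')) (tens_prod (scaleB N)) (\<lambda>y. x \<boxtimes> y)"
  by unfold_locales (simp_all add: tensC_rules tensC_scale_right)

lemma tensC_diff: "(x - x') \<boxtimes> y = x \<boxtimes> y - x' \<boxtimes> y" "x'' \<boxtimes> (z - z') = x'' \<boxtimes> z - x'' \<boxtimes> z'"
  using module_hom.diff[OF module_hom_tensC_left] module_hom.diff[OF module_hom_tensC_right] by auto

lemma rhoC_tensC: "N.rhoC (x \<boxtimes> y) = M.rhoC x \<boxtimes> M'.rhoC y"
proof (induction x rule: tensor_C_induct)
  case (tens v z)
  show ?case
    by (induction y rule: tensor_C_induct)
      (simp_all add: tensC_rules M.rhoC_tens M'.rhoC_tens N.rhoC_tens rho_tB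
        M'.rhoC.zero N.rhoC.zero M'.rhoC.add N.rhoC.add)
qed (simp_all add: tensC_rules M.rhoC.zero N.rhoC.zero M.rhoC.add N.rhoC.add)

lemma hodge_tensC:
  assumes "x \<in> hodge M a b" "y \<in> hodge M' a' b'"
  shows "x \<boxtimes> y \<in> hodge N (a + a') (b + b')"
  unfolding hodge_N by (rule N.BC.span_base) (use assms in force)

lemma span_tensC_right:
  assumes "\<And>y. y \<in> Y \<Longrightarrow> x \<boxtimes> y \<in> N.BC.span S" "y \<in> M'.BC.span Y"
  shows "x \<boxtimes> y \<in> N.BC.span S"
proof -
  interpret h: Modules.module_hom "tens_prod (scaleB M')" "tens_prod (scaleB N)" "\<lambda>y. x \<boxtimes> y"
    by (rule module_hom_tensC_right)
  have "x \<boxtimes> y \<in> N.BC.span ((\<lambda>y. x \<boxtimes> y) ` Y)" unfolding h.span_image using assms(2) by (rule imageI)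
  moreover have "(\<lambda>y. x \<boxtimes> y) ` Y \<subseteq> N.BC.span S" using assms(1) by blast
  ultimately show ?thesis using N.BC.span_list_minimal by blast
qed

lemma span_tensC_left:
  assumes "\<And>x. x \<in> X \<Longrightarrow> x \<boxtimes> y \<in> N.BC.span S" "x \<in> M.BC.span X"
  shows "x \<boxtimes> y \<in> N.BC.span S"
proof -
  interpret h: Modules.module_hom "tens_prod (scaleB M)" "tens_prod (scaleB N)" "\<lambda>x. x \<boxtimes> y"
    by (rule module_hom_tensC_left)
  have "x \<boxtimes> y \<in> N.BC.span ((\<lambda>x. x \<boxtimes> y) ` X)" unfolding h.span_image using assms(2) by (rule imageI)
  moreover have "(\<lambda>x. x \<boxtimes> y) ` X \<subseteq> N.BC.span S" using assms(1) by blast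
  ultimately show ?thesis using N.BC.span_list_minimal by blast
qed

lemma tensor_basis:
  assumes "is_basis (scaleB M) UNIV B" "is_basis (scaleB M') UNIV C"
  shows "inj_on (case_prod tB) (B \<times> C)" "is_basis (scaleB N) UNIV (case_prod tB ` (B \<times> C))"
  using is_tensor_product_betti assms unfolding is_tensor_product_def by blast+

text \<open>Rational bases of the factors give a rational basis of the tensor product, and this
  still generates after extension of scalars.\<close>

lemma span_tensC_UNIV:
  assumes "\<And>x y. x \<boxtimes> y \<in> N.BC.span S"
  shows "N.BC.span S = UNIV"
proof -
  obtain vs where vs: "is_basis (scaleB M) UNIV (set vs)"
    using exists_basis_list[OF M.betti M.B.subspace_UNIV] by blast
  obtain ws where ws: "is_basis (scaleB M') UNIV (set ws)"
    using exists_basis_list[OF M'.betti M'.B.subspace_UNIV] by blast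
  let ?T = "case_prod tB ` (set vs \<times> set ws)"
  have "N.BC.span (ext ` ?T) = UNIV"
    using tensor_basis(2)[OF vs ws] by (intro span_ext_spanning[OF N.betti(1)]) (simp add: is_basis_def)
  moreover have "ext ` ?T \<subseteq> N.BC.span S" using assms ext_tB by auto
  ultimately show ?thesis using N.BC.span_minimal[OF _ N.BC.subspace_span] by blast
qed

text \<open>The factor from M' is the outer index: each fixed \<open>w\<close> contributes a block
  that is an image of \<open>vs\<close>, as \<open>rel_det_product\<close> requires.\<close>

abbreviation tB_list :: "'b2 list \<Rightarrow> 'b1 list \<Rightarrow> 'b3 list" where
  "tB_list ws vs \<equiv> map (\<lambda>(w, v). tB v w) (List.product ws vs)"

text \<open>Eigenvalues multiply, so each list lies in one eigenspace, and together the lists form a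
  tensor basis. As the eigenspaces meet only in 0, each list must generate its own.\<close>

lemma tensor_eigenbases:
  assumes vp: "M.eigenbasis 1 vp" and vm: "M.eigenbasis (- 1) vm"
    and wp: "M'.eigenbasis 1 wp" and wm: "M'.eigenbasis (- 1) wm"
  shows "N.eigenbasis 1 (tB_list wp vp @ tB_list wm vm)"
    and "N.eigenbasis (- 1) (tB_list wp vm @ tB_list wm vp)"
proof -
  let ?P = "tB_list wp vp @ tB_list wm vm" and ?Q = "tB_list wp vm @ tB_list wm vp"
  note M = M.eigenbasis_append[OF vp vm] and M' = M'.eigenbasis_append[OF wp wm]
  let ?S = "set (vp @ vm) \<times> set (wp @ wm)"
  note T = tensor_basis[OF M(2) M'(2)]
  have PQ_set: "set ?P \<union> set ?Q = case_prod tB ` ?S"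
    by (auto simp: image_iff)
  have eq: "?P @ ?Q = map (\<lambda>(w, v). tB v w)
      (List.product wp vp @ List.product wm vm @ List.product wp vm @ List.product wm vp)"
    by simp
  have "distinct (List.product wp vp @ List.product wm vm @ List.product wp vm @ List.product wm vp)"
    using M(1) M'(1) by (auto simp: distinct_product)
  moreover have "inj_on (\<lambda>(w, v). tB v w) (set (wp @ wm) \<times> set (vp @ vm))"
    using T(1) by (auto simp: inj_on_def)
  then have "inj_on (\<lambda>(w, v). tB v w)
      (set (List.product wp vp @ List.product wm vm @ List.product wp vm @ List.product wm vp))"
    by (rule inj_on_subset) auto
  ultimately have dist: "distinct (?P @ ?Q)" unfolding eq distinct_map by (rule conjI)
  have ind: "N.B.independent (set ?P \<union> set ?Q)" and span: "N.B.span (set ?P \<union> set ?Q) = UNIV"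
    using T(2) unfolding PQ_set by (auto simp: is_basis_def)
  have M_eig: "rho M v = scaleB M 1 v" if "v \<in> set vp" for v
    using that vp M.B.span_base unfolding M.eigenbasis_def is_basis_def eigenspace_def by blast
  have M_eig': "rho M v = scaleB M (- 1) v" if "v \<in> set vm" for v
    using that vm M.B.span_base unfolding M.eigenbasis_def is_basis_def eigenspace_def by blast
  have M'_eig: "rho M' v = scaleB M' 1 v" if "v \<in> set wp" for v
    using that wp M'.B.span_base unfolding M'.eigenbasis_def is_basis_def eigenspace_def by blast
  have M'_eig': "rho M' v = scaleB M' (- 1) v" if "v \<in> set wm" for v
    using that wm M'.B.span_base unfolding M'.eigenbasis_def is_basis_def eigenspace_def by blast
  note eig = M_eig M_eig' M'_eig M'_eig'
  have PQ: "set ?P \<subseteq> eigenspace N 1" "set ?Q \<subseteq> eigenspace N (- 1)"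
    by (auto simp: eigenspace_def rho_tB eig tB_scale
        simp del: M.B.scale_minus_left M'.B.scale_minus_left N.B.scale_minus_left)
  note P = N.B.span_minimal[OF PQ(1) N.eigenspace_subspace]
    and Q = N.B.span_minimal[OF PQ(2) N.eigenspace_subspace]
  have split: "\<exists>x\<in>N.B.span (set ?P). \<exists>y\<in>N.B.span (set ?Q). v = x + y" for v
    using span unfolding N.B.span_Un by blast
  have P': "eigenspace N 1 \<subseteq> N.B.span (set ?P)"
  proof
    fix v assume v: "v \<in> eigenspace N 1"
    obtain x y where xy: "x \<in> N.B.span (set ?P)" "y \<in> N.B.span (set ?Q)" "v = x + y" using split by blast
    have "y \<in> eigenspace N 1"
      using N.B.subspace_diff[OF N.eigenspace_subspace v, of x] xy P by auto
    then have "y = 0" using xy(2) Q N.eigenspaces_disjoint by blast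
    then show "v \<in> N.B.span (set ?P)" using xy by simp
  qed
  have Q': "eigenspace N (- 1) \<subseteq> N.B.span (set ?Q)"
  proof
    fix v assume v: "v \<in> eigenspace N (- 1)"
    obtain x y where xy: "x \<in> N.B.span (set ?P)" "y \<in> N.B.span (set ?Q)" "v = x + y" using split by blast
    have "x \<in> eigenspace N (- 1)"
      using N.B.subspace_diff[OF N.eigenspace_subspace v, of y] xy Q by auto
    then have "x = 0" using xy(1) P N.eigenspaces_disjoint by blast
    then show "v \<in> N.B.span (set ?Q)" using xy by simp
  qed
  note span_eq = subset_antisym[OF P P'] subset_antisym[OF Q Q']
  have "N.B.independent (set ?P)" "N.B.independent (set ?Q)"
    using N.B.independent_mono[OF ind] by blast+
  moreover have "distinct ?P" "distinct ?Q"
    using dist unfolding distinct_append[of ?P ?Q] by blast+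
  ultimately show "N.eigenbasis 1 ?P" "N.eigenbasis (- 1) ?Q"
    using span_eq unfolding N.eigenbasis_def is_basis_def by blast+
qed

definition frame_product ::
    "(int \<times> 'b2 tensor_C) list \<Rightarrow> (int \<times> 'b1 tensor_C) list \<Rightarrow> (int \<times> 'b3 tensor_C) list" where
  "frame_product fs L = map (\<lambda>(f, e). (fst e + fst f, snd e \<boxtimes> snd f)) (List.product fs L)"

text \<open>Types add under tensor products. For generation, the reflected half of the frame of M
  needs care: the list offers \<rho> e \<otimes> \<rho> f, but not \<rho> e \<otimes> f.\<close>

lemma hodge_frame_product:
  assumes fs: "M'.hodge_frame fs" and L: "M.hodge_frame (L @ map M.reflect L)"
    and dim: "N.D.dim UNIV = 2 * (length fs * length L)"
  shows "N.hodge_frame (frame_product fs L @ map N.reflect (frame_product fs L))"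
proof -
  let ?K = "frame_product fs L"
  let ?S = "snd ` set (?K @ map N.reflect ?K)"
  have mem: "snd e \<boxtimes> snd f \<in> ?S" "N.rhoC (snd e \<boxtimes> snd f) \<in> ?S" if "e \<in> set L" "f \<in> set fs" for e f
  proof -
    have "(fst e + fst f, snd e \<boxtimes> snd f) \<in> set ?K" using that by (force simp: frame_product_def)
    moreover from this have "N.reflect (fst e + fst f, snd e \<boxtimes> snd f) \<in> set (map N.reflect ?K)"
      unfolding set_map by (rule imageI)
    ultimately show "snd e \<boxtimes> snd f \<in> ?S" "N.rhoC (snd e \<boxtimes> snd f) \<in> ?S"
      unfolding set_append by (force simp del: set_map)+
  qed
  have spanL: "M.BC.span (snd ` set L \<union> M.rhoC ` snd ` set L) = UNIV"
    using L by (simp add: M.hodge_frame_def image_Un image_image)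
  have span: "M'.BC.span (snd ` set fs) = UNIV" using fs by (simp add: M'.hodge_frame_def)
  have span': "M'.BC.span (M'.rhoC ` snd ` set fs) = UNIV"
    using M'.rhoC.span_image span M'.rhoC_surj by simp
  have "x \<boxtimes> y \<in> N.BC.span ?S" for x y
  proof (rule span_tensC_left[of "snd ` set L \<union> M.rhoC ` snd ` set L"])
    show "x \<in> M.BC.span (snd ` set L \<union> M.rhoC ` snd ` set L)" using spanL by simp
    fix x assume "x \<in> snd ` set L \<union> M.rhoC ` snd ` set L"
    then show "x \<boxtimes> y \<in> N.BC.span ?S"
    proof
      assume x: "x \<in> snd ` set L"
      show ?thesis
        by (rule span_tensC_right[of "snd ` set fs"]) (use x mem(1) span N.BC.span_base in auto)
    next
      assume "x \<in> M.rhoC ` snd ` set L"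
      then obtain e where e: "e \<in> set L" "x = M.rhoC (snd e)" by blast
      \<comment> \<open>For this half the \<rho>-images of \<open>fs\<close> are taken as generators
        of V', because \<rho> e \<otimes> \<rho> f = \<rho>(e \<otimes> f).\<close>
      show ?thesis
      proof (rule span_tensC_right[of "M'.rhoC ` snd ` set fs"])
        fix y assume "y \<in> M'.rhoC ` snd ` set fs"
        then obtain f where "f \<in> set fs" "y = M'.rhoC (snd f)" by blast
        then show "x \<boxtimes> y \<in> N.BC.span ?S"
          using mem(2)[OF e(1)] e(2) by (intro N.BC.span_base) (simp add: rhoC_tensC)
      qed (simp add: span')
    qed
  qed
  then have "N.BC.span ?S = UNIV" by (rule span_tensC_UNIV)
  moreover have hom: "N.homogeneous ?K"
    unfolding N.homogeneous_def
  proof clarify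
    fix a z assume "(a, z) \<in> set ?K"
    then obtain e f where ef: "e \<in> set L" "f \<in> set fs" "a = fst e + fst f" "z = snd e \<boxtimes> snd f"
      by (auto simp: frame_product_def)
    have "snd e \<in> hodge M (fst e) (weight M - fst e)" "snd f \<in> hodge M' (fst f) (weight M' - fst f)"
      using L fs ef(1,2) by (auto simp: M.hodge_frame_def M'.hodge_frame_def M.homogeneous_def M'.homogeneous_def)
    from hodge_tensC[OF this] show "z \<in> hodge N a (weight N - a)"
      by (simp add: ef weight_N algebra_simps)
  qed
  moreover have "N.homogeneous (?K @ map N.reflect ?K)"
    using hom N.homogeneous_reflect[OF hom] by (auto simp: N.homogeneous_def)
  ultimately show ?thesis
    using dim by (simp add: N.hodge_frame_def frame_product_def)
qed

text \<open>For each \<open>w\<close>, tensoring with \<open>w\<close> carries the relation on M to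
  one block of determinant \<open>d\<close>; concatenating the blocks gives the power.\<close>

lemma rel_det_product:
  assumes "M.BC.rel_det (map ext vs) us d"
  shows "N.BC.rel_det (map ext (tB_list ws vs))
     (map (\<lambda>(w, u). u \<boxtimes> ext w) (List.product ws us)) (d ^ length ws)"
proof -
  have "N.BC.rel_det (map (\<lambda>v. ext v \<boxtimes> ext w) vs) (map (\<lambda>u. u \<boxtimes> ext w) us) d" for w
    using rel_det_map[OF module_hom_tensC_left[of "ext w"] assms] by (simp add: o_def)
  then have "N.BC.rel_det (concat (map (\<lambda>w. map (\<lambda>v. ext v \<boxtimes> ext w) vs) ws))
      (concat (map (\<lambda>w. map (\<lambda>u. u \<boxtimes> ext w) us) ws)) (d ^ length ws)"
    by (intro N.BC.rel_det_concat)
  then show ?thesis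
    by (simp add: product_concat_map map_concat o_def ext_tB)
qed

text \<open>\<open>P\<close> and \<open>Q\<close> arise from each other by exchanging symmetrized
  and antisymmetrized vectors of M. The factors from M' are expanded in rational eigenvectors, with
  coefficients unaffected by that exchange; this is the source of the common coefficient
  matrix.\<close>

lemma symmetrize_tensC:
  assumes wp: "M'.eigenbasis 1 wp" and wm: "M'.eigenbasis (- 1) wm" and e: "e \<in> set es"
  defines "P \<equiv> map (\<lambda>(w, u). u \<boxtimes> ext w) (List.product wp (map (M.symmetrize 1) es)) @
      map (\<lambda>(w, u). u \<boxtimes> ext w) (List.product wm (map (M.symmetrize (- 1)) es))"
    and "Q \<equiv> map (\<lambda>(w, u). u \<boxtimes> ext w) (List.product wp (map (M.symmetrize (- 1)) es)) @
      map (\<lambda>(w, u). u \<boxtimes> ext w) (List.product wm (map (M.symmetrize 1) es))"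
  shows "N.BC.corresponds P Q (N.symmetrize 1 (e \<boxtimes> f)) (N.symmetrize (- 1) (e \<boxtimes> f))"
proof -
  let ?p = "M.symmetrize 1 e" and ?m = "M.symmetrize (- 1) e"
  let ?fp = "M'.symmetrize 1 f" and ?fm = "M'.symmetrize (- 1) f"
  have prod: "List.product ws (map g es) = map (\<lambda>(w, e). (w, g e)) (List.product ws es)"
    for ws :: "'b2 list" and g :: "'b1 tensor_C \<Rightarrow> 'b1 tensor_C"
    by (simp add: product_concat_map map_concat o_def)
  \<comment> \<open>\<open>corresponds\<close> compares positions, so the exchange is recorded as
    the set of pairs standing at equal positions.\<close>
  have zip: "set (zip P Q) = (\<lambda>(w, e). (M.symmetrize 1 e \<boxtimes> ext w, M.symmetrize (- 1) e \<boxtimes> ext w)) ` (set wp \<times> set es)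
      \<union> (\<lambda>(w, e). (M.symmetrize (- 1) e \<boxtimes> ext w, M.symmetrize 1 e \<boxtimes> ext w)) ` (set wm \<times> set es)"
    unfolding P_def Q_def prod by (simp add: zip_append zip_map_map zip_same_conv_map o_def case_prod_unfold)
  \<comment> \<open>Both tensors have the same second factor \<open>y\<close>, whose expansion
    supplies the common coefficients.\<close>
  have c: "N.BC.corresponds P Q (x \<boxtimes> y) (x' \<boxtimes> y)"
    if y: "y \<in> M'.BC.span (set (map ext ws))"
      and base: "\<And>w. w \<in> set ws \<Longrightarrow> (x \<boxtimes> ext w, x' \<boxtimes> ext w) \<in> set (zip P Q)" for x x' y ws
    using y
  proof (induction rule: M'.BC.span_induct_alt)
    case base
    show ?case using N.BC.corresponds_zero by (simp add: tensC_rules)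
  next
    case (step c y z)
    then obtain w where w: "w \<in> set ws" "y = ext w" by auto
    then have "N.BC.corresponds P Q (x \<boxtimes> y) (x' \<boxtimes> y)"
      using base N.BC.corresponds_base by simp
    then show ?case using step
      by (simp add: tensC_rules tensC_scale_right N.BC.corresponds_add N.BC.corresponds_scale)
  qed
  have "N.BC.corresponds P Q (?p \<boxtimes> ?fp) (?m \<boxtimes> ?fp)"
  proof (rule c)
    show "?fp \<in> M'.BC.span (set (map ext wp))" using M'.symmetrize_mem_span_eigenbasis[OF _ wp] by simp
    show "(?p \<boxtimes> ext w, ?m \<boxtimes> ext w) \<in> set (zip P Q)" if "w \<in> set wp" for w
      unfolding zip using that e by force
  qed
  moreover have "N.BC.corresponds P Q (?m \<boxtimes> ?fm) (?p \<boxtimes> ?fm)"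
  proof (rule c)
    show "?fm \<in> M'.BC.span (set (map ext wm))" using M'.symmetrize_mem_span_eigenbasis[OF _ wm] by simp
    show "(?m \<boxtimes> ext w, ?p \<boxtimes> ext w) \<in> set (zip P Q)" if "w \<in> set wm" for w
      unfolding zip using that e by force
  qed
  ultimately have "N.BC.corresponds P Q (tens_prod (scaleB N) (ext (1 / 2)) (?p \<boxtimes> ?fp + ?m \<boxtimes> ?fm))
      (tens_prod (scaleB N) (ext (1 / 2)) (?m \<boxtimes> ?fp + ?p \<boxtimes> ?fm))"
    by (intro N.BC.corresponds_scale N.BC.corresponds_add)
  moreover have half: "tens_prod (scaleB N) (ext (1 / 2)) (x + x) = x" for x
  proof -
    have "tens_prod (scaleB N) (ext (1 / 2)) (x + x) = tens_prod (scaleB N) (ext (1 / 2) + ext (1 / 2)) x"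
      by (simp only: N.BC.scale_right_distrib N.BC.scale_left_distrib)
    then show ?thesis by (simp add: ext_one flip: tens_add_left)
  qed
  \<comment> \<open>exchanging \<open>?p\<close> and \<open>?m\<close> turns twice the symmetrization into twice the antisymmetrization\<close>
  have "?p \<boxtimes> ?fp + ?m \<boxtimes> ?fm = N.symmetrize 1 (e \<boxtimes> f) + N.symmetrize 1 (e \<boxtimes> f)"
    by (simp add: M.symmetrize_one M'.symmetrize_one N.symmetrize_one M.symmetrize_minus_one
        M'.symmetrize_minus_one tensC_rules tensC_diff rhoC_tensC)
  moreover have "?m \<boxtimes> ?fp + ?p \<boxtimes> ?fm = N.symmetrize (- 1) (e \<boxtimes> f) + N.symmetrize (- 1) (e \<boxtimes> f)"
    by (simp add: M.symmetrize_one M'.symmetrize_one N.symmetrize_minus_one M.symmetrize_minus_one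
        M'.symmetrize_minus_one tensC_rules tensC_diff rhoC_tensC)
  ultimately show ?thesis by (simp only: half)
qed

end

section \<open>The period group\<close>

lemma coeff_units_simps:
  "carrier coeff_units = {u :: 'e::field_char_0 tensor_C. u dvd 1}"
  "x \<otimes>\<^bsub>coeff_units\<^esub> y = x * (y :: 'e tensor_C)" "\<one>\<^bsub>coeff_units\<^esub> = (1 :: 'e tensor_C)"
  by (simp_all add: coeff_units_def)

lemma comm_group_coeff_units: "comm_group (coeff_units :: 'e::field_char_0 tensor_C monoid)"
proof (rule comm_groupI)
  fix x :: "'e tensor_C" assume "x \<in> carrier coeff_units"
  then obtain y where y: "1 = x * y" by (auto simp: coeff_units_simps elim: dvdE)
  then show "\<exists>y\<in>carrier coeff_units. y \<otimes>\<^bsub>coeff_units\<^esub> x = \<one>\<^bsub>coeff_units\<^esub>"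
    by (intro bexI[of _ y]) (simp_all add: coeff_units_simps mult.commute dvd_triv_right[of y x, folded y])
qed (simp_all add: coeff_units_simps is_unit_mult_iff mult_ac)

lemma subgroup_field_units: "subgroup field_units (coeff_units :: 'e::field_char_0 tensor_C monoid)"
proof -
  interpret comm_group "coeff_units :: 'e tensor_C monoid" by (rule comm_group_coeff_units)
  have inverse: "ext a * ext (inverse a) = (1 :: 'e tensor_C)" if "a \<noteq> 0" for a
    using that by (simp add: ext_mult ext_one)
  have sub: "field_units \<subseteq> carrier (coeff_units :: 'e tensor_C monoid)"
    using inverse by (fastforce simp: field_units_def coeff_units_simps intro: dvdI)
  show ?thesis
  proof (rule subgroupI)
    show "field_units \<subseteq> carrier (coeff_units :: 'e tensor_C monoid)" by (rule sub)
    show "field_units \<noteq> ({} :: 'e tensor_C set)"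
      unfolding field_units_def using one_neq_zero by blast
  next
    fix x :: "'e tensor_C" assume x: "x \<in> field_units"
    then obtain a where a: "x = ext a" "a \<noteq> 0" by (auto simp: field_units_def)
    have "inv\<^bsub>coeff_units\<^esub> x = ext (inverse a)"
    proof (rule inv_equality)
      have "ext (inverse a) \<in> (field_units :: 'e tensor_C set)" using a(2) by (force simp: field_units_def)
      then show "ext (inverse a) \<in> carrier (coeff_units :: 'e tensor_C monoid)" using sub by blast
      show "x \<in> carrier coeff_units" using x sub by blast
      show "ext (inverse a) \<otimes>\<^bsub>coeff_units\<^esub> x = \<one>\<^bsub>coeff_units\<^esub>"
        using inverse[OF a(2)] a(1) by (simp add: coeff_units_simps mult.commute)
    qed
    then show "inv\<^bsub>coeff_units\<^esub> x \<in> field_units" using a(2) by (force simp: field_units_def)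
  next
    fix x y :: "'e tensor_C" assume "x \<in> field_units" "y \<in> field_units"
    then obtain a b where "x = ext a" "a \<noteq> 0" "y = ext b" "b \<noteq> 0" by (auto simp: field_units_def)
    then show "x \<otimes>\<^bsub>coeff_units\<^esub> y \<in> field_units"
      by (auto simp: field_units_def coeff_units_simps ext_mult intro!: exI[of _ "a * b"])
  qed
qed

lemma comm_group_period_group: "comm_group (period_group :: 'e::field_char_0 tensor_C set monoid)"
  unfolding period_group_def
  by (rule comm_group.abelian_FactGroup[OF comm_group_coeff_units subgroup_field_units])

abbreviation period_class :: "'e::field_char_0 tensor_C \<Rightarrow> 'e tensor_C set" where
  "period_class x \<equiv> field_units #>\<^bsub>coeff_units\<^esub> x"

lemma period_class_hom: "period_class \<in> hom (coeff_units :: 'e::field_char_0 tensor_C monoid) period_group"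
  unfolding period_group_def
  by (rule normal.r_coset_hom_Mod)
    (rule comm_group.subgroup_imp_normal[OF comm_group_coeff_units subgroup_field_units])

lemma period_class_closed:
  fixes x :: "'e::field_char_0 tensor_C"
  shows "x dvd 1 \<Longrightarrow> period_class x \<in> carrier period_group"
  using hom_in_carrier[OF period_class_hom] by (simp add: coeff_units_simps)

lemma period_class_mult:
  fixes x :: "'e::field_char_0 tensor_C"
  shows "x dvd 1 \<Longrightarrow> y dvd 1 \<Longrightarrow> period_class (x * y) = period_class x \<otimes>\<^bsub>period_group\<^esub> period_class y"
  using hom_mult[OF period_class_hom, of x y] by (simp add: coeff_units_simps)

lemma is_unit_power: "(x :: 'a::comm_ring_1) dvd 1 \<Longrightarrow> x ^ n dvd 1"
  by (metis dvd_power_same power_one)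

lemma period_class_power:
  fixes x :: "'e::field_char_0 tensor_C"
  assumes "x dvd 1"
  shows "period_class (x ^ n) = period_class x [^]\<^bsub>period_group\<^esub> n"
proof -
  interpret comm_group "period_group :: 'e tensor_C set monoid" by (rule comm_group_period_group)
  show ?thesis
  proof (induction n)
    case 0
    have "period_class (\<one>\<^bsub>coeff_units\<^esub> :: 'e tensor_C) = \<one>\<^bsub>period_group\<^esub>"
      by (rule hom_one[OF period_class_hom comm_group.axioms(2) comm_group.axioms(2)])
        (rule comm_group_coeff_units comm_group_period_group)+
    then show ?case by (simp add: coeff_units_simps)
  next
    case (Suc n)
    have "period_class (x ^ Suc n) = period_class (x ^ n) \<otimes>\<^bsub>period_group\<^esub> period_class x"
      using period_class_mult[OF is_unit_power[OF assms] assms] by (simp add: mult.commute)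
    then show ?case using Suc by simp
  qed
qed

text \<open>With r = c/d the first relation says b = ra. Substituted into the second, it leaves a
  common factor a^(m+n); cancelling this gives x r^n = y r^m.\<close>

lemma (in comm_group) ratio_of_powers:
  assumes [simp]: "a \<in> carrier G" "b \<in> carrier G" "c \<in> carrier G" "d \<in> carrier G" "x \<in> carrier G" "y \<in> carrier G"
    and ab: "c \<otimes> a = d \<otimes> b"
    and xy: "x \<otimes> (a [^] (m::nat) \<otimes> b [^] (n::nat)) = y \<otimes> (b [^] m \<otimes> a [^] n)"
  shows "x \<otimes> inv y = (c \<otimes> inv d) [^] (int m - int n)"
proof -
  define r where "r = c \<otimes> inv d"
  have r [simp]: "r \<in> carrier G" by (simp add: r_def)
  have b: "b = r \<otimes> a"
  proof -
    have "r \<otimes> a = inv d \<otimes> (c \<otimes> a)" by (simp add: r_def m_ac)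
    also have "\<dots> = b" by (simp add: ab inv_solve_left')
    finally show ?thesis ..
  qed
  define z where "z = a [^] m \<otimes> a [^] n"
  have z: "z \<in> carrier G" by (simp add: z_def)
  have "(x \<otimes> r [^] n) \<otimes> z = (y \<otimes> r [^] m) \<otimes> z"
    using xy unfolding b z_def by (simp add: nat_pow_distrib m_ac)
  then have eq: "x \<otimes> r [^] n = y \<otimes> r [^] m"
    using z by (simp add: right_cancel)
  have "x \<otimes> inv y = (x \<otimes> r [^] n) \<otimes> inv (r [^] n) \<otimes> inv y"
    by (simp add: m_assoc)
  also have "\<dots> = (y \<otimes> r [^] m) \<otimes> inv (r [^] n) \<otimes> inv y" by (simp only: eq)
  also have "\<dots> = y \<otimes> (inv y \<otimes> (r [^] m \<otimes> inv (r [^] n)))" by (simp add: m_ac)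
  also have "\<dots> = r [^] m \<otimes> inv (r [^] n)" by (simp flip: m_assoc)
  also have "\<dots> = r [^] (int m - int n)"
    by (simp add: int_pow_diff int_pow_int)
  finally show ?thesis by (simp add: r_def)
qed


section \<open>The ratio of the periods of a tensor product\<close>

context pure_realization
begin

text \<open>Equal eigenspace dimensions force both signs to use one step. Its codimension is half
  the total dimension, hence so is its dimension.\<close>

lemma critical_middle_step:
  assumes crit: "critical M" and eq: "eig_dim M 1 = eig_dim M (- 1)"
  obtains p where "sub_hodge_step M UNIV UNIV 1 (fil M p)" "sub_hodge_step M UNIV UNIV (- 1) (fil M p)"
    and "D.dim UNIV = 2 * eig_dim M 1" "D.dim (fil M p) = eig_dim M 1"
proof -
  obtain F F' where F: "sub_hodge_step M UNIV UNIV 1 F" "sub_hodge_step M UNIV UNIV (- 1) F'"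
    using crit unfolding sub_critical_def by blast
  have "F' = F" using hodge_step_unique[OF F eq] ..
  moreover obtain p where p: "F = fil M p" using F by (auto simp: hodge_step_iff)
  moreover have dim: "D.dim UNIV = 2 * eig_dim M 1"
    using dim_eq_eig_dims dim_betti_eq_dim_de_rham eq by simp
  moreover have "D.dim (fil M p) = eig_dim M 1"
  proof -
    obtain B0 where B0: "finite_dimensional_vector_space (scaleD M) B0" using finite_dimE[OF de_rham] .
    have "D.dim (fil M p) \<le> D.dim UNIV"
      by (rule finite_dimensional_vector_space.dim_subset[OF B0 subset_UNIV])
    moreover have "D.dim UNIV - D.dim (fil M p) = eig_dim M 1" using F(1) by (simp add: p hodge_step_iff)
    ultimately show ?thesis using dim by linarith
  qed
  ultimately show thesis using F that by blast
qed

lemma exists_symmetrize_rel_det: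
  assumes "\<epsilon> = 1 \<or> \<epsilon> = - 1" "eigenbasis \<epsilon> vs" "length us = length vs"
  shows "\<exists>\<alpha>. BC.rel_det (map ext vs) (map (symmetrize \<epsilon>) us) \<alpha>"
proof -
  have "set (map (symmetrize \<epsilon>) us) \<subseteq> BC.span (set (map ext vs))"
    using symmetrize_mem_span_eigenbasis[OF assms(1,2)] by auto
  then show ?thesis using BC.exists_expresses assms(3) by (fastforce simp: BC.rel_det_def)
qed

text \<open>Because of these signs, choosing between e \<otimes> f and its \<rho>-image changes
  determinants at most by \<plusminus>1, a factor from E.\<close>

lemma symmetrize_rhoC: "symmetrize 1 (rhoC x) = symmetrize 1 x"
    "symmetrize (- 1) (rhoC x) = - symmetrize (- 1) x"
  by (simp_all add: symmetrize_one symmetrize_minus_one add.commute)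

end

context tensor_realization
begin

lemma period_ratio_tensor:
  assumes M: "critical M" "eig_dim M 1 = eig_dim M (- 1)" and N: "critical N"
  shows "period_ratio N = period_ratio M
      [^]\<^bsub>period_group :: 'e tensor_C set monoid\<^esub> (int (eig_dim M' 1) - int (eig_dim M' (- 1)))"
proof -
  let ?G = "period_group :: 'e tensor_C set monoid"
  interpret G: comm_group ?G by (rule comm_group_period_group)
  define n where "n = eig_dim M 1"
  obtain vp vm where v: "M.eigenbasis 1 vp" "M.eigenbasis (- 1) vm" using M.exists_eigenbasis by metis
  obtain wp wm where w: "M'.eigenbasis 1 wp" "M'.eigenbasis (- 1) wm" using M'.exists_eigenbasis by metis
  have len_v: "length vp = n" "length vm = n"
    using M.eigenbasis_length[OF v(1)] M.eigenbasis_length[OF v(2)] M(2) by (simp_all add: n_def)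
  have len_w: "length wp = eig_dim M' 1" "length wm = eig_dim M' (- 1)"
    using M'.eigenbasis_length[OF w(1)] M'.eigenbasis_length[OF w(2)] by simp_all
  obtain p where p: "sub_hodge_step M UNIV UNIV 1 (fil M p)" "sub_hodge_step M UNIV UNIV (- 1) (fil M p)"
    "M.D.dim UNIV = 2 * n" "M.D.dim (fil M p) = n"
    using M.critical_middle_step[OF M] unfolding n_def by blast
  obtain bs where bs: "M.hodge_frame bs" using M.exists_hodge_frame by blast
  define L where "L = filter (\<lambda>b. \<not> p \<le> fst b) bs"
  have L: "M.hodge_frame (L @ map M.reflect L)" "length L = n"
    using M.middle_step_half_frame[OF bs, of p] p(3,4) by (simp_all add: L_def)
  define es where "es = map snd L"
  \<comment> \<open>All members of \<open>L\<close> have degree below \<open>p\<close>, so the case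
    distinction in \<open>middle_step_transversal\<close> never takes its first branch.\<close>
  have "es = map (\<lambda>b. if p \<le> fst b then M.rhoC (snd b) else snd b) L"
    unfolding es_def by (intro map_cong) (auto simp: L_def)
  then have es: "M.transversal (fil M p) es"
    using M.middle_step_transversal[OF L(1)] L(2) p(4) by simp
  obtain \<tau> where \<tau>: "\<tau> dvd 1" and per: "\<And>\<epsilon> vs \<alpha>. \<epsilon> = 1 \<or> \<epsilon> = - 1 \<Longrightarrow>
      sub_hodge_step M UNIV UNIV \<epsilon> (fil M p) \<Longrightarrow> M.eigenbasis \<epsilon> vs \<Longrightarrow>
      M.BC.rel_det (map ext vs) (map (M.symmetrize \<epsilon>) es) \<alpha> \<Longrightarrow>
      \<exists>c. c * \<alpha> = \<tau> \<and> period M \<epsilon> = period_class c"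
    using M.period_transversal[OF p(1) es] by blast
  have len_es: "length es = length vp" "length es = length vm" using L(2) len_v by (simp_all add: es_def)
  obtain \<alpha> where \<alpha>: "M.BC.rel_det (map ext vp) (map (M.symmetrize 1) es) \<alpha>"
    using M.exists_symmetrize_rel_det[OF _ v(1) len_es(1)] by blast
  obtain \<beta> where \<beta>: "M.BC.rel_det (map ext vm) (map (M.symmetrize (- 1)) es) \<beta>"
    using M.exists_symmetrize_rel_det[OF _ v(2) len_es(2)] by blast
  obtain c where c: "c * \<alpha> = \<tau>" "period M 1 = period_class c" using per[OF _ p(1) v(1) \<alpha>] by blast
  obtain d where d: "d * \<beta> = \<tau>" "period M (- 1) = period_class d" using per[OF _ p(2) v(2) \<beta>] by blast
  have units: "c dvd 1" "\<alpha> dvd 1" "d dvd 1" "\<beta> dvd 1"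
    using \<tau> c(1) d(1) by (metis dvd_trans dvd_triv_left dvd_triv_right)+

  let ?P = "tB_list wp vp @ tB_list wm vm" and ?Q = "tB_list wp vm @ tB_list wm vp"
  note PQ = tensor_eigenbases[OF v w]
  \<comment> \<open>Since the eigenspaces of M have equal dimension, both eigenspaces of the tensor
    product have dimension \<open>m\<close>, and \<open>critical_middle_step\<close> applies to it
    as well.\<close>
  define m where "m = length wp * n + length wm * n"
  have eig_N: "eig_dim N 1 = m" "eig_dim N (- 1) = m"
    using N.eigenbasis_length[OF PQ(1)] N.eigenbasis_length[OF PQ(2)] len_v by (simp_all add: m_def)
  obtain q where q: "sub_hodge_step N UNIV UNIV 1 (fil N q)" "sub_hodge_step N UNIV UNIV (- 1) (fil N q)"
    "N.D.dim UNIV = 2 * m" "N.D.dim (fil N q) = m"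
    using N.critical_middle_step[OF N] eig_N by auto
  obtain fs where fs: "M'.hodge_frame fs" using M'.exists_hodge_frame by blast
  have len_fs: "length fs * length L = m"
    using fs M'.dim_eq_eig_dims M'.dim_betti_eq_dim_de_rham len_w L(2)
    by (simp add: M'.hodge_frame_def m_def distrib_right)
  define K where "K = frame_product fs L"
  have K: "N.hodge_frame (K @ map N.reflect K)" "length K = m"
    using hodge_frame_product[OF fs L(1)] q(3) len_fs by (simp_all add: K_def frame_product_def)
  \<comment> \<open>Of e \<otimes> f and its \<rho>-image, the one of degree below \<open>q\<close>
    is taken.\<close>
  define us where "us = map (\<lambda>b. if q \<le> fst b then N.rhoC (snd b) else snd b) K"
  have us: "N.transversal (fil N q) us"
    using N.middle_step_transversal[OF K(1)] K(2) q(4) by (simp add: us_def)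
  obtain \<sigma> where \<sigma>: "\<sigma> dvd 1" and per_N: "\<And>\<epsilon> vs \<alpha>. \<epsilon> = 1 \<or> \<epsilon> = - 1 \<Longrightarrow>
      sub_hodge_step N UNIV UNIV \<epsilon> (fil N q) \<Longrightarrow> N.eigenbasis \<epsilon> vs \<Longrightarrow>
      N.BC.rel_det (map ext vs) (map (N.symmetrize \<epsilon>) us) \<alpha> \<Longrightarrow>
      \<exists>c. c * \<alpha> = \<sigma> \<and> period N \<epsilon> = period_class c"
    using N.period_transversal[OF q(1) us] by blast

  let ?sp = "map (M.symmetrize 1) es" and ?sm = "map (M.symmetrize (- 1)) es"
  let ?R = "\<lambda>ws us. map (\<lambda>(w, u). u \<boxtimes> ext w) (List.product ws us)"
  let ?P' = "?R wp ?sp @ ?R wm ?sm" and ?Q' = "?R wp ?sm @ ?R wm ?sp"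
  define a b where "a = length wp" and "b = length wm"
  have rP: "N.BC.rel_det (map ext ?P) ?P' (\<alpha> ^ a * \<beta> ^ b)"
    unfolding map_append a_def b_def by (intro N.BC.rel_det_append rel_det_product \<alpha> \<beta>)
  have rQ: "N.BC.rel_det (map ext ?Q) ?Q' (\<beta> ^ a * \<alpha> ^ b)"
    unfolding map_append a_def b_def by (intro N.BC.rel_det_append rel_det_product \<alpha> \<beta>)
  have K_mem: "\<exists>e\<in>set es. \<exists>f. snd k = e \<boxtimes> f" if "k \<in> set K" for k
  proof -
    have "k \<in> (\<lambda>z. (fst (snd z) + fst (fst z), snd (snd z) \<boxtimes> snd (fst z))) ` (set fs \<times> set L)"
      using that by (simp add: K_def frame_product_def case_prod_unfold)
    then obtain z where "z \<in> set fs \<times> set L" "snd k = snd (snd z) \<boxtimes> snd (fst z)" by auto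
    then show ?thesis
      by (intro bexI[of _ "snd (snd z)"] exI[of _ "snd (fst z)"]) (auto simp: es_def)
  qed
  \<comment> \<open>The factor \<open>g\<close> carries the dependence on the frame of M'; being the
    same for both signs, it cancels in the ratio.\<close>
  have "\<exists>g. N.BC.rel_det ?P' (map (\<lambda>k. N.symmetrize 1 (snd k)) K) g \<and>
      N.BC.rel_det ?Q' (map (\<lambda>k. N.symmetrize (- 1) (snd k)) K) g"
  proof (rule N.BC.rel_det_corresponds)
    have "length es = n" using len_es len_v by simp
    then show "length (map (\<lambda>k. N.symmetrize 1 (snd k)) K) = length ?P'"
      using K(2) by (simp add: m_def)
    have "N.BC.corresponds ?P' ?Q' (N.symmetrize 1 (snd k)) (N.symmetrize (- 1) (snd k))"
      if k: "k \<in> set K" for k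
    proof -
      obtain e f where e: "e \<in> set es" and ef: "snd k = e \<boxtimes> f" using K_mem[OF k] by blast
      show ?thesis unfolding ef by (rule symmetrize_tensC[OF w e])
    qed
    then show "list_all2 (N.BC.corresponds ?P' ?Q') (map (\<lambda>k. N.symmetrize 1 (snd k)) K)
        (map (\<lambda>k. N.symmetrize (- 1) (snd k)) K)"
      unfolding list_all2_map1 list_all2_map2 list_all2_same by blast
  qed simp
  then obtain g where g: "N.BC.rel_det ?P' (map (\<lambda>k. N.symmetrize 1 (snd k)) K) g"
    "N.BC.rel_det ?Q' (map (\<lambda>k. N.symmetrize (- 1) (snd k)) K) g" by blast
  have sym_us: "map (N.symmetrize 1) us = map (\<lambda>k. N.symmetrize 1 (snd k)) K"
    by (simp add: us_def N.symmetrize_rhoC)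
  \<comment> \<open>The symmetrizations do not see the choice made in \<open>us\<close>, while the
    antisymmetrizations may change sign; \<open>s\<close> is the product of these signs.\<close>
  have "list_all2 (\<lambda>v u. u = v \<or> u = - v) (map (\<lambda>k. N.symmetrize (- 1) (snd k)) K)
      (map (N.symmetrize (- 1)) us)"
    by (simp add: list_all2_conv_all_nth us_def N.symmetrize_rhoC)
  from N.BC.rel_det_signs[OF this] obtain s where s: "s = 1 \<or> s = - 1"
    "N.BC.rel_det (map (\<lambda>k. N.symmetrize (- 1) (snd k)) K) (map (N.symmetrize (- 1)) us) s" by blast
  have "N.BC.rel_det (map ext ?P) (map (N.symmetrize 1) us) (\<alpha> ^ a * \<beta> ^ b * g)"
    unfolding sym_us by (rule N.BC.rel_det_trans[OF rP g(1)])
  then obtain x where x: "x * (\<alpha> ^ a * \<beta> ^ b * g) = \<sigma>" "period N 1 = period_class x"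
    using per_N[OF _ q(1) PQ(1)] by blast
  have "N.BC.rel_det (map ext ?Q) (map (N.symmetrize (- 1)) us) (\<beta> ^ a * \<alpha> ^ b * g * s)"
    by (rule N.BC.rel_det_trans[OF N.BC.rel_det_trans[OF rQ g(2)] s(2)])
  then obtain y where y: "y * (\<beta> ^ a * \<alpha> ^ b * g * s) = \<sigma>" "period N (- 1) = period_class y"
    using per_N[OF _ q(2) PQ(2)] by blast
  have unit_xg: "x dvd 1" "g dvd 1"
    using \<sigma> x(1) by (metis dvd_trans dvd_triv_left dvd_triv_right mult.assoc)+
  have unit_y: "y dvd 1" using \<sigma> y(1) by (metis dvd_trans dvd_triv_left)
  \<comment> \<open>Both sides equal \<sigma>, the determinant of the transversal of the tensor
    product, which is shared by the two signs.\<close>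
  have "x * (\<alpha> ^ a * \<beta> ^ b) * g = s * y * (\<beta> ^ a * \<alpha> ^ b) * g"
    using x(1) y(1) by (simp add: mult_ac)
  then have xy: "x * (\<alpha> ^ a * \<beta> ^ b) = s * (y * (\<beta> ^ a * \<alpha> ^ b))"
    using dvd_one_cancel_right[OF unit_xg(2)] by (simp add: mult.assoc)
  \<comment> \<open>The sign comes from E, so it is invisible in the period group.\<close>
  have s_ext: "s = ext 1 \<or> s = ext (- 1)"
  proof -
    interpret h: comm_ring_hom "ext :: 'e \<Rightarrow> 'e tensor_C" by (rule comm_ring_hom_ext)
    show ?thesis using s(1) by (simp add: h.hom_uminus ext_one)
  qed
  have "period_class (x * (\<alpha> ^ a * \<beta> ^ b)) = period_class (y * (\<beta> ^ a * \<alpha> ^ b))"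
    unfolding xy using s_ext field_units_coset[of 1] field_units_coset[of "- 1"] by auto
  then have 1: "period_class x \<otimes>\<^bsub>?G\<^esub> (period_class \<alpha> [^]\<^bsub>?G\<^esub> a \<otimes>\<^bsub>?G\<^esub> period_class \<beta> [^]\<^bsub>?G\<^esub> b)
      = period_class y \<otimes>\<^bsub>?G\<^esub> (period_class \<beta> [^]\<^bsub>?G\<^esub> a \<otimes>\<^bsub>?G\<^esub> period_class \<alpha> [^]\<^bsub>?G\<^esub> b)"
    using unit_xg(1) unit_y units
    by (simp add: period_class_mult period_class_power is_unit_power is_unit_mult_iff)
  have 2: "period_class c \<otimes>\<^bsub>?G\<^esub> period_class \<alpha> = period_class d \<otimes>\<^bsub>?G\<^esub> period_class \<beta>"
    using units c(1) d(1) by (simp flip: period_class_mult)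
  have "period_class x \<otimes>\<^bsub>?G\<^esub> inv\<^bsub>?G\<^esub> period_class y
      = (period_class c \<otimes>\<^bsub>?G\<^esub> inv\<^bsub>?G\<^esub> period_class d) [^]\<^bsub>?G\<^esub> (int a - int b)"
    using unit_xg(1) unit_y units
    by (intro G.ratio_of_powers[OF _ _ _ _ _ _ 2 1] period_class_closed)
  then show ?thesis
    unfolding period_ratio_def c(2) d(2) x(2) y(2) a_def b_def len_w .
qed

end

theorem theorem5p1:
  fixes M :: "('e::field_char_0, 'b1::ab_group_add, 'd1::ab_group_add) realization"
    and M' :: "('e, 'b2::ab_group_add, 'd2::ab_group_add) realization"
    and MM' :: "('e, 'b3::ab_group_add, 'd3::ab_group_add) realization"
    and tB :: "'b1 \<Rightarrow> 'b2 \<Rightarrow> 'b3" and tD :: "'d1 \<Rightarrow> 'd2 \<Rightarrow> 'd3"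
  assumes "number_field TYPE('e)"
    and "pure_realization M" and "pure_realization M'" and "pure_realization MM'"
    and "is_tensor_realization tB tD M M' MM'"
    and "critical M" and "eig_dim M 1 = eig_dim M (-1)"
    and "direct_sum_of_critical M'"
    and "critical MM'"
  shows "trace_of (scaleB M') (rho M') = of_int (int (eig_dim M' 1) - int (eig_dim M' (-1))) \<and>
    period_ratio MM' = period_ratio M
      [^]\<^bsub>period_group :: 'e tensor_C set monoid\<^esub> (int (eig_dim M' 1) - int (eig_dim M' (-1)))"
proof -
  interpret tensor_realization M M' MM' tB tD
    using assms(2-5) by (intro tensor_realization.intro tensor_realization_axioms.intro)
  show ?thesis using M'.trace_of_rho period_ratio_tensor assms(6,7,9) by blast
qed

end
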